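(* Let $d\ge2$, $\boldsymbol\beta=(\beta_1,\dots,\beta_d)\in(0,\infty)^d$, $0<L<\infty$, and let $b$ be defined by $b^{-1}=\sum_{i=1}^d\frac1{\beta_i}$. Let $\mathbf X_1,\dots,\mathbf X_n$ be i.i.d. random vectors in $\mathbb R^d$ with continuous marginal distribution functions and copula density $c\in L^2([0,1]^d)$. Let $$\mathcal R^\star\big(\mathcal F_{\boldsymbol\beta}(L)\big)=\inf_{\mathbf N\in\mathbb N^d,\ \mathbf N\neq\mathbf 0}\ \sup_{c\in\mathcal F_{\boldsymbol\beta}(L)}\mathbb E\|\widehat c^{[\mathbf N]}-c\|_2^2$$ and $v_n=n^{-\frac b{2d+b+4}}$. Then $$\mathcal R^\star\big(\mathcal F_{\boldsymbol\beta}(L)\big)\le K\,v_n,\qquad\text{where } K=\frac{Ld(2d+b+4)}{2d+4}\left(\frac{Lbd}{\eta(2d+4)}\right)^{\frac{-b}{2d+b+4}},\quad \eta=8d^2\,3^d+2\cdot3^d .$$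
   Context: $\mathbb N=\{0,1,2,\dots\}$. $Q_m(x)=\sqrt{2m+1}\,L_m(2x-1)$, $x\in[0,1]$, are the orthonormal shifted Legendre polynomials, where $L_0=1$, $L_1(x)=x$, $(m+1)L_{m+1}(x)=(2m+1)xL_m(x)-mL_{m-1}(x)$. Write $\mathbf X_i=(X_{i1},\dots,X_{id})^T$ with marginal distribution functions $F_1,\dots,F_d$, and $\widehat F_j(x)=\frac1n\sum_{i=1}^n\mathbf 1(X_{ij}\le x)$. The copula density $c$ is the Lebesgue density on $[0,1]^d$ of $(F_1(X_{11}),\dots,F_d(X_{1d}))$, with copula coefficients $\rho_{\mathbf m}=\mathbb E\big(\prod_{j=1}^dQ_{m_j}(F_j(X_{1j}))\big)=\int_{[0,1]^d}c(\mathbf u)\prod_{j=1}^dQ_{m_j}(u_j)\,d\mathbf u$. $\mathcal F_{\boldsymbol\beta}(L)$ is the set of copula densities $c\in L^2([0,1]^d)$ with $\sum_{\mathbf m\in\mathbb N^d}\rho_{\mathbf m}^2\big(1+\sum_{i=1}^dm_i^{\beta_i}\big)<L$. For $\mathbf m\in\mathbb N^d$: $\widehat\rho_{\mathbf m}=1$ if $\mathbf m=\mathbf 0$; $\widehat\rho_{\mathbf m}=0$ if exactly $d-1$ components of $\mathbf m$ are zero; and $\widehat\rho_{\mathbf m}=\frac1n\sum_{i=1}^n\prod_{j=1}^dQ_{m_j}(\widehat F_j(X_{ij}))$ otherwise. With $\mathbf m\le\mathbf N$ meaning $m_j\le N_j$ for all $j$, $\widehat c^{[\mathbf N]}(\mathbf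 u)=\sum_{\mathbf m\le\mathbf N}\widehat\rho_{\mathbf m}\prod_{j=1}^dQ_{m_j}(u_j)$. $\|\cdot\|_2$ is the norm of $L^2([0,1]^d)$ (Lebesgue measure); in the supremum, for each $c$ the expectation is taken under sampling from a distribution with continuous margins and copula density $c$. *)

theory Defs
  imports "HOL-Probability.Probability"
begin

section \<open>Shifted Legendre polynomials\<close>

fun legendre :: "nat \<Rightarrow> real \<Rightarrow> real" where
  "legendre 0 x = 1"
| "legendre (Suc 0) x = x"
| "legendre (Suc (Suc m)) x =
     ((2 * real (Suc m) + 1) * x * legendre (Suc m) x - real (Suc m) * legendre m x)
       / (real (Suc m) + 1)"

definition shifted_legendre :: "nat \<Rightarrow> real \<Rightarrow> real" where
  "shifted_legendre m x = sqrt (2 * real m + 1) * legendre m (2 * x - 1)"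

definition tensor_legendre :: "nat ^ 'd \<Rightarrow> real ^ 'd \<Rightarrow> real" where
  "tensor_legendre m u = (\<Prod>j\<in>UNIV. shifted_legendre (m $ j) (u $ j))"


section \<open>Copula densities and their coefficients\<close>

definition unit_cube :: "(real ^ 'd) measure" where
  "unit_cube = restrict_space lborel (cbox 0 1)"

text \<open>The squared norm of \<open>L\<^sup>2([0,1]\<^sup>d)\<close>, with value \<open>\<infinity>\<close> outside that space.\<close>

definition l2_norm_sq :: "(real ^ 'd \<Rightarrow> real) \<Rightarrow> ennreal" where
  "l2_norm_sq f = (\<integral>\<^sup>+ u. ennreal ((f u)\<^sup>2) \<partial>unit_cube)"

definition marginal_cdf :: "(real ^ 'd) measure \<Rightarrow> 'd \<Rightarrow> real \<Rightarrow> real" where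
  "marginal_cdf P j = cdf (distr P borel (\<lambda>x. x $ j))"

text \<open>\<open>P\<close> is the law of a random vector with continuous marginal distribution functions
  \<open>F\<^sub>1, \<dots>, F\<^sub>d\<close>, and \<open>c\<close> is (a Borel version of) the Lebesgue density of
  \<open>(F\<^sub>1(X\<^sub>1), \<dots>, F\<^sub>d(X\<^sub>d))\<close> on the unit cube. Nonnegativity has to be required separately
  because \<open>ennreal\<close> truncates negative values of \<open>c\<close> to \<open>0\<close>.\<close>

definition has_copula_density :: "(real ^ 'd) measure \<Rightarrow> (real ^ 'd \<Rightarrow> real) \<Rightarrow> bool" where
  "has_copula_density P c \<longleftrightarrow>
     prob_space P \<and> sets P = sets borel \<and>
     (\<forall>j. continuous_on UNIV (marginal_cdf P j)) \<and>
     c \<in> borel_measurable unit_cube \<and> (AE u in unit_cube. 0 \<le> c u) \<and>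
     distributed P unit_cube (\<lambda>x. \<chi> j. marginal_cdf P j (x $ j)) (\<lambda>u. ennreal (c u))"

definition copula_coeff :: "(real ^ 'd \<Rightarrow> real) \<Rightarrow> nat ^ 'd \<Rightarrow> real" where
  "copula_coeff c m = (\<integral> u. c u * tensor_legendre m u \<partial>unit_cube)"

lemma legendre_measurable [measurable]: "legendre m \<in> borel_measurable borel"
proof -
  have "continuous_on UNIV (\<lambda>x. legendre m x)"
    by (induction m rule: induct_nat_012) (auto simp only: legendre.simps intro!: continuous_intros)
  then show ?thesis by (simp add: borel_measurable_continuous_onI)
qed

lemma tensor_legendre_measurable: "tensor_legendre m \<in> borel_measurable unit_cube"
proof -
  have "tensor_legendre m \<in> borel_measurable borel"
    unfolding tensor_legendre_def[abs_def] shifted_legendre_def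
    by (intro borel_measurable_prod borel_measurable_times borel_measurable_const
          measurable_compose[OF _ legendre_measurable] borel_measurable_diff) simp_all
  then show ?thesis
    unfolding unit_cube_def by (auto intro: measurable_restrict_space1)
qed

lemma copula_coeff_eq_expectation:
  assumes "has_copula_density P c"
  shows "copula_coeff c m =
    (\<integral> x. (\<Prod>j\<in>UNIV. shifted_legendre (m $ j) (marginal_cdf P j (x $ j))) \<partial>P)"
proof -
  let ?T = "\<lambda>x. \<chi> j. marginal_cdf P j (x $ j)"
  have c: "c \<in> borel_measurable unit_cube" "AE u in unit_cube. 0 \<le> c u"
    and D: "distributed P unit_cube ?T (\<lambda>u. ennreal (c u))"
    using assms unfolding has_copula_density_def by blast+
  have eq: "(\<lambda>u. ennreal (c u)) = (\<lambda>u. ennreal (max 0 (c u)))"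
    by (rule ext) (simp add: max_def ennreal_neg)
  have D': "distributed P unit_cube ?T (\<lambda>u. ennreal (max 0 (c u)))"
    using D by (rule subst[OF eq])
  have "copula_coeff c m = (\<integral> u. max 0 (c u) * tensor_legendre m u \<partial>unit_cube)"
    unfolding copula_coeff_def
  proof (rule integral_cong_AE)
    show "(\<lambda>u. c u * tensor_legendre m u) \<in> borel_measurable unit_cube"
      by (intro borel_measurable_times c(1) tensor_legendre_measurable)
    show "(\<lambda>u. max 0 (c u) * tensor_legendre m u) \<in> borel_measurable unit_cube"
      by (intro borel_measurable_times borel_measurable_max borel_measurable_const c(1)
            tensor_legendre_measurable)
    show "AE u in unit_cube. c u * tensor_legendre m u = max 0 (c u) * tensor_legendre m u"
      using c(2) by eventually_elim simp
  qed
  also have "\<dots> = (\<integral> x. tensor_legendre m (?T x) \<partial>P)"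
    by (rule distributed_integral[OF D' tensor_legendre_measurable]) simp
  finally show ?thesis by (simp add: tensor_legendre_def)
qed

definition copula_class :: "real ^ 'd \<Rightarrow> real \<Rightarrow> (real ^ 'd \<Rightarrow> real) set" where
  "copula_class \<beta> L =
     {c. (\<exists>P. has_copula_density P c) \<and>
         integrable unit_cube (\<lambda>u. (c u)\<^sup>2) \<and>
         (\<lambda>m. (copula_coeff c m)\<^sup>2 * (1 + (\<Sum>i\<in>UNIV. real (m $ i) powr (\<beta> $ i)))) summable_on UNIV \<and>
         (\<Sum>\<^sub>\<infinity>m. (copula_coeff c m)\<^sup>2 * (1 + (\<Sum>i\<in>UNIV. real (m $ i) powr (\<beta> $ i)))) < L}"


section \<open>The projection estimator and its minimal maximal risk\<close>

text \<open>A sample of size \<open>n\<close> is a function \<open>x\<close> on \<open>{..<n}\<close>; i.i.d. sampling from \<open>P\<close> is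
  the product measure \<open>\<Pi>\<^sub>M i\<in>{..<n}. P\<close>.\<close>

definition ecdf :: "nat \<Rightarrow> (nat \<Rightarrow> real ^ 'd) \<Rightarrow> 'd \<Rightarrow> real \<Rightarrow> real" where
  "ecdf n x j t = (\<Sum>i<n. of_bool (x i $ j \<le> t)) / real n"

definition coeff_est :: "nat \<Rightarrow> (nat \<Rightarrow> real ^ 'd) \<Rightarrow> nat ^ 'd \<Rightarrow> real" where
  "coeff_est n x m =
     (if m = 0 then 1
      else if card {j. m $ j = 0} = CARD('d) - 1 then 0
      else (\<Sum>i<n. tensor_legendre m (\<chi> j. ecdf n x j (x i $ j))) / real n)"

definition density_est :: "nat \<Rightarrow> (nat \<Rightarrow> real ^ 'd) \<Rightarrow> nat ^ 'd \<Rightarrow> real ^ 'd \<Rightarrow> real" where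
  "density_est n x N u = (\<Sum>m | m \<le> N. coeff_est n x m * tensor_legendre m u)"

definition risk ::
    "nat \<Rightarrow> (real ^ 'd) measure \<Rightarrow> (real ^ 'd \<Rightarrow> real) \<Rightarrow> nat ^ 'd \<Rightarrow> ennreal" where
  "risk n P c N =
     (\<integral>\<^sup>+ x. l2_norm_sq (\<lambda>u. density_est n x N u - c u) \<partial>(\<Pi>\<^sub>M i\<in>{..<n}. P))"

text \<open>The sampling distribution \<open>P\<close> is not determined by \<open>c\<close>, so the supremum runs over every
  admissible \<open>P\<close>. (By invariance of ranks under increasing transformations, the risk does not
  depend on the choice of \<open>P\<close>.)\<close>

definition projection_minimax_risk :: "nat \<Rightarrow> (real ^ 'd \<Rightarrow> real) set \<Rightarrow> ennreal" where
  "projection_minimax_risk n C =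
     (INF N\<in>{N. N \<noteq> 0}. SUP c\<in>C. SUP P\<in>{P. has_copula_density P c}. risk n P c N)"

end

theory Submission
  imports Defs
begin

text \<open>The tensor Legendre functions \<open>Q\<^sub>m\<close> form an orthonormal basis of \<open>L\<^sup>2([0,1]\<^sup>d)\<close>. Hence the squared loss of
  the estimator with degrees at most \<open>N\<close> is the squared error of the coefficients with \<open>m \<le> N\<close> plus the
  squared bias \<open>\<parallel>c\<parallel>\<^sup>2 - \<Sum>\<^sub>m\<^sub>\<le>\<^sub>N \<rho>\<^sub>m\<^sup>2\<close>. By Parseval the bias is at most \<open>L / W\<close> as soon as every omitted nonzero
  coefficient has smoothness weight at least \<open>W\<close> (\<open>projection_bias_le\<close>).

  An estimated coefficient differs from the true one for two reasons (\<open>estimation_error_le\<close>). An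
  oracle that knows the margins would average \<open>n\<close> independent copies of \<open>Q\<^sub>m(U)\<close>, with variance at most
  \<open>E Q\<^sub>m(U)\<^sup>2 / n\<close>. Replacing the margins by empirical ones moves each argument by
  \<open>ecdf - F\<close> at an observation; given that observation, \<open>n\<close> times this shift is a bounded term plus a sum of
  \<open>n - 1\<close> independent centred indicators, whence its mean square is at most
  \<open>1 / (3 n)\<close>. With \<open>\<bar>L\<^sub>m\<bar> \<le> 1\<close> and \<open>\<bar>L\<^sub>m'\<bar> \<le> m (m + 1) / 2\<close> this gives \<open>estimation_error_polynomial_le\<close>.

  To see the rate, let \<open>t\<close> be a common threshold for the powers \<open>m\<^sub>i powr \<beta>\<^sub>i\<close> and \<open>T = t powr (1 / b)\<close>. With
  \<open>N\<^sub>i = \<lfloor>t powr (1 / \<beta>\<^sub>i)\<rfloor>\<close> one has \<open>\<Prod> N\<^sub>i \<le> T\<close> and bias at most \<open>L / t\<close>. The bound \<open>K v\<close> is the minimum over \<open>t\<close> of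
  \<open>L d / t + \<eta> T ^ (2 d + 4) / n\<close>, and \<open>t\<close> below is its minimiser. It remains to find, for this \<open>t\<close>, degrees whose risk
  is below that sum. There are three regimes.

  \<^item> If \<open>t \<le> 3 d\<close>, estimate nothing: with \<open>N\<close> a coordinate vector the estimator is identically \<open>1\<close>, and its risk is at most
    \<open>L / 3\<close>, because nonconstant coefficients supported on one coordinate vanish and the others have weight at least \<open>3\<close>.

  \<^item> If \<open>t > 3 d\<close> and \<open>T\<close> is not too close to \<open>1\<close>, the choice \<open>N\<^sub>i = \<lfloor>t powr (1 / \<beta>\<^sub>i)\<rfloor>\<close> works. Counting terms crudely produces a
    factor \<open>4 ^ d\<close> where \<open>\<eta>\<close> only offers \<open>3 ^ d\<close>; the high power \<open>T ^ (2 d + 4)\<close> pays for the difference.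

  \<^item> In the remaining case \<open>d \<ge> 5\<close>, \<open>T\<^sup>2 < 4 / 3\<close> and \<open>b \<ge> 32\<close> (\<open>small_spread_consequences\<close>). A class that smooth consists of
    nearly multilinear densities, for which the factor \<open>4 ^ d\<close> is an artefact of bounding \<open>Q\<^sub>m\<^sup>2\<close> by its supremum:
    \<open>\<Sum>\<^sub>m\<^sub>\<le>\<^sub>1 Q\<^sub>m(u)\<^sup>2 = \<Prod>\<^sub>k (1 + 3 (2 u\<^sub>k - 1)\<^sup>2)\<close> has mean at most \<open>3 ^ d / 6\<close> (\<open>multilinear_energy_class_le\<close>). For small
    \<open>n\<close> this mean bounds the whole sum of squares \<open>\<Sum>\<^sub>m\<^sub>\<le>\<^sub>1 \<rho>\<^sub>m\<^sup>2\<close>, and the constant estimator is good enough; for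
    \<open>n \<ge> 48 d\<^sup>2\<close> the rank error is at most this mean times \<open>23 d\<^sup>2 / n\<close> (\<open>rank_shift_multilinear_le\<close>), and all degrees equal
    to \<open>1\<close> work.\<close>

section \<open>Legendre polynomials\<close>

text \<open>The derivatives of the Legendre polynomials, defined by differentiating the recurrence, so that all
  identities between them can be proved by induction.\<close>

fun legendre_deriv :: "nat \<Rightarrow> real \<Rightarrow> real" where
  "legendre_deriv 0 x = 0"
| "legendre_deriv (Suc 0) x = 1"
| "legendre_deriv (Suc (Suc m)) x =
     ((2 * real (Suc m) + 1) * (legendre (Suc m) x + x * legendre_deriv (Suc m) x)
        - real (Suc m) * legendre_deriv m x) / (real (Suc m) + 1)"

lemma has_derivative_legendre [derivative_intros]:
  "(legendre m has_real_derivative legendre_deriv m x) (at x within S)"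
proof (induction m rule: induct_nat_012)
  case 0 show ?case by (simp add: legendre.simps(1)[abs_def])
next
  case 1 show ?case by (simp add: legendre.simps(2)[abs_def])
next
  case (ge2 m)
  show ?case
    unfolding legendre.simps(3)[abs_def] legendre_deriv.simps(3)
    by (rule derivative_eq_intros ge2 refl | simp)+ (simp add: algebra_simps)
qed

text \<open>The induction needs both classical identities at once: each step of one uses the other.\<close>

lemma legendre_deriv_Suc_aux:
  "legendre_deriv (Suc m) x = x * legendre_deriv m x + (real m + 1) * legendre m x \<and>
   x * legendre_deriv (Suc m) x = legendre_deriv m x + (real m + 1) * legendre (Suc m) x"
proof (induction m)
  case 0 show ?case by simp
next
  case (Suc m)
  define p q s a b where "p = legendre_deriv (Suc m) x" and "q = legendre_deriv m x"
    and "s = real m" and "a = legendre (Suc m) x" and "b = legendre m x"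
  have A: "p = x * q + (s + 1) * b" and B: "q = x * p - (s + 1) * a"
    using Suc unfolding p_def q_def s_def a_def b_def by linarith+
  have s: "s + 2 \<noteq> 0" by (simp add: s_def)
  have D: "legendre_deriv (Suc (Suc m)) x * (s + 2) = (2 * s + 3) * (a + x * p) - (s + 1) * q"
    using s by (simp add: p_def q_def s_def a_def b_def field_simps)
  have L: "legendre (Suc (Suc m)) x * (s + 2) = (2 * s + 3) * x * a - (s + 1) * b"
    using s by (simp add: p_def q_def s_def a_def b_def field_simps)
  have "legendre_deriv (Suc (Suc m)) x * (s + 2) = (x * p + (s + 2) * a) * (s + 2)"
    unfolding D B by (simp add: algebra_simps)
  then have A': "legendre_deriv (Suc (Suc m)) x = x * p + (s + 2) * a"
    using s by (simp only: mult_cancel_right) simp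
  have "x * (x * p) = x * q + (s + 1) * (x * a)"
    by (subst B) (simp add: algebra_simps)
  then have "x * (x * p) - p = (s + 1) * (x * a) - (s + 1) * b"
    using A by simp
  then have "x * legendre_deriv (Suc (Suc m)) x = p + legendre (Suc (Suc m)) x * (s + 2)"
    unfolding L A' by (simp add: algebra_simps)
  with A' show ?case by (simp add: p_def a_def s_def algebra_simps)
qed

lemmas legendre_deriv_Suc = legendre_deriv_Suc_aux[THEN conjunct1]
lemmas mult_legendre_deriv_Suc = legendre_deriv_Suc_aux[THEN conjunct2]

lemma legendre_deriv_differentiable:
  "\<exists>D. (legendre_deriv m has_real_derivative D) (at x)"
proof (induction m)
  case 0 show ?case unfolding legendre_deriv.simps(1)[abs_def] by (intro exI[of _ 0] DERIV_const)
next
  case (Suc m)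
  then obtain D where D: "(legendre_deriv m has_real_derivative D) (at x)" by blast
  have "((\<lambda>x. x * legendre_deriv m x + (real m + 1) * legendre m x) has_real_derivative
      (legendre_deriv m x + x * D + (real m + 1) * legendre_deriv m x)) (at x)"
    by (rule derivative_eq_intros D refl | simp)+
  then show ?case unfolding legendre_deriv_Suc[abs_def] by blast
qed

text \<open>Legendre's differential equation in self-adjoint form. It is the source of both orthogonality
  and the bound \<open>\<bar>L\<^sub>m\<bar> \<le> 1\<close>.\<close>

lemma legendre_ode:
  "((\<lambda>x. (1 - x\<^sup>2) * legendre_deriv m x) has_real_derivative
      - (real m * (real m + 1) * legendre m x)) (at x within S)"
proof (cases m)
  case 0 then show ?thesis by (simp add: legendre_deriv.simps(1)[abs_def])
next
  case (Suc k)
  have eq: "(\<lambda>x. (1 - x\<^sup>2) * legendre_deriv (Suc k) x) =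
      (\<lambda>x. (real k + 1) * (legendre k x - x * legendre (Suc k) x))"
  proof
    fix x :: real
    have "x\<^sup>2 * legendre_deriv (Suc k) x = x * (legendre_deriv k x + (real k + 1) * legendre (Suc k) x)"
      by (simp add: mult_legendre_deriv_Suc[symmetric] power2_eq_square)
    then show "(1 - x\<^sup>2) * legendre_deriv (Suc k) x = (real k + 1) * (legendre k x - x * legendre (Suc k) x)"
      using legendre_deriv_Suc[of k x] by (simp add: algebra_simps)
  qed
  have "((\<lambda>x. (real k + 1) * (legendre k x - x * legendre (Suc k) x)) has_real_derivative
      (real k + 1) * (legendre_deriv k x - (legendre (Suc k) x + x * legendre_deriv (Suc k) x))) (at x within S)"
    by (rule derivative_eq_intros refl | simp)+
  moreover have "(real k + 1) * (legendre_deriv k x - (legendre (Suc k) x + x * legendre_deriv (Suc k) x))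
      = - (real m * (real m + 1) * legendre m x)"
    unfolding mult_legendre_deriv_Suc Suc by (simp add: algebra_simps)
  ultimately show ?thesis unfolding Suc eq by simp
qed

lemma legendre_at_ends: "legendre m 1 = 1" "legendre m (-1) = (-1) ^ m"
  by (induction m rule: induct_nat_012) (auto simp: field_simps)

text \<open>By the differential equation, \<open>L\<^sub>m\<^sup>2 + (1 - x\<^sup>2) L\<^sub>m'\<^sup>2 / (m (m + 1))\<close> has derivative \<open>2 x L\<^sub>m'\<^sup>2 / (m (m + 1))\<close>. So it
  decreases on \<open>[-1, 0]\<close>, increases on \<open>[0, 1]\<close>, and equals \<open>1\<close> at both ends.\<close>

lemma abs_legendre_le_1:
  assumes "\<bar>x\<bar> \<le> 1" shows "\<bar>legendre m x\<bar> \<le> 1"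
proof (cases "m = 0")
  case False
  define ev where "ev = real m * (real m + 1)"
  have ev: "ev > 0" using False by (simp add: ev_def)
  define h where "h x = (legendre m x)\<^sup>2 + (1 - x\<^sup>2) * (legendre_deriv m x)\<^sup>2 / ev" for x
  have h: "(h has_real_derivative 2 * x * (legendre_deriv m x)\<^sup>2 / ev) (at x)" for x
  proof -
    obtain D where D: "(legendre_deriv m has_real_derivative D) (at x)"
      using legendre_deriv_differentiable by blast
    have "((\<lambda>x. (1 - x\<^sup>2) * legendre_deriv m x) has_real_derivative
        (- 2 * x * legendre_deriv m x + (1 - x\<^sup>2) * D)) (at x)"
      by (rule derivative_eq_intros D refl | simp)+
    from DERIV_unique[OF this legendre_ode]
    have ode: "(1 - x\<^sup>2) * D = 2 * x * legendre_deriv m x - ev * legendre m x"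
      by (simp add: ev_def)
    have "(h has_real_derivative 2 * legendre m x * legendre_deriv m x +
        (- 2 * x * (legendre_deriv m x)\<^sup>2 + 2 * ((1 - x\<^sup>2) * D) * legendre_deriv m x) / ev) (at x)"
      unfolding h_def[abs_def]
      by (rule derivative_eq_intros D refl | use ev in simp)+ (simp add: power2_eq_square field_simps)?
    moreover have "2 * legendre m x * legendre_deriv m x +
        (- 2 * x * (legendre_deriv m x)\<^sup>2 + 2 * ((1 - x\<^sup>2) * D) * legendre_deriv m x) / ev
       = 2 * x * (legendre_deriv m x)\<^sup>2 / ev"
      unfolding ode using ev by (simp add: field_simps power2_eq_square)
    ultimately show ?thesis by (rule DERIV_cong)
  qed
  have "h x \<le> 1"
  proof (cases "x \<ge> 0")
    case True
    have "h x \<le> h 1"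
    proof (rule DERIV_nonneg_imp_nondecreasing[of x 1 h])
      show "x \<le> 1" using assms by simp
      fix y assume "x \<le> y" "y \<le> 1"
      with True ev show "\<exists>D. (h has_real_derivative D) (at y) \<and> 0 \<le> D"
        by (intro exI[of _ "2 * y * (legendre_deriv m y)\<^sup>2 / ev"] conjI h) simp
    qed
    then show ?thesis by (simp add: h_def legendre_at_ends)
  next
    case False
    have "h x \<le> h (-1)"
    proof (rule DERIV_nonpos_imp_nonincreasing[of "-1" x h])
      show "-1 \<le> x" using assms by simp
      fix y assume "-1 \<le> y" "y \<le> x"
      with False ev show "\<exists>D. (h has_real_derivative D) (at y) \<and> D \<le> 0"
        by (intro exI[of _ "2 * y * (legendre_deriv m y)\<^sup>2 / ev"] conjI h)
          (auto simp: field_simps mult_nonpos_nonneg)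
    qed
    then show ?thesis by (simp add: h_def legendre_at_ends flip: power_mult)
  qed
  moreover have "x\<^sup>2 \<le> 1" using assms by (simp add: abs_square_le_1)
  then have "(1 - x\<^sup>2) * (legendre_deriv m x)\<^sup>2 / ev \<ge> 0" using ev by simp
  ultimately have "(legendre m x)\<^sup>2 \<le> 1" unfolding h_def by linarith
  then show ?thesis by (simp add: abs_square_le_1)
qed simp

text \<open>From \<open>L\<^sub>m\<^sub>+\<^sub>2' - L\<^sub>m' = (2 m + 3) L\<^sub>m\<^sub>+\<^sub>1\<close> and \<open>\<bar>L\<^sub>m\<^sub>+\<^sub>1\<bar> \<le> 1\<close>.\<close>

lemma abs_legendre_deriv_le:
  assumes "\<bar>x\<bar> \<le> 1" shows "\<bar>legendre_deriv m x\<bar> \<le> real m * (real m + 1) / 2"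
proof (induction m rule: induct_nat_012)
  case (ge2 m)
  have "legendre_deriv (Suc (Suc m)) x = legendre_deriv m x + (2 * real m + 3) * legendre (Suc m) x"
    using legendre_deriv_Suc[of "Suc m" x] mult_legendre_deriv_Suc[of x m] by (simp add: algebra_simps)
  moreover have "\<bar>(2 * real m + 3) * legendre (Suc m) x\<bar> \<le> 2 * real m + 3"
    using abs_legendre_le_1[OF assms, of "Suc m"] by (simp add: abs_mult mult_left_le)
  ultimately have "\<bar>legendre_deriv (Suc (Suc m)) x\<bar> \<le> real m * (real m + 1) / 2 + (2 * real m + 3)"
    using ge2(1) by linarith
  also have "\<dots> = real (Suc (Suc m)) * (real (Suc (Suc m)) + 1) / 2" by (simp add: field_simps)
  finally show ?case .
qed auto

lemma continuous_on_legendre [continuous_intros]: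
  "continuous_on S f \<Longrightarrow> continuous_on S (\<lambda>x. legendre m (f x))"
  using continuous_on_compose2[OF DERIV_continuous_on[OF has_derivative_legendre, of UNIV m]] by blast

lemma continuous_on_shifted_legendre [continuous_intros]:
  "continuous_on S f \<Longrightarrow> continuous_on S (\<lambda>x. shifted_legendre m (f x))"
  unfolding shifted_legendre_def by (intro continuous_intros)

lemma abs_shifted_legendre_le:
  assumes "u \<in> {0..1}" shows "\<bar>shifted_legendre m u\<bar> \<le> sqrt (2 * real m + 1)"
  unfolding shifted_legendre_def abs_mult
proof -
  have "\<bar>2 * u - 1\<bar> \<le> 1" using assms by auto
  from abs_legendre_le_1[OF this] show "\<bar>sqrt (2 * real m + 1)\<bar> * \<bar>legendre m (2 * u - 1)\<bar> \<le> sqrt (2 * real m + 1)"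
    by (simp add: mult_left_le)
qed

lemma legendre_lipschitz:
  assumes "u \<in> {0..1}" "v \<in> {0..1}"
  shows "\<bar>legendre m (2 * u - 1) - legendre m (2 * v - 1)\<bar> \<le> real m * (real m + 1) * \<bar>u - v\<bar>"
proof -
  have "norm (legendre m (2 * u - 1) - legendre m (2 * v - 1))
      \<le> (real m * (real m + 1) / 2) * norm ((2 * u - 1) - (2 * v - 1))"
    by (rule field_differentiable_bound[of "{-1..1}" "legendre m" "legendre_deriv m"])
      (use assms in \<open>auto intro!: has_derivative_legendre order_trans[OF abs_legendre_deriv_le]
          simp del: le_divide_eq_numeral1\<close>)
  also have "(2 * u - 1) - (2 * v - 1) = 2 * (u - v)" by simp
  also have "real m * (real m + 1) / 2 * norm (2 * (u - v)) = real m * (real m + 1) * \<bar>u - v\<bar>"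
    by (simp only: real_norm_def abs_mult) simp
  finally show ?thesis by simp
qed

text \<open>The Wronskian \<open>(1 - x\<^sup>2) (L\<^sub>k' L\<^sub>m - L\<^sub>m' L\<^sub>k)\<close> is an antiderivative of a nonzero multiple of \<open>L\<^sub>m L\<^sub>k\<close>, and it
  vanishes at \<open>1\<close> and \<open>-1\<close>.\<close>

lemma has_integral_legendre_orthogonal:
  assumes "m \<noteq> k"
  shows "((\<lambda>u. legendre m (2 * u - 1) * legendre k (2 * u - 1)) has_integral 0) {0..1}"
proof -
  define ev :: "nat \<Rightarrow> real" where "ev j = real j * (real j + 1)" for j
  have ne: "ev m - ev k \<noteq> 0"
  proof
    assume "ev m - ev k = 0"
    then have "(real m - real k) * (real m + real k + 1) = 0" by (simp add: ev_def algebra_simps)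
    then show False using assms by auto
  qed
  define W where "W x = ((1 - x\<^sup>2) * legendre_deriv k x) * legendre m x
      - ((1 - x\<^sup>2) * legendre_deriv m x) * legendre k x" for x
  have W: "(W has_real_derivative (ev m - ev k) * (legendre m x * legendre k x)) (at x)" for x
    unfolding W_def[abs_def]
    by (rule derivative_eq_intros legendre_ode refl | simp)+ (simp add: ev_def algebra_simps)
  have aff: "((\<lambda>u. 2 * u - 1) has_real_derivative 2) (at u within {0..1})" for u :: real
    by (rule derivative_eq_intros refl | simp)+
  have "((\<lambda>u. W (2 * u - 1) / (2 * (ev m - ev k))) has_real_derivative
      (legendre m (2 * u - 1) * legendre k (2 * u - 1))) (at u within {0..1})" for u
    by (rule DERIV_cong[OF DERIV_cdivide[OF DERIV_chain2[OF W aff]]]) (use ne in \<open>simp add: field_simps\<close>)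
  then have "((\<lambda>u. legendre m (2 * u - 1) * legendre k (2 * u - 1)) has_integral
      (W (2 * 1 - 1) / (2 * (ev m - ev k)) - W (2 * 0 - 1) / (2 * (ev m - ev k)))) {0..1}"
    by (intro fundamental_theorem_of_calculus)
      (simp_all flip: has_real_derivative_iff_has_vector_derivative)
  then show ?thesis by (simp add: W_def)
qed

lemma legendre_recurrence:
  "(real m + 2) * legendre (Suc (Suc m)) x = (2 * real m + 3) * (x * legendre (Suc m) x) - (real m + 1) * legendre m x"
proof -
  have 1: "real m + 1 + 1 = real m + 2" "2 * (real m + 1) + 1 = 2 * real m + 3" by simp_all
  have 2: "(real m + 2) * (y / (real m + 2)) = y" for y :: real by simp
  have 3: "real (Suc m) = real m + 1" by simp
  show ?thesis unfolding legendre.simps(3) 3 unfolding 1 2 by (simp only: mult.assoc)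
qed

text \<open>Norms are computed below from equations in which the integrand carries a constant factor.\<close>

lemma has_integral_mult_cancel:
  fixes f :: "real \<Rightarrow> real"
  assumes "((\<lambda>u. k * f u) has_integral k * a) S" "k \<noteq> 0"
  shows "(f has_integral a) S"
  using has_integral_mult_right[OF assms(1), of "1 / k"] assms(2) by simp

text \<open>The integral of \<open>x L\<^sub>m\<^sub>+\<^sub>1 L\<^sub>m\<close> can be computed from the recurrence for \<open>L\<^sub>m\<^sub>+\<^sub>2\<close> and from the one for \<open>L\<^sub>m\<^sub>+\<^sub>1\<close>;
  equating the results links the norms of \<open>L\<^sub>m\<close> and \<open>L\<^sub>m\<^sub>+\<^sub>1\<close>.\<close>

lemma has_integral_legendre_square:
  "((\<lambda>u. (legendre m (2 * u - 1))\<^sup>2) has_integral 1 / (2 * real m + 1)) {0..1}"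
proof (induction m)
  case 0 then show ?case using has_integral_const_real[of "1::real" 0 1] by simp
next
  case (Suc m)
  let ?l = "\<lambda>m u. legendre m (2 * u - 1)"
  have 1: "((\<lambda>u. (real m + 2) * (?l (Suc (Suc m)) u * ?l m u) + (real m + 1) * (?l m u)\<^sup>2) has_integral
      ((real m + 2) * 0 + (real m + 1) * (1 / (2 * real m + 1)))) {0..1}"
    by (intro has_integral_add has_integral_mult_right has_integral_legendre_orthogonal Suc) simp
  have "((\<lambda>u. (2 * real m + 3) * ((2 * u - 1) * ?l (Suc m) u * ?l m u)) has_integral
      (real m + 1) / (2 * real m + 1)) {0..1}"
  proof (rule has_integral_eq_rhs[OF has_integral_eq[OF _ 1]])
    fix u :: real
    have rec: "(real m + 2) * ?l (Suc (Suc m)) u + (real m + 1) * ?l m u = (2 * real m + 3) * ((2 * u - 1) * ?l (Suc m) u)"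
      using legendre_recurrence[of m "2 * u - 1"] by linarith
    have "(real m + 2) * (?l (Suc (Suc m)) u * ?l m u) + (real m + 1) * (?l m u)\<^sup>2
        = ((real m + 2) * ?l (Suc (Suc m)) u + (real m + 1) * ?l m u) * ?l m u"
      by (simp add: power2_eq_square distrib_right mult.assoc del: legendre.simps(3))
    also have "\<dots> = (2 * real m + 3) * ((2 * u - 1) * ?l (Suc m) u * ?l m u)"
      unfolding rec by (simp add: mult.assoc)
    finally show "(real m + 2) * (?l (Suc (Suc m)) u * ?l m u) + (real m + 1) * (?l m u)\<^sup>2
        = (2 * real m + 3) * ((2 * u - 1) * ?l (Suc m) u * ?l m u)" .
  qed simp
  then have cross: "((\<lambda>u. (2 * u - 1) * ?l (Suc m) u * ?l m u) has_integral
      (real m + 1) / ((2 * real m + 1) * (2 * real m + 3))) {0..1}"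
    by (rule has_integral_mult_cancel[OF has_integral_eq_rhs]) simp_all
  show ?case
  proof (cases m)
    case 0
    then show ?thesis using cross by (simp add: power2_eq_square)
  next
    case (Suc k)
    have shift: "real k + 2 = real m + 1" "2 * real k + 3 = 2 * real m + 1" "real k + 1 = real m"
      by (simp_all add: Suc)
    have 2: "((\<lambda>u. (2 * real m + 1) * ((2 * u - 1) * ?l (Suc m) u * ?l m u)
        - real m * (?l (Suc m) u * ?l k u)) has_integral
        ((2 * real m + 1) * ((real m + 1) / ((2 * real m + 1) * (2 * real m + 3))) - real m * 0)) {0..1}"
      by (intro has_integral_diff has_integral_mult_right has_integral_legendre_orthogonal cross)
        (simp add: Suc)
    have "((\<lambda>u. (real m + 1) * (?l (Suc m) u)\<^sup>2) has_integral (real m + 1) / (2 * real m + 3)) {0..1}"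
    proof (rule has_integral_eq_rhs[OF has_integral_eq[OF _ 2]])
      fix u :: real
      have gen: "(a * (w * p) - b * q) * r = a * (w * r * p) - b * (r * q)" for a b p q r w :: real
        by (simp add: algebra_simps)
      have rec: "(real m + 1) * ?l (Suc m) u = (2 * real m + 1) * ((2 * u - 1) * ?l m u) - real m * ?l k u"
        using legendre_recurrence[of k "2 * u - 1", folded Suc] unfolding shift by (simp only: mult.assoc)
      have "(real m + 1) * (?l (Suc m) u)\<^sup>2 = ((real m + 1) * ?l (Suc m) u) * ?l (Suc m) u"
        by (simp only: power2_eq_square mult.assoc)
      also have "\<dots> = (2 * real m + 1) * ((2 * u - 1) * ?l (Suc m) u * ?l m u) - real m * (?l (Suc m) u * ?l k u)"
        unfolding rec by (rule gen)
      finally show "(2 * real m + 1) * ((2 * u - 1) * ?l (Suc m) u * ?l m u) - real m * (?l (Suc m) u * ?l k u)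
          = (real m + 1) * (?l (Suc m) u)\<^sup>2" by (rule sym)
    next
      show "(real m + 1) / (2 * real m + 3)
          = (2 * real m + 1) * ((real m + 1) / ((2 * real m + 1) * (2 * real m + 3))) - real m * 0"
        by simp
    qed
    then have "((\<lambda>u. (?l (Suc m) u)\<^sup>2) has_integral 1 / (2 * real m + 3)) {0..1}"
      by (rule has_integral_mult_cancel[OF has_integral_eq_rhs]) simp_all
    moreover have "2 * real m + 3 = 2 * real (Suc m) + 1" by simp
    ultimately show ?thesis by simp
  qed
qed

lemma integral_shifted_legendre:
  "(LINT u:{0..1}|lborel. shifted_legendre m u * shifted_legendre k u) = (if m = k then 1 else 0)"
proof -
  have cont: "continuous_on {0..1} (\<lambda>u. shifted_legendre m u * shifted_legendre k u)"
    by (intro continuous_intros)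
  have eq: "shifted_legendre m u * shifted_legendre k u = sqrt (2 * real m + 1) * sqrt (2 * real k + 1)
      * (legendre m (2 * u - 1) * legendre k (2 * u - 1))" for u
    by (simp add: shifted_legendre_def)
  have "((\<lambda>u. shifted_legendre m u * shifted_legendre k u) has_integral (if m = k then 1 else 0)) {0..1}"
  proof (cases "m = k")
    case True
    have "((\<lambda>u. (2 * real m + 1) * (legendre m (2 * u - 1))\<^sup>2) has_integral
        (2 * real m + 1) * (1 / (2 * real m + 1))) {0..1}"
      by (rule has_integral_mult_right[OF has_integral_legendre_square])
    moreover have "(2 * real m + 1) * (legendre m (2 * u - 1))\<^sup>2 = shifted_legendre m u * shifted_legendre k u" for u
      unfolding shifted_legendre_def True by (simp add: power2_eq_square)
    ultimately show ?thesis using True by simp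
  next
    case False
    have "((\<lambda>u. shifted_legendre m u * shifted_legendre k u) has_integral
        sqrt (2 * real m + 1) * sqrt (2 * real k + 1) * 0) {0..1}"
      unfolding eq by (rule has_integral_mult_right[OF has_integral_legendre_orthogonal[OF False]])
    then show ?thesis using False by simp
  qed
  then show ?thesis
    by (intro trans[OF set_borel_integral_eq_integral(2)[OF borel_integrable_atLeastAtMost'[OF cont]]] integral_unique)
qed

section \<open>The tensor Legendre basis of the unit cube\<close>

lemma finite_vec_atMost [simp]: "finite {m :: nat ^ 'd. m \<le> N}"
proof -
  have "{m :: nat ^ 'd. m \<le> N} \<subseteq> vec_lambda ` PiE UNIV (\<lambda>i. {..N $ i})"
  proof
    fix m :: "nat ^ 'd" assume "m \<in> {m. m \<le> N}"
    then have "(\<lambda>i. m $ i) \<in> PiE UNIV (\<lambda>i. {..N $ i})" by (auto simp: less_eq_vec_def)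
    then show "m \<in> vec_lambda ` PiE UNIV (\<lambda>i. {..N $ i})"
      by (metis image_eqI vec_nth_inverse)
  qed
  then show ?thesis by (rule finite_subset) (simp add: finite_PiE)
qed

text \<open>Sums over a box of multi-indices factorise; this is how all sums over \<open>m \<le> N\<close> are evaluated.\<close>

lemma sum_prod_vec_atMost:
  fixes f :: "'d::finite \<Rightarrow> nat \<Rightarrow> real"
  shows "(\<Sum>m | m \<le> N. \<Prod>j\<in>UNIV. f j (m $ j)) = (\<Prod>j\<in>UNIV. \<Sum>i\<le>N $ j. f j i)"
proof -
  have "(\<Prod>j\<in>UNIV. \<Sum>i\<le>N $ j. f j i) = (\<Sum>g\<in>PiE UNIV (\<lambda>j. {..N $ j}). \<Prod>j\<in>UNIV. f j (g j))"
    by (rule prod_sum_PiE) auto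
  also have "\<dots> = (\<Sum>m | m \<le> N. \<Prod>j\<in>UNIV. f j (m $ j))"
    by (rule sum.reindex_bij_witness[of _ vec_nth vec_lambda])
      (auto simp: less_eq_vec_def vec_lambda_inverse vec_nth_inverse)
  finally show ?thesis by simp
qed

lemma mem_unit_cube: "u \<in> space (unit_cube :: (real ^ 'd) measure) \<longleftrightarrow> (\<forall>j. u $ j \<in> {0..1})"
  by (simp add: unit_cube_def space_restrict_space mem_box_cart)

lemma borel_measurable_unit_cube: "f \<in> borel_measurable borel \<Longrightarrow> f \<in> borel_measurable unit_cube"
  unfolding unit_cube_def by (auto intro: measurable_restrict_space1)

lemma Basis_vec_axis: "(Basis :: (real ^ 'd) set) = (\<lambda>j. axis j 1) ` UNIV"
  by (auto simp: Basis_vec_def)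

text \<open>Fubini for product integrands, transported along the isomorphism between the product measure over
  \<open>Basis\<close> and Lebesgue measure on vectors.\<close>

lemma integral_lborel_prod:
  fixes h :: "'d::finite \<Rightarrow> real \<Rightarrow> real"
  assumes int: "\<And>j. integrable lborel (h j)"
  shows "(LINT u|lborel. (\<Prod>j\<in>UNIV. h j ((u :: real ^ 'd) $ j))) = (\<Prod>j\<in>UNIV. (LINT x|lborel. h j x))"
proof -
  interpret product_sigma_finite "\<lambda>_::real ^ 'd. lborel :: real measure" ..
  let ?ax = "\<lambda>j::'d. axis j (1::real)"
  define h' where "h' b = h (inv ?ax b)" for b
  have inj: "inj ?ax" by (auto intro!: injI simp: axis_eq_axis)
  have [measurable]: "h j \<in> borel_measurable borel" for j using int[of j] by simp
  have meas: "(\<lambda>f. \<Sum>b\<in>Basis. f b *\<^sub>R b) \<in> (\<Pi>\<^sub>M b\<in>(Basis :: (real ^ 'd) set). lborel) \<rightarrow>\<^sub>M borel"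
    by measurable
  have comp: "(\<Sum>b\<in>Basis. f b *\<^sub>R b) $ j = f (?ax j)" for f and j :: 'd
  proof -
    have "(\<Sum>b\<in>Basis. f b *\<^sub>R b) $ j = (\<Sum>b\<in>Basis. f b *\<^sub>R b) \<bullet> ?ax j" by (simp add: inner_axis)
    also have "\<dots> = f (?ax j)" by (intro inner_sum_left_Basis) (auto simp: Basis_vec_axis)
    finally show ?thesis .
  qed
  have prod_eq: "(\<Prod>j\<in>UNIV. h j (f (?ax j))) = (\<Prod>b\<in>Basis. h' b (f b))" for f
    unfolding Basis_vec_axis by (subst prod.reindex[OF inj]) (simp add: h'_def inv_f_f[OF inj])
  have "(LINT u|lborel. (\<Prod>j\<in>UNIV. h j ((u :: real ^ 'd) $ j))) =
      (LINT f|(\<Pi>\<^sub>M b\<in>(Basis :: (real ^ 'd) set). lborel). (\<Prod>j\<in>UNIV. h j ((\<Sum>b\<in>Basis. f b *\<^sub>R b) $ j)))"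
    unfolding lborel_eq[where ?'a = "real ^ 'd"] by (rule integral_distr[OF meas]) measurable
  also have "\<dots> = (LINT f|(\<Pi>\<^sub>M b\<in>(Basis :: (real ^ 'd) set). lborel). (\<Prod>b\<in>Basis. h' b (f b)))"
    unfolding comp by (simp only: prod_eq)
  also have "\<dots> = (\<Prod>b\<in>(Basis :: (real ^ 'd) set). (LINT x|lborel. h' b x))"
    by (rule product_integral_prod) (auto simp: h'_def int)
  also have "\<dots> = (\<Prod>j\<in>UNIV. (LINT x|lborel. h j x))"
    unfolding Basis_vec_axis by (subst prod.reindex[OF inj]) (simp add: h'_def inv_f_f[OF inj])
  finally show ?thesis .
qed

lemma integral_unit_cube_prod:
  fixes g :: "'d::finite \<Rightarrow> real \<Rightarrow> real"
  assumes "\<And>j. continuous_on {0..1} (g j)"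
  shows "(LINT u|unit_cube. (\<Prod>j\<in>UNIV. g j (u $ j))) = (\<Prod>j\<in>UNIV. (LINT x:{0..1}|lborel. g j x))"
proof -
  have ind: "indicator (cbox 0 1) u = (\<Prod>j\<in>UNIV. indicator {0..1} (u $ j) :: real)" for u :: "real ^ 'd"
    by (auto simp: indicator_def mem_box_cart)
  have "(LINT u|unit_cube. (\<Prod>j\<in>UNIV. g j (u $ j)))
      = (LINT u|lborel. (\<Prod>j\<in>UNIV. indicator {0..1} (u $ j) *\<^sub>R g j (u $ j)))"
    unfolding unit_cube_def by (subst integral_restrict_space) (simp_all add: ind prod.distrib)
  also have "\<dots> = (\<Prod>j\<in>UNIV. (LINT x|lborel. indicator {0..1} x *\<^sub>R g j x))"
    using borel_integrable_atLeastAtMost'[OF assms]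
    by (intro integral_lborel_prod) (simp add: set_integrable_def)
  finally show ?thesis by (simp add: set_lebesgue_integral_def)
qed

lemma prob_space_unit_cube: "prob_space (unit_cube :: (real ^ 'd) measure)"
proof
  have "(1::real ^ 'd) \<bullet> b = 1" if "b \<in> Basis" for b
    using that by (auto simp: Basis_vec_axis inner_axis)
  then have "emeasure lborel (cbox 0 (1::real ^ 'd)) = 1"
    by (simp add: emeasure_lborel_cbox_eq)
  then show "emeasure unit_cube (space (unit_cube :: (real ^ 'd) measure)) = 1"
    by (simp add: unit_cube_def space_restrict_space emeasure_restrict_space)
qed

interpretation cube: prob_space unit_cube
  by (rule prob_space_unit_cube)

lemma abs_tensor_legendre_le:
  assumes "\<And>j. u $ j \<in> {0..1}"
  shows "\<bar>tensor_legendre m u\<bar> \<le> (\<Prod>j\<in>UNIV. sqrt (2 * real (m $ j) + 1))"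
  unfolding tensor_legendre_def abs_prod
  by (intro prod_mono conjI abs_ge_zero abs_shifted_legendre_le assms)

lemma integrable_tensor_legendre_mult:
  "integrable unit_cube (\<lambda>u. tensor_legendre m u * tensor_legendre k u)"
proof (rule cube.integrable_const_bound)
  show "AE u in unit_cube. norm (tensor_legendre m u * tensor_legendre k u)
      \<le> (\<Prod>j\<in>UNIV. sqrt (2 * real (m $ j) + 1)) * (\<Prod>j\<in>UNIV. sqrt (2 * real (k $ j) + 1))"
    by (rule AE_I2) (auto simp: mem_unit_cube abs_mult intro!: mult_mono abs_tensor_legendre_le prod_nonneg)
  show "(\<lambda>u. tensor_legendre m u * tensor_legendre k u) \<in> borel_measurable unit_cube"
    by (intro borel_measurable_times tensor_legendre_measurable)
qed

lemma integral_tensor_legendre_mult: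
  fixes m k :: "nat ^ 'd"
  shows "(LINT u|unit_cube. tensor_legendre m u * tensor_legendre k u) = (if m = k then 1 else 0)"
proof -
  have "(LINT u|unit_cube. tensor_legendre m u * tensor_legendre k u)
      = (LINT u|unit_cube. (\<Prod>j\<in>UNIV. shifted_legendre (m $ j) (u $ j) * shifted_legendre (k $ j) (u $ j)))"
    by (simp add: tensor_legendre_def prod.distrib)
  also have "\<dots> = (\<Prod>j\<in>UNIV. if m $ j = k $ j then 1 else 0)"
    by (subst integral_unit_cube_prod) (auto intro!: continuous_intros simp: integral_shifted_legendre)
  also have "\<dots> = (if m = k then 1 else 0)" by (auto simp: vec_eq_iff)
  finally show ?thesis .
qed

lemma integrable_of_square:
  assumes "c \<in> borel_measurable unit_cube" "integrable unit_cube (\<lambda>u. (c u)\<^sup>2)"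
  shows "integrable unit_cube (c :: real ^ 'd \<Rightarrow> real)"
proof (rule Bochner_Integration.integrable_bound)
  show "integrable unit_cube (\<lambda>u. 1 + (c u)\<^sup>2)" using assms by simp
  show "AE u in unit_cube. norm (c u) \<le> norm (1 + (c u)\<^sup>2)"
  proof (rule AE_I2)
    fix u
    have "0 \<le> (\<bar>c u\<bar> - 1)\<^sup>2 + (c u)\<^sup>2" by simp
    then show "norm (c u) \<le> norm (1 + (c u)\<^sup>2)" by (simp add: power2_diff)
  qed
qed (rule assms)

lemma integrable_mult_tensor_legendre:
  fixes c :: "real ^ 'd \<Rightarrow> real"
  assumes "c \<in> borel_measurable unit_cube" "integrable unit_cube (\<lambda>u. (c u)\<^sup>2)"
  shows "integrable unit_cube (\<lambda>u. c u * tensor_legendre m u)"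
proof (rule Bochner_Integration.integrable_bound)
  show "integrable unit_cube (\<lambda>u. (\<Prod>j\<in>UNIV. sqrt (2 * real (m $ j) + 1)) * c u)"
    using integrable_of_square[OF assms] by simp
  show "(\<lambda>u. c u * tensor_legendre m u) \<in> borel_measurable unit_cube"
    by (intro borel_measurable_times assms tensor_legendre_measurable)
  show "AE u in unit_cube. norm (c u * tensor_legendre m u)
      \<le> norm ((\<Prod>j\<in>UNIV. sqrt (2 * real (m $ j) + 1)) * c u)"
  proof (rule AE_I2)
    fix u :: "real ^ 'd" assume "u \<in> space unit_cube"
    then have "\<bar>tensor_legendre m u\<bar> \<le> (\<Prod>j\<in>UNIV. sqrt (2 * real (m $ j) + 1))"
      by (intro abs_tensor_legendre_le) (simp add: mem_unit_cube)
    also have "\<dots> \<le> \<bar>\<Prod>j\<in>UNIV. sqrt (2 * real (m $ j) + 1)\<bar>" by simp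
    finally show "norm (c u * tensor_legendre m u) \<le> norm ((\<Prod>j\<in>UNIV. sqrt (2 * real (m $ j) + 1)) * c u)"
      unfolding real_norm_def abs_mult by (subst mult.commute) (rule mult_right_mono, simp_all)
  qed
qed

text \<open>Pythagoras: the \<open>L\<^sup>2\<close> distance from \<open>c\<close> to a combination of basis functions splits into the distance to the
  projection of \<open>c\<close> and the error of the coefficients.\<close>

lemma integral_square_diff_expansion:
  assumes c: "c \<in> borel_measurable unit_cube" "integrable unit_cube (\<lambda>u. (c u)\<^sup>2)" and A: "finite A"
  shows "integrable unit_cube (\<lambda>u. ((\<Sum>m\<in>A. a m * tensor_legendre m u) - c u)\<^sup>2)" (is ?int)
    and "(LINT u|unit_cube. ((\<Sum>m\<in>A. a m * tensor_legendre m u) - c u)\<^sup>2)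
      = (LINT u|unit_cube. (c u)\<^sup>2) - (\<Sum>m\<in>A. (copula_coeff c m)\<^sup>2) + (\<Sum>m\<in>A. (a m - copula_coeff c m)\<^sup>2)" (is ?eq)
proof -
  let ?Q = tensor_legendre
  have expand: "((\<Sum>m\<in>A. a m * ?Q m u) - c u)\<^sup>2 = (\<Sum>m\<in>A. \<Sum>k\<in>A. (a m * a k) * (?Q m u * ?Q k u))
      - 2 * (\<Sum>m\<in>A. a m * (c u * ?Q m u)) + (c u)\<^sup>2" for u
  proof -
    have "(\<Sum>m\<in>A. a m * ?Q m u)\<^sup>2 = (\<Sum>m\<in>A. \<Sum>k\<in>A. (a m * a k) * (?Q m u * ?Q k u))"
      by (simp add: power2_eq_square sum_product mult_ac)
    moreover have "(\<Sum>m\<in>A. a m * ?Q m u) * c u = (\<Sum>m\<in>A. a m * (c u * ?Q m u))"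
      by (simp add: sum_distrib_left sum_distrib_right mult_ac)
    ultimately show ?thesis by (simp add: power2_diff)
  qed
  note int = integrable_tensor_legendre_mult integrable_mult_tensor_legendre[OF c] c(2)
  show ?int unfolding expand by (intro Bochner_Integration.integrable_add Bochner_Integration.integrable_diff
        integrable_mult_right Bochner_Integration.integrable_sum int)
  have "(LINT u|unit_cube. ((\<Sum>m\<in>A. a m * ?Q m u) - c u)\<^sup>2) =
      (\<Sum>m\<in>A. \<Sum>k\<in>A. (a m * a k) * (if m = k then 1 else 0))
      - 2 * (\<Sum>m\<in>A. a m * copula_coeff c m) + (LINT u|unit_cube. (c u)\<^sup>2)"
    unfolding expand
    by (simp add: int Bochner_Integration.integral_add Bochner_Integration.integral_diff
        Bochner_Integration.integral_sum integral_tensor_legendre_mult copula_coeff_def)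
  also have "(\<Sum>m\<in>A. \<Sum>k\<in>A. (a m * a k) * (if m = k then 1 else 0)) = (\<Sum>m\<in>A. (a m)\<^sup>2)"
    using A by (simp add: power2_eq_square if_distrib cong: if_cong sum.cong)
  finally show ?eq
    by (simp add: power2_diff sum.distrib sum_subtractf sum_distrib_left mult_ac)
qed

section \<open>Completeness of the basis and the projection bias\<close>

text \<open>The linear span of the basis functions, presented so that closure properties follow by rule induction.\<close>

inductive_set legendre_span :: "(real ^ 'd \<Rightarrow> real) set" where
  zero: "(\<lambda>u. 0) \<in> legendre_span"
| add_term: "f \<in> legendre_span \<Longrightarrow> (\<lambda>u. a * tensor_legendre m u + f u) \<in> legendre_span"

lemma legendre_span_add: "f \<in> legendre_span \<Longrightarrow> g \<in> legendre_span \<Longrightarrow> (\<lambda>u. f u + g u) \<in> legendre_span"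
proof (induction rule: legendre_span.induct)
  case (add_term f a m)
  then have "(\<lambda>u. a * tensor_legendre m u + (f u + g u)) \<in> legendre_span"
    by (intro legendre_span.add_term) simp
  then show ?case by (simp add: add.assoc)
qed simp

lemma legendre_span_scale: "f \<in> legendre_span \<Longrightarrow> (\<lambda>u. b * f u) \<in> legendre_span"
proof (induction rule: legendre_span.induct)
  case (add_term f a m)
  then have "(\<lambda>u. (b * a) * tensor_legendre m u + b * f u) \<in> legendre_span"
    by (intro legendre_span.add_term)
  then show ?case by (simp add: distrib_left mult.assoc)
qed (simp add: legendre_span.zero)

lemma legendre_span_tensor: "(\<lambda>u. a * tensor_legendre m u) \<in> legendre_span"
  using legendre_span.add_term[OF legendre_span.zero] by simp

lemma legendre_span_sum:
  "(\<And>i. i \<in> I \<Longrightarrow> f i \<in> legendre_span) \<Longrightarrow> (\<lambda>u. \<Sum>i\<in>I. f i u) \<in> legendre_span"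
  by (induction I rule: infinite_finite_induct) (simp_all add: legendre_span.zero legendre_span_add)

lemma legendre_span_obtain:
  assumes "f \<in> legendre_span"
  obtains A a where "finite A" "\<And>u. f u = (\<Sum>m\<in>A. a m * tensor_legendre m u)"
proof -
  from assms have "\<exists>A a. finite A \<and> (\<forall>u. f u = (\<Sum>m\<in>A. a m * tensor_legendre m u))"
  proof (induction rule: legendre_span.induct)
    case zero show ?case by (intro exI[of _ "{}"]) simp
  next
    case (add_term f b k)
    then obtain A a where A: "finite A" "\<And>u. f u = (\<Sum>m\<in>A. a m * tensor_legendre m u)" by blast
    define a' where "a' m = (if m \<in> A then a m else 0) + (if m = k then b else 0)" for m
    have "b * tensor_legendre k u + f u = (\<Sum>m\<in>insert k A. a' m * tensor_legendre m u)" for u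
    proof -
      have "(\<Sum>m\<in>insert k A. (if m \<in> A then a m else 0) * tensor_legendre m u) = (\<Sum>m\<in>A. a m * tensor_legendre m u)"
        using A(1) by (intro sum.mono_neutral_cong_right) auto
      moreover have "(\<Sum>m\<in>insert k A. (if m = k then b else 0) * tensor_legendre m u) = b * tensor_legendre k u"
        using A(1) by (subst sum.remove[of _ k]) (auto intro!: sum.neutral)
      ultimately show ?thesis by (simp only: a'_def distrib_right sum.distrib A(2))
    qed
    then show ?case using A(1) by (intro exI[of _ "insert k A"] exI[of _ a']) auto
  qed
  then show ?thesis using that by blast
qed

text \<open>The three-term recurrence, read as an expansion of \<open>u Q\<^sub>k(u)\<close>; for \<open>k = 0\<close> the term with \<open>k - 1\<close> gets coefficient \<open>0\<close>.\<close>

lemma mult_shifted_legendre: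
  "\<exists>a b. \<forall>u. u * shifted_legendre k u = a * shifted_legendre (Suc k) u + b * shifted_legendre (k - 1) u
      + (1 / 2) * shifted_legendre k u"
proof (cases k)
  case 0
  have "u * shifted_legendre k u = (1 / (2 * sqrt 3)) * shifted_legendre (Suc k) u + 0 * shifted_legendre (k - 1) u
      + (1 / 2) * shifted_legendre k u" for u
    by (simp add: shifted_legendre_def 0 field_simps)
  then show ?thesis by blast
next
  case (Suc i)
  define a b where "a = (real i + 2) / (2 * (2 * real i + 3)) * sqrt (2 * real k + 1) / sqrt (2 * real (Suc k) + 1)"
    and "b = (real i + 1) / (2 * (2 * real i + 3)) * sqrt (2 * real k + 1) / sqrt (2 * real i + 1)"
  have "u * shifted_legendre k u = a * shifted_legendre (Suc k) u + b * shifted_legendre i u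
      + (1 / 2) * shifted_legendre k u" for u
  proof -
    define x where "x = 2 * u - 1"
    have u: "u = x / 2 + 1 / 2" by (simp add: x_def diff_divide_distrib)
    define p q l where "p = legendre (Suc k) x" and "q = legendre i x" and "l = legendre k x"
    have "(real i + 2) * p = (2 * real i + 3) * (x * l) - (real i + 1) * q"
      using legendre_recurrence[of i x] by (simp only: p_def q_def l_def Suc)
    then have xl: "x * l = ((real i + 2) * p + (real i + 1) * q) / (2 * real i + 3)"
      by (simp add: field_simps)
    have a: "a * (sqrt (2 * real (Suc k) + 1) * p) = (real i + 2) / (2 * (2 * real i + 3)) * sqrt (2 * real k + 1) * p"
      by (simp add: a_def)
    have b: "b * (sqrt (2 * real i + 1) * q) = (real i + 1) / (2 * (2 * real i + 3)) * sqrt (2 * real k + 1) * q"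
      by (simp add: b_def)
    have "u * (sqrt (2 * real k + 1) * l) = sqrt (2 * real k + 1) * (x * l) / 2 + 1 / 2 * (sqrt (2 * real k + 1) * l)"
      unfolding u by (simp add: algebra_simps)
    also have "sqrt (2 * real k + 1) * (x * l) / 2 = a * (sqrt (2 * real (Suc k) + 1) * p) + b * (sqrt (2 * real i + 1) * q)"
      unfolding a b xl by (simp add: add_divide_distrib distrib_left mult_ac)
    finally show ?thesis
      unfolding shifted_legendre_def x_def[symmetric] p_def[symmetric] q_def[symmetric] l_def[symmetric] .
  qed
  then show ?thesis using Suc by auto
qed

lemma legendre_span_coord: "f \<in> legendre_span \<Longrightarrow> (\<lambda>u. u $ j * f u) \<in> legendre_span"
proof (induction rule: legendre_span.induct)
  case (add_term f c m)
  define upd where "upd k = (\<chi> i. if i = j then k else m $ i)" for k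
  have split: "tensor_legendre (upd k) u = shifted_legendre k (u $ j) * (\<Prod>i\<in>UNIV - {j}. shifted_legendre (m $ i) (u $ i))" for k u
    unfolding tensor_legendre_def
    by (subst prod.remove[of _ j]) (auto simp: upd_def intro!: prod.cong arg_cong2[where f = "(*)"])
  have upd_self: "upd (m $ j) = m" by (simp add: upd_def vec_eq_iff)
  obtain a b where ab: "\<And>v. v * shifted_legendre (m $ j) v = a * shifted_legendre (Suc (m $ j)) v
      + b * shifted_legendre (m $ j - 1) v + (1 / 2) * shifted_legendre (m $ j) v"
    using mult_shifted_legendre[of "m $ j"] by blast
  have coord: "u $ j * tensor_legendre m u = a * tensor_legendre (upd (Suc (m $ j))) u
      + b * tensor_legendre (upd (m $ j - 1)) u + (1 / 2) * tensor_legendre m u" for u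
  proof -
    have "u $ j * tensor_legendre (upd (m $ j)) u = (u $ j * shifted_legendre (m $ j) (u $ j))
        * (\<Prod>i\<in>UNIV - {j}. shifted_legendre (m $ i) (u $ i))"
      unfolding split by (rule mult.assoc[symmetric])
    also have "\<dots> = a * tensor_legendre (upd (Suc (m $ j))) u
      + b * tensor_legendre (upd (m $ j - 1)) u + (1 / 2) * tensor_legendre (upd (m $ j)) u"
      unfolding ab split by (simp only: distrib_right mult.assoc)
    finally show ?thesis unfolding upd_self .
  qed
  have "(\<lambda>u. c * (a * tensor_legendre (upd (Suc (m $ j))) u + b * tensor_legendre (upd (m $ j - 1)) u
      + (1 / 2) * tensor_legendre m u) + u $ j * f u) \<in> legendre_span"
    by (intro legendre_span_add legendre_span_scale legendre_span_tensor add_term)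
  moreover have "(\<lambda>u. u $ j * (c * tensor_legendre m u + f u)) = (\<lambda>u. c * (u $ j * tensor_legendre m u) + u $ j * f u)"
    by (simp add: distrib_left mult_ac)
  ultimately show ?case unfolding coord by simp
qed (simp add: legendre_span.zero)

text \<open>The span is an ideal under multiplication by polynomials, since it is closed under multiplication by
  coordinates. As it contains the constant \<open>1\<close>, it contains all polynomials.\<close>

lemma polynomial_mult_legendre_span:
  "real_polynomial_function p \<Longrightarrow> f \<in> legendre_span \<Longrightarrow> (\<lambda>u. p u * f u) \<in> legendre_span"
proof (induction arbitrary: f rule: real_polynomial_function.induct)
  case (linear p)
  interpret p: bounded_linear p by fact
  have "p u = (\<Sum>j\<in>UNIV. p (axis j 1) * u $ j)" for u
  proof -
    have "p (\<Sum>j\<in>UNIV. (u $ j) *\<^sub>R axis j 1) = (\<Sum>j\<in>UNIV. p (axis j 1) * u $ j)"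
      by (simp add: p.sum p.scaleR mult.commute)
    moreover have "(\<Sum>j\<in>UNIV. (u $ j) *\<^sub>R axis j 1) = u"
      using basis_expansion[of u] by (simp add: scalar_mult_eq_scaleR)
    ultimately show ?thesis by simp
  qed
  note rep = this
  have "(\<lambda>u. p u * f u) = (\<lambda>u. \<Sum>j\<in>UNIV. p (axis j 1) * (u $ j * f u))"
  proof
    fix u show "p u * f u = (\<Sum>j\<in>UNIV. p (axis j 1) * (u $ j * f u))"
      by (simp only: rep[of u] sum_distrib_right mult.assoc)
  qed
  also have "\<dots> \<in> legendre_span"
    by (intro legendre_span_sum legendre_span_scale legendre_span_coord linear.prems)
  finally show ?case .
next
  case (const c) then show ?case by (rule legendre_span_scale)
next
  case (add p q)
  then show ?case unfolding distrib_right by (intro legendre_span_add)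
next
  case (mult p q)
  then show ?case unfolding mult.assoc by blast
qed

lemma polynomial_in_legendre_span:
  fixes p :: "real ^ 'd \<Rightarrow> real"
  assumes "real_polynomial_function p" shows "p \<in> legendre_span"
proof -
  have "(\<lambda>u. 1 * tensor_legendre (0 :: nat ^ 'd) u) = (\<lambda>u. 1)"
    by (simp add: tensor_legendre_def shifted_legendre_def)
  then have "(\<lambda>u. 1) \<in> (legendre_span :: (real ^ 'd \<Rightarrow> real) set)" by (metis legendre_span_tensor)
  from polynomial_mult_legendre_span[OF assms this] show ?thesis by simp
qed

lemma continuous_approx_legendre_span:
  fixes f :: "real ^ 'd \<Rightarrow> real"
  assumes "continuous_on (cbox 0 1) f" "0 < e"
  obtains p where "p \<in> legendre_span" "\<And>u. u \<in> cbox 0 1 \<Longrightarrow> \<bar>f u - p u\<bar> < e"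
  using Stone_Weierstrass_real_polynomial_function[OF compact_cbox assms] polynomial_in_legendre_span by metis

text \<open>Truncation keeps a sequence of continuous approximations bounded, so that almost everywhere convergence
  implies \<open>L\<^sup>2\<close> convergence.\<close>

definition clip :: "real \<Rightarrow> real \<Rightarrow> real" where
  "clip B y = max (- B) (min B y)"

lemma abs_clip_le: "0 \<le> B \<Longrightarrow> \<bar>clip B y\<bar> \<le> B"
  by (auto simp: clip_def)

lemma continuous_on_clip: "continuous_on S f \<Longrightarrow> continuous_on S (\<lambda>x. clip B (f x))"
  unfolding clip_def by (intro continuous_intros)

lemma clip_measurable [measurable]: "clip B \<in> borel_measurable borel"
  using continuous_on_clip[of UNIV "\<lambda>x. x" B] by (intro borel_measurable_continuous_onI) simp

lemma abs_diff_clip_le: "0 \<le> B \<Longrightarrow> \<bar>y - clip B y\<bar> \<le> \<bar>y\<bar>"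
  by (auto simp: clip_def)

text \<open>Truncate \<open>c\<close> at a high level, write the truncation as an almost everywhere limit of continuous functions, truncate
  these too, and use dominated convergence twice.\<close>

lemma L2_approx_continuous:
  fixes c :: "real ^ 'd \<Rightarrow> real"
  assumes c: "c \<in> borel_measurable unit_cube" "integrable unit_cube (\<lambda>u. (c u)\<^sup>2)" and "0 < e"
  obtains f where "continuous_on UNIV f" "integrable unit_cube (\<lambda>u. (c u - f u)\<^sup>2)"
    "(LINT u|unit_cube. (c u - f u)\<^sup>2) < e"
proof -
  have "(\<lambda>n. LINT u|unit_cube. (c u - clip (real n) (c u))\<^sup>2) \<longlonglongrightarrow> (LINT u|(unit_cube :: (real ^ 'd) measure). 0)"
  proof (rule integral_dominated_convergence)
    show "integrable unit_cube (\<lambda>u. (c u)\<^sup>2)" by fact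
    show "AE u in unit_cube. (\<lambda>n. (c u - clip (real n) (c u))\<^sup>2) \<longlonglongrightarrow> 0"
    proof (rule AE_I2, rule tendsto_eventually)
      fix u
      show "\<forall>\<^sub>F n in sequentially. (c u - clip (real n) (c u))\<^sup>2 = 0"
        using eventually_ge_at_top[of "nat \<lceil>\<bar>c u\<bar>\<rceil>"] by eventually_elim (auto simp: clip_def)
    qed
    show "AE u in unit_cube. norm ((c u - clip (real n) (c u))\<^sup>2) \<le> (c u)\<^sup>2" for n
      by (rule AE_I2) (simp add: abs_le_square_iff[symmetric] abs_diff_clip_le)
  qed (use c in measurable)
  from order_tendstoD(2)[OF this, of "e / 4"] \<open>0 < e\<close>
  have "\<forall>\<^sub>F n in sequentially. (LINT u|unit_cube. (c u - clip (real n) (c u))\<^sup>2) < e / 4" by simp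
  then obtain n where n: "(LINT u|unit_cube. (c u - clip (real n) (c u))\<^sup>2) < e / 4"
    by (auto simp: eventually_sequentially)
  define B where "B = real n"
  have B: "0 \<le> B" by (simp add: B_def)
  define b where "b u = clip B (c u)" for u
  have b[measurable]: "b \<in> borel_measurable unit_cube" using c unfolding b_def by measurable
  define F where "F u = indicator (cbox 0 1) u *\<^sub>R b u" for u
  have "F \<in> borel_measurable lborel"
    using b unfolding F_def unit_cube_def by (subst (asm) borel_measurable_restrict_space_iff) simp_all
  then have "F \<in> borel_measurable lebesgue" by (rule measurable_completion)
  then have "F measurable_on UNIV" by (intro lebesgue_measurable_imp_measurable_on) simp_all
  then obtain N g where N: "negligible N" and g: "\<And>n. continuous_on UNIV (g n)"
    and lim: "\<And>u. u \<notin> N \<Longrightarrow> (\<lambda>n. g n u) \<longlonglongrightarrow> F u"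
    unfolding measurable_on_def by auto
  have "AE u in lebesgue. u \<notin> N" using N by (intro AE_not_in) (simp add: negligible_iff_null_sets)
  then have N': "AE u in unit_cube. u \<notin> N"
    unfolding AE_completion_iff unit_cube_def by (subst AE_restrict_space_iff) auto
  have g'[measurable]: "(\<lambda>u. clip B (g k u)) \<in> borel_measurable unit_cube" for k
    by (intro borel_measurable_unit_cube borel_measurable_continuous_onI continuous_on_clip g)
  have bd: "\<bar>b u\<bar> \<le> B" for u unfolding b_def by (rule abs_clip_le[OF B])
  have sq: "(b u - clip B (g k u))\<^sup>2 \<le> (2 * B)\<^sup>2" for u k
    using bd[of u] abs_clip_le[OF B, of "g k u"] B by (intro power2_le_iff_abs_le[THEN iffD2]) auto
  have "(\<lambda>k. LINT u|unit_cube. (b u - clip B (g k u))\<^sup>2) \<longlonglongrightarrow> (LINT u|(unit_cube :: (real ^ 'd) measure). 0)"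
  proof (rule integral_dominated_convergence)
    show "integrable unit_cube (\<lambda>u :: real ^ 'd. (2 * B)\<^sup>2)" by simp
    show "AE u in unit_cube. (\<lambda>k. (b u - clip B (g k u))\<^sup>2) \<longlonglongrightarrow> 0"
      using N' AE_space
    proof eventually_elim
      fix u :: "real ^ 'd" assume u: "u \<notin> N" "u \<in> space unit_cube"
      then have "F u = b u" by (simp add: F_def unit_cube_def space_restrict_space)
      with lim[OF u(1)] have "(\<lambda>k. g k u) \<longlonglongrightarrow> b u" by simp
      then have "(\<lambda>k. (b u - clip B (g k u))\<^sup>2) \<longlonglongrightarrow> (b u - clip B (b u))\<^sup>2"
        unfolding clip_def by (intro tendsto_intros)
      moreover have "clip B (b u) = b u" using B by (auto simp: b_def clip_def)
      ultimately show "(\<lambda>k. (b u - clip B (g k u))\<^sup>2) \<longlonglongrightarrow> 0" by simp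
    qed
    show "AE u in unit_cube. norm ((b u - clip B (g k u))\<^sup>2) \<le> (2 * B)\<^sup>2" for k
      by (rule AE_I2) (use sq in simp)
  qed measurable
  from order_tendstoD(2)[OF this, of "e / 4"] \<open>0 < e\<close>
  have "\<forall>\<^sub>F k in sequentially. (LINT u|unit_cube. (b u - clip B (g k u))\<^sup>2) < e / 4" by simp
  then obtain k where k: "(LINT u|unit_cube. (b u - clip B (g k u))\<^sup>2) < e / 4"
    by (auto simp: eventually_sequentially)
  define f where "f u = clip B (g k u)" for u
  have int1: "integrable unit_cube (\<lambda>u. (c u - b u)\<^sup>2)"
    by (rule Bochner_Integration.integrable_bound[OF c(2)])
      (use c(1) in \<open>auto simp: b_def abs_le_square_iff[symmetric] abs_diff_clip_le[OF B]\<close>)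
  have int2: "integrable unit_cube (\<lambda>u. (b u - f u)\<^sup>2)"
    by (rule cube.integrable_const_bound[where B = "(2 * B)\<^sup>2"]) (use sq in \<open>auto simp: f_def\<close>)
  have le: "(c u - f u)\<^sup>2 \<le> 2 * (c u - b u)\<^sup>2 + 2 * (b u - f u)\<^sup>2" for u
  proof -
    have "(c u - f u)\<^sup>2 + ((c u - b u) - (b u - f u))\<^sup>2 = 2 * (c u - b u)\<^sup>2 + 2 * (b u - f u)\<^sup>2"
      by (simp add: power2_eq_square algebra_simps)
    then show ?thesis using zero_le_power2[of "(c u - b u) - (b u - f u)"] by linarith
  qed
  have int12: "integrable unit_cube (\<lambda>u. 2 * (c u - b u)\<^sup>2 + 2 * (b u - f u)\<^sup>2)"
    using int1 int2 by simp
  have int: "integrable unit_cube (\<lambda>u. (c u - f u)\<^sup>2)"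
    by (rule Bochner_Integration.integrable_bound[OF int12]) (use c(1) le in \<open>auto simp: f_def\<close>)
  have "(LINT u|unit_cube. (c u - f u)\<^sup>2) \<le> (LINT u|unit_cube. 2 * (c u - b u)\<^sup>2 + 2 * (b u - f u)\<^sup>2)"
    by (rule integral_mono[OF int int12 le])
  also have "\<dots> < e" using int1 int2 n k by (simp add: b_def B_def f_def)
  finally have "(LINT u|unit_cube. (c u - f u)\<^sup>2) < e" .
  moreover have "continuous_on UNIV f" unfolding f_def by (intro continuous_on_clip g)
  ultimately show ?thesis using int that by blast
qed

text \<open>By density of polynomials some combination of basis functions is \<open>L\<^sup>2\<close>-close to \<open>c\<close>, and the projection onto the
  same finite set of basis functions is at least as close.\<close>

lemma parseval_tail:
  fixes c :: "real ^ 'd \<Rightarrow> real"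
  assumes c: "c \<in> borel_measurable unit_cube" "integrable unit_cube (\<lambda>u. (c u)\<^sup>2)" and "0 < e"
  obtains A where "finite A" "(LINT u|unit_cube. (c u)\<^sup>2) - (\<Sum>m\<in>A. (copula_coeff c m)\<^sup>2) \<le> e"
proof -
  obtain f where f: "continuous_on UNIV f" "integrable unit_cube (\<lambda>u. (c u - f u)\<^sup>2)"
    "(LINT u|unit_cube. (c u - f u)\<^sup>2) < e / 4"
    using L2_approx_continuous[OF c, of "e / 4"] \<open>0 < e\<close> by auto
  have "continuous_on (cbox 0 1) f" using f(1) continuous_on_subset by blast
  then obtain p where p: "p \<in> legendre_span" "\<And>u. u \<in> cbox 0 1 \<Longrightarrow> \<bar>f u - p u\<bar> < sqrt (e / 4)"
    using continuous_approx_legendre_span[of f "sqrt (e / 4)"] \<open>0 < e\<close> by auto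
  obtain A a where A: "finite A" "\<And>u. p u = (\<Sum>m\<in>A. a m * tensor_legendre m u)"
    using legendre_span_obtain[OF p(1)] by blast
  have "(LINT u|unit_cube. (c u)\<^sup>2) - (\<Sum>m\<in>A. (copula_coeff c m)\<^sup>2) \<le>
      (LINT u|unit_cube. (c u)\<^sup>2) - (\<Sum>m\<in>A. (copula_coeff c m)\<^sup>2) + (\<Sum>m\<in>A. (a m - copula_coeff c m)\<^sup>2)"
    by (simp add: sum_nonneg)
  also have "\<dots> = (LINT u|unit_cube. (p u - c u)\<^sup>2)"
    unfolding A(2) by (rule integral_square_diff_expansion(2)[OF c A(1), symmetric])
  also have "\<dots> \<le> (LINT u|unit_cube. 2 * (c u - f u)\<^sup>2 + 2 * (e / 4))"
  proof (rule integral_mono)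
    show "integrable unit_cube (\<lambda>u. (p u - c u)\<^sup>2)"
      unfolding A(2) by (rule integral_square_diff_expansion(1)[OF c A(1)])
    show "integrable unit_cube (\<lambda>u. 2 * (c u - f u)\<^sup>2 + 2 * (e / 4))" using f(2) by simp
    fix u :: "real ^ 'd" assume "u \<in> space unit_cube"
    then have "\<bar>f u - p u\<bar> < sqrt (e / 4)"
      by (intro p(2)) (simp add: unit_cube_def space_restrict_space)
    then have "\<bar>f u - p u\<bar>\<^sup>2 \<le> (sqrt (e / 4))\<^sup>2" by (intro power_mono) auto
    then have "(f u - p u)\<^sup>2 \<le> e / 4" using \<open>0 < e\<close> by simp
    moreover have "(p u - c u)\<^sup>2 + ((c u - f u) - (f u - p u))\<^sup>2 = 2 * (c u - f u)\<^sup>2 + 2 * (f u - p u)\<^sup>2"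
      by (simp add: power2_eq_square algebra_simps)
    ultimately show "(p u - c u)\<^sup>2 \<le> 2 * (c u - f u)\<^sup>2 + 2 * (e / 4)"
      using zero_le_power2[of "(c u - f u) - (f u - p u)"] by linarith
  qed
  also have "\<dots> = 2 * (LINT u|unit_cube. (c u - f u)\<^sup>2) + 2 * (e / 4)"
    using f(2) by (simp add: cube.prob_space)
  also have "\<dots> \<le> e" using f(3) by simp
  finally show ?thesis using that A(1) by blast
qed

text \<open>Up to an arbitrarily small remainder the bias is a finite sum of omitted squares \<open>\<rho>\<^sub>m\<^sup>2 \<le> \<rho>\<^sub>m\<^sup>2 w\<^sub>m / W\<close>.\<close>

lemma projection_bias_le:
  fixes c :: "real ^ 'd \<Rightarrow> real"
  assumes c: "c \<in> borel_measurable unit_cube" "integrable unit_cube (\<lambda>u. (c u)\<^sup>2)"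
    and w0: "\<And>m. 0 \<le> w m"
    and sum: "\<And>A. finite A \<Longrightarrow> (\<Sum>m\<in>A. (copula_coeff c m)\<^sup>2 * w m) \<le> L"
    and A: "finite A" and W: "0 < W"
    and w: "\<And>m. m \<notin> A \<Longrightarrow> copula_coeff c m \<noteq> 0 \<Longrightarrow> W \<le> w m"
  shows "(LINT u|unit_cube. (c u)\<^sup>2) - (\<Sum>m\<in>A. (copula_coeff c m)\<^sup>2) \<le> L / W"
proof (rule field_le_epsilon)
  fix e :: real assume "0 < e"
  then obtain D where D: "finite D" "(LINT u|unit_cube. (c u)\<^sup>2) - (\<Sum>m\<in>D. (copula_coeff c m)\<^sup>2) \<le> e"
    using parseval_tail[OF c] by blast
  have "(\<Sum>m\<in>D. (copula_coeff c m)\<^sup>2) \<le> (\<Sum>m\<in>A \<union> D. (copula_coeff c m)\<^sup>2)"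
    using A D(1) by (intro sum_mono2) auto
  also have "\<dots> = (\<Sum>m\<in>A. (copula_coeff c m)\<^sup>2) + (\<Sum>m\<in>D - A. (copula_coeff c m)\<^sup>2)"
    using A D(1) by (metis Un_Diff_cancel finite_Diff sum.union_disjoint Diff_disjoint)
  also have "(\<Sum>m\<in>D - A. (copula_coeff c m)\<^sup>2) \<le> (\<Sum>m\<in>D - A. (copula_coeff c m)\<^sup>2 * w m / W)"
  proof (rule sum_mono)
    fix m assume "m \<in> D - A"
    then have "(copula_coeff c m)\<^sup>2 * W \<le> (copula_coeff c m)\<^sup>2 * w m"
      using w[of m] by (cases "copula_coeff c m = 0") (auto intro!: mult_left_mono)
    then show "(copula_coeff c m)\<^sup>2 \<le> (copula_coeff c m)\<^sup>2 * w m / W"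
      using W by (simp add: pos_le_divide_eq)
  qed
  also have "\<dots> = (\<Sum>m\<in>D - A. (copula_coeff c m)\<^sup>2 * w m) / W" by (rule sum_divide_distrib[symmetric])
  also have "\<dots> \<le> L / W" using W sum[of "D - A"] D(1) by (intro divide_right_mono) auto
  finally show "(LINT u|unit_cube. (c u)\<^sup>2) - (\<Sum>m\<in>A. (copula_coeff c m)\<^sup>2) \<le> L / W + e"
    using D(2) by linarith
qed

section \<open>Probability integral transform and moments of samples\<close>

text \<open>The distribution function of \<open>F(X)\<close>. For the upper bound it is enough to compare \<open>{F \<le> u}\<close> with the half-lines
  \<open>{..x}\<close> where \<open>F x = v > u\<close>; this covers flat pieces of \<open>F\<close> and \<open>u = 0\<close> at once.\<close>

lemma (in real_distribution) measure_cdf_le: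
  assumes cont: "continuous_on UNIV (cdf M)"
  shows "measure M {y. cdf M y \<le> u} = max 0 (min 1 u)"
proof -
  have ivt: "\<exists>x. cdf M x = v" if "0 < v" "v < 1" for v
  proof -
    obtain a where a: "cdf M a < v"
      using order_tendstoD(2)[OF cdf_lim_at_bot \<open>0 < v\<close>] by (auto simp: eventually_at_bot_linorder)
    obtain b where b: "v < cdf M b"
      using order_tendstoD(1)[OF cdf_lim_at_top_prob \<open>v < 1\<close>] by (auto simp: eventually_at_top_linorder)
    have "a \<le> b" using a b cdf_nondecreasing[of b a] by linarith
    then show ?thesis
      using IVT'[of "cdf M" a v b] a b continuous_on_subset[OF cont] by fastforce
  qed
  have [measurable]: "cdf M \<in> borel_measurable borel" by (rule borel_measurable_continuous_onI[OF cont])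
  have sets: "{y. cdf M y \<le> u} \<in> sets M" for u by simp
  have upper: "measure M {y. cdf M y \<le> u} \<le> u" if u: "0 \<le> u" "u < 1"
  proof (rule dense_ge_bounded[OF u(2)])
    fix v assume v: "u < v" "v < 1"
    then obtain x where x: "cdf M x = v" using ivt[of v] u by auto
    have "{y. cdf M y \<le> u} \<subseteq> {..x}"
    proof
      fix y assume "y \<in> {y. cdf M y \<le> u}"
      then show "y \<in> {..x}" using x v cdf_nondecreasing[of x y] by (cases "y \<le> x") auto
    qed
    then have "measure M {y. cdf M y \<le> u} \<le> measure M {..x}" by (intro finite_measure_mono) simp_all
    then show "measure M {y. cdf M y \<le> u} \<le> v" using x by (simp add: cdf_def)
  qed
  consider "u < 0" | "u = 0" | "0 < u" "u < 1" | "1 \<le> u" by linarith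
  then show ?thesis
  proof cases
    case 1
    then have "{y. cdf M y \<le> u} = {}" using cdf_nonneg by (force simp: not_le intro: less_le_trans)
    then show ?thesis using 1 by simp
  next
    case 2 then show ?thesis using upper by (simp add: measure_le_0_iff)
  next
    case 3
    then obtain x where x: "cdf M x = u" using ivt by auto
    have "measure M {..x} \<le> measure M {y. cdf M y \<le> u}"
      using x cdf_nondecreasing sets by (intro finite_measure_mono) auto
    then show ?thesis using 3 x upper by (simp add: cdf_def)
  next
    case 4
    then have "{y. cdf M y \<le> u} = space M" using cdf_bounded_prob by (auto intro: order_trans)
    then show ?thesis using 4 prob_space by simp
  qed
qed

lemma (in real_distribution) integral_cdf_uniform:
  fixes g :: "real \<Rightarrow> real"
  assumes cont: "continuous_on UNIV (cdf M)" and g: "continuous_on UNIV g"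
  shows "(LINT x|M. g (cdf M x)) = (LINT u:{0..1}|lborel. g u)"
proof -
  let ?U = "uniform_measure lborel {0..1::real}"
  have [measurable]: "cdf M \<in> borel_measurable borel" by (rule borel_measurable_continuous_onI[OF cont])
  have [measurable]: "g \<in> borel_measurable borel" by (rule borel_measurable_continuous_onI[OF g])
  have "distr M borel (cdf M) = ?U"
  proof (rule cdf_unique)
    show "real_distribution (distr M borel (cdf M))" by (rule real_distribution_distr) measurable
    have "prob_space ?U" by (rule prob_space_uniform_measure) simp_all
    then show "real_distribution ?U"
      by (simp add: real_distribution_def real_distribution_axioms_def)
    show "cdf (distr M borel (cdf M)) = cdf ?U"
    proof
      fix u :: real
      have "cdf (distr M borel (cdf M)) u = measure M (cdf M -` {..u} \<inter> space M)"
        unfolding cdf_def2[of "distr M borel (cdf M)"] by (rule measure_distr) simp_all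
      also have "cdf M -` {..u} \<inter> space M = {y. cdf M y \<le> u}" by auto
      also have "measure M {y. cdf M y \<le> u} = max 0 (min 1 u)" by (rule measure_cdf_le[OF cont])
      also have "\<dots> = measure lborel ({0..1} \<inter> {..u})"
      proof -
        have "{0..1} \<inter> {..u} = {0..min 1 u}" by auto
        then show ?thesis by (cases "0 \<le> u") simp_all
      qed
      also have "\<dots> = cdf ?U u" by (simp add: cdf_def)
      finally show "cdf (distr M borel (cdf M)) u = cdf ?U u" .
    qed
  qed
  moreover have "(LINT x|M. g (cdf M x)) = (LINT u|distr M borel (cdf M). g u)"
    by (subst integral_distr) measurable
  moreover have "?U = density lborel (\<lambda>u. ennreal (indicator {0..1} u))"
    unfolding uniform_measure_def by (intro density_cong) (auto simp: indicator_def)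
  ultimately show ?thesis by (simp add: integral_density set_lebesgue_integral_def)
qed

lemma borel_measurable_vec_nth [measurable]: "(\<lambda>x :: real ^ 'd. x $ j) \<in> borel_measurable borel"
  by (intro borel_measurable_continuous_onI continuous_intros)

lemma shifted_legendre_measurable [measurable]: "shifted_legendre m \<in> borel_measurable borel"
  by (intro borel_measurable_continuous_onI continuous_on_shifted_legendre continuous_on_id)

text \<open>The second moment of \<open>n\<close> times the rank error given the observation, averaged over a uniform observation.\<close>

lemma integral_uniform_poly:
  "(LINT u:{0..1}|lborel. (1 - u)\<^sup>2 + k * (u * (1 - u))) = 1 / 3 + k / (6::real)"
proof -
  have cont: "continuous_on {0..1} (\<lambda>u. (1 - u)\<^sup>2 + k * (u * (1 - u)))" by (intro continuous_intros)
  have "((\<lambda>u. - ((1 - u) ^ 3) / 3 + k * (u\<^sup>2 / 2 - u ^ 3 / 3)) has_real_derivative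
      (1 - u)\<^sup>2 + k * (u * (1 - u))) (at u within {0..1})" for u
    by (rule derivative_eq_intros refl | simp)+ (simp add: power2_eq_square algebra_simps)
  then have "((\<lambda>u. (1 - u)\<^sup>2 + k * (u * (1 - u))) has_integral
      (- ((1 - 1) ^ 3) / 3 + k * (1\<^sup>2 / 2 - 1 ^ 3 / 3) - (- ((1 - 0) ^ 3) / 3 + k * (0\<^sup>2 / 2 - 0 ^ 3 / 3)))) {0..1}"
    by (intro fundamental_theorem_of_calculus) (simp_all flip: has_real_derivative_iff_has_vector_derivative)
  then have "((\<lambda>u. (1 - u)\<^sup>2 + k * (u * (1 - u))) has_integral (1 / 3 + k / 6)) {0..1}"
    by (rule has_integral_eq_rhs) simp
  then show ?thesis
    by (intro trans[OF set_borel_integral_eq_integral(2)[OF borel_integrable_atLeastAtMost'[OF cont]]] integral_unique)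
qed

text \<open>One observation with law \<open>P\<close> and copula density \<open>c\<close>; \<open>U\<close> below is its probability integral transform.\<close>

locale copula_law = prob_space P for P :: "(real ^ 'd) measure" +
  fixes c :: "real ^ 'd \<Rightarrow> real"
  assumes copula: "has_copula_density P c"
begin

lemma sets_P [measurable_cong]: "sets P = sets borel"
  using copula by (simp add: has_copula_density_def)

lemma space_P [simp]: "space P = UNIV"
  using sets_eq_imp_space_eq[OF sets_P] by simp

lemma prob_UNIV [simp]: "prob UNIV = 1"
  using prob_space by simp

lemma c_measurable: "c \<in> borel_measurable unit_cube"
  using copula by (simp add: has_copula_density_def)

definition U :: "real ^ 'd \<Rightarrow> real ^ 'd" where
  "U x = (\<chi> j. marginal_cdf P j (x $ j))"

lemma U_nth [simp]: "U x $ j = marginal_cdf P j (x $ j)"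
  by (simp add: U_def)

lemma continuous_marginal_cdf: "continuous_on UNIV (marginal_cdf P j)"
  using copula by (simp add: has_copula_density_def)

lemma marginal_cdf_measurable [measurable]: "marginal_cdf P j \<in> borel_measurable borel"
  by (rule borel_measurable_continuous_onI[OF continuous_marginal_cdf])

lemma marginal_cdf_eq_prob: "marginal_cdf P j t = measure P {x. x $ j \<le> t}"
  unfolding marginal_cdf_def cdf_def by (subst measure_distr) (auto simp: vimage_def)

lemma marginal_cdf_bounds: "marginal_cdf P j t \<in> {0..1}"
  by (simp add: marginal_cdf_eq_prob)

lemma marginal_cdf_bounds' [simp]: "0 \<le> marginal_cdf P j t" "marginal_cdf P j t \<le> 1"
  using marginal_cdf_bounds[of j t] by simp_all

lemma integral_marginal_uniform:
  fixes g :: "real \<Rightarrow> real"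
  assumes g: "continuous_on UNIV g"
  shows "(LINT x|P. g (marginal_cdf P j (x $ j))) = (LINT u:{0..1}|lborel. g u)"
proof -
  interpret M: real_distribution "distr P borel (\<lambda>x. x $ j)"
    by (rule real_distribution_distr) measurable
  have [measurable]: "g \<in> borel_measurable borel" by (rule borel_measurable_continuous_onI[OF g])
  have "(LINT x|P. g (marginal_cdf P j (x $ j))) = (LINT y|distr P borel (\<lambda>x. x $ j). g (marginal_cdf P j y))"
    by (subst integral_distr) measurable
  also have "\<dots> = (LINT u:{0..1}|lborel. g u)"
    using M.integral_cdf_uniform[OF _ g] continuous_marginal_cdf unfolding marginal_cdf_def by simp
  finally show ?thesis .
qed

lemma tensor_U_measurable [measurable]: "(\<lambda>x. tensor_legendre m (U x)) \<in> borel_measurable borel"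
  unfolding tensor_legendre_def U_nth by measurable

lemma abs_tensor_U_le: "\<bar>tensor_legendre m (U x)\<bar> \<le> (\<Prod>j\<in>UNIV. sqrt (2 * real (m $ j) + 1))"
  by (rule abs_tensor_legendre_le) simp

lemma copula_coeff_eq: "copula_coeff c m = (LINT x|P. tensor_legendre m (U x))"
  using copula_coeff_eq_expectation[OF copula, of m] by (simp add: tensor_legendre_def)

lemma copula_coeff_0: "copula_coeff c 0 = 1"
  unfolding copula_coeff_eq by (simp add: tensor_legendre_def shifted_legendre_def prob_space)

text \<open>Only one coordinate enters \<open>Q\<^sub>m\<close>, and the margins of \<open>U\<close> are uniform, so orthogonality to \<open>Q\<^sub>0 = 1\<close> applies. This is
  why the estimator sets these coefficients to \<open>0\<close>.\<close>

lemma copula_coeff_single: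
  assumes "card {j. m $ j = 0} = CARD('d) - 1"
  shows "copula_coeff c m = 0"
proof -
  have "{j. m $ j \<noteq> 0} = UNIV - {j. m $ j = 0}" by auto
  then have "card {j. m $ j \<noteq> 0} = CARD('d) - (CARD('d) - 1)"
    using assms by (simp add: card_Diff_subset)
  also have "\<dots> = 1" using zero_less_card_finite[where 'a = 'd] by linarith
  finally obtain k where k: "{j. m $ j \<noteq> 0} = {k}" by (auto simp: card_1_singleton_iff)
  then have mk: "m $ k \<noteq> 0" and zero: "\<And>j. j \<noteq> k \<Longrightarrow> m $ j = 0" by blast+
  have "tensor_legendre m (U x) = shifted_legendre (m $ k) (marginal_cdf P k (x $ k))" for x
    unfolding tensor_legendre_def
    by (subst prod.remove[of _ k]) (simp_all add: zero shifted_legendre_def[of 0])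
  then have "copula_coeff c m = (LINT u:{0..1}|lborel. shifted_legendre (m $ k) u)"
    unfolding copula_coeff_eq
    by (simp add: integral_marginal_uniform continuous_on_shifted_legendre)
  also have "\<dots> = 0"
    using integral_shifted_legendre[of "m $ k" 0] mk by (simp add: shifted_legendre_def[of 0])
  finally show ?thesis .
qed

abbreviation sample :: "'i set \<Rightarrow> ('i \<Rightarrow> real ^ 'd) measure" where
  "sample I \<equiv> Pi\<^sub>M I (\<lambda>_. P)"

lemma prob_space_sample: "prob_space (sample I)"
  by (intro prob_space_PiM prob_space_axioms)

lemma product_sigma_finite_P: "product_sigma_finite (\<lambda>_. P)" ..

lemma borel_measurable_P: "f \<in> borel_measurable borel \<Longrightarrow> f \<in> borel_measurable P"
  by (simp add: measurable_cong_sets[OF sets_P refl])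

lemma sample_component [measurable]: "i \<in> I \<Longrightarrow> (\<lambda>x. x i) \<in> sample I \<rightarrow>\<^sub>M borel"
  using measurable_component_singleton[of i I "\<lambda>_. P"] by (simp add: measurable_cong_sets[OF refl sets_P])

lemma integrable_square_sum:
  fixes f :: "real ^ 'd \<Rightarrow> real" and I :: "nat set"
  assumes [measurable]: "f \<in> borel_measurable borel" and bd: "\<And>x. \<bar>f x\<bar> \<le> B"
  shows "integrable (sample I) (\<lambda>x. (a + (\<Sum>i\<in>I. f (x i)))\<^sup>2)"
proof -
  interpret S: prob_space "sample I" by (rule prob_space_sample)
  show ?thesis
  proof (rule S.integrable_const_bound)
    show "AE x in sample I. norm ((a + (\<Sum>i\<in>I. f (x i)))\<^sup>2) \<le> (\<bar>a\<bar> + real (card I) * B)\<^sup>2"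
    proof (rule AE_I2)
      fix x :: "nat \<Rightarrow> real ^ 'd"
      have "\<bar>\<Sum>i\<in>I. f (x i)\<bar> \<le> (\<Sum>i\<in>I. B)" by (intro order_trans[OF sum_abs] sum_mono bd)
      then have "\<bar>a + (\<Sum>i\<in>I. f (x i))\<bar> \<le> \<bar>a\<bar> + real (card I) * B" by simp
      then have "\<bar>a + (\<Sum>i\<in>I. f (x i))\<bar>\<^sup>2 \<le> (\<bar>a\<bar> + real (card I) * B)\<^sup>2" by (rule power_mono) simp
      then show "norm ((a + (\<Sum>i\<in>I. f (x i)))\<^sup>2) \<le> (\<bar>a\<bar> + real (card I) * B)\<^sup>2" by simp
    qed
  qed measurable
qed

text \<open>The variance of a sum of independent centred terms, shifted by a constant \<open>a\<close> that makes the induction go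
  through.\<close>

lemma second_moment_sum:
  fixes f :: "real ^ 'd \<Rightarrow> real" and I :: "nat set"
  assumes [measurable]: "f \<in> borel_measurable borel" and bd: "\<And>x. \<bar>f x\<bar> \<le> B" and mean: "(LINT x|P. f x) = 0"
    and "finite I"
  shows "(LINT x|sample I. (a + (\<Sum>i\<in>I. f (x i)))\<^sup>2) = a\<^sup>2 + real (card I) * (LINT x|P. (f x)\<^sup>2)"
  using \<open>finite I\<close>
proof (induction I arbitrary: a)
  case empty
  interpret S: prob_space "sample {}" by (rule prob_space_sample)
  show ?case by (simp add: S.prob_space)
next
  case (insert i I)
  have bd2: "(f x)\<^sup>2 \<le> B\<^sup>2" for x using power_mono[OF bd[of x] abs_ge_zero, of 2] by simp
  have int_f: "integrable P f" by (rule integrable_const_bound[where B = B]) (simp_all add: bd borel_measurable_P)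
  have int_f2: "integrable P (\<lambda>x. (f x)\<^sup>2)" by (rule integrable_const_bound[where B = "B\<^sup>2"]) (simp_all add: bd2 borel_measurable_P)
  note int = integrable_square_sum[OF assms(1) bd]
  have inner: "(LINT y|P. (a + (\<Sum>l\<in>insert i I. f ((x(i := y)) l)))\<^sup>2)
      = (a + (\<Sum>l\<in>I. f (x l)))\<^sup>2 + (LINT y|P. (f y)\<^sup>2)" for x
  proof -
    define s where "s = a + (\<Sum>l\<in>I. f (x l))"
    have split: "a + (\<Sum>l\<in>insert i I. f ((x(i := y)) l)) = s + f y" for y
    proof -
      have "(\<Sum>l\<in>I. f ((x(i := y)) l)) = (\<Sum>l\<in>I. f (x l))"
        using insert.hyps by (intro sum.cong) auto
      then show ?thesis using insert.hyps by (simp add: s_def)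
    qed
    have "(LINT y|P. (s + f y)\<^sup>2) = s\<^sup>2 + 2 * s * (LINT y|P. f y) + (LINT y|P. (f y)\<^sup>2)"
      using int_f int_f2 by (simp add: power2_sum)
    then show ?thesis unfolding split mean by (simp add: s_def)
  qed
  have "(LINT x|sample (insert i I). (a + (\<Sum>l\<in>insert i I. f (x l)))\<^sup>2)
      = (LINT x|sample I. (LINT y|P. (a + (\<Sum>l\<in>insert i I. f ((x(i := y)) l)))\<^sup>2))"
    using insert.hyps by (intro product_sigma_finite.product_integral_insert[OF product_sigma_finite_P] int)
  also have "\<dots> = (LINT x|sample I. (a + (\<Sum>l\<in>I. f (x l)))\<^sup>2 + (LINT y|P. (f y)\<^sup>2))"
    unfolding inner ..
  also have "\<dots> = (LINT x|sample I. (a + (\<Sum>l\<in>I. f (x l)))\<^sup>2) + (LINT y|P. (f y)\<^sup>2)"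
  proof -
    interpret S: prob_space "sample I" by (rule prob_space_sample)
    show ?thesis using int by (simp add: S.prob_space)
  qed
  also have "\<dots> = a\<^sup>2 + real (card (insert i I)) * (LINT x|P. (f x)\<^sup>2)"
    unfolding insert.IH using insert.hyps by (simp add: algebra_simps)
  finally show ?case .
qed

lemma nn_second_moment_sum:
  fixes f :: "real ^ 'd \<Rightarrow> real" and I :: "nat set"
  assumes [measurable]: "f \<in> borel_measurable borel" and bd: "\<And>x. \<bar>f x\<bar> \<le> B" and mean: "(LINT x|P. f x) = 0"
    and I: "finite I"
  shows "(\<integral>\<^sup>+x. ennreal ((a + (\<Sum>i\<in>I. f (x i)))\<^sup>2) \<partial>sample I) = ennreal (a\<^sup>2 + real (card I) * (LINT x|P. (f x)\<^sup>2))"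
proof -
  have "integrable (sample I) (\<lambda>x. (a + (\<Sum>i\<in>I. f (x i)))\<^sup>2)"
    by (rule integrable_square_sum[OF assms(1) bd])
  then have "(\<integral>\<^sup>+x. ennreal ((a + (\<Sum>i\<in>I. f (x i)))\<^sup>2) \<partial>sample I)
      = ennreal (LINT x|sample I. (a + (\<Sum>i\<in>I. f (x i)))\<^sup>2)"
    by (rule nn_integral_eq_integral) simp
  then show ?thesis unfolding second_moment_sum[OF assms(1) bd mean I] .
qed

text \<open>Conditioning on the observation with index \<open>i\<close>.\<close>

lemma sample_conditional_le:
  fixes f :: "(nat \<Rightarrow> real ^ 'd) \<Rightarrow> ennreal"
  assumes f: "f \<in> borel_measurable (sample {..<n})" and i: "i < n"
    and le: "\<And>y. (\<integral>\<^sup>+z. f (z(i := y)) \<partial>sample ({..<n} - {i})) \<le> g y"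
  shows "(\<integral>\<^sup>+x. f x \<partial>sample {..<n}) \<le> (\<integral>\<^sup>+y. g y \<partial>P)"
proof -
  have eq: "insert i ({..<n} - {i}) = {..<n}" using i by auto
  have "(\<integral>\<^sup>+x. f x \<partial>sample {..<n}) = (\<integral>\<^sup>+y. (\<integral>\<^sup>+z. f (z(i := y)) \<partial>sample ({..<n} - {i})) \<partial>P)"
    using product_sigma_finite.product_nn_integral_insert_rev[OF product_sigma_finite_P, of "{..<n} - {i}" i f, unfolded eq] f by simp
  also have "\<dots> \<le> (\<integral>\<^sup>+y. g y \<partial>P)" by (intro nn_integral_mono le)
  finally show ?thesis .
qed

lemma ecdf_measurable:
  assumes "i < n"
  shows "(\<lambda>x. ecdf n x j (x i $ j)) \<in> borel_measurable (sample {..<n})"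
proof -
  have [measurable]: "(\<lambda>x. x l $ j) \<in> borel_measurable (sample {..<n})" if "l < n" for l
    using that by (intro measurable_compose[OF sample_component borel_measurable_vec_nth]) simp
  have eq: "(of_bool b :: real) = (if b then 1 else 0)" for b by simp
  show ?thesis
    unfolding ecdf_def eq using assms by (intro borel_measurable_divide borel_measurable_sum measurable_If) auto
qed

lemma ecdf_bounds: "ecdf n x j t \<in> {0..1}"
proof -
  have "(\<Sum>i<n. of_bool (x i $ j \<le> t) :: real) \<le> (\<Sum>i<n. 1)" by (intro sum_mono) simp
  then show ?thesis by (auto simp: ecdf_def sum_nonneg divide_le_eq_1)
qed

text \<open>The contribution of an observation \<open>x\<close> to \<open>ecdf - F\<close> at the \<open>j\<close>-th coordinate of \<open>y\<close>.\<close>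

definition centred_indicator :: "'d \<Rightarrow> real ^ 'd \<Rightarrow> real ^ 'd \<Rightarrow> real" where
  "centred_indicator j y x = of_bool (x $ j \<le> y $ j) - marginal_cdf P j (y $ j)"

lemma centred_indicator_measurable [measurable]: "centred_indicator j y \<in> borel_measurable borel"
proof -
  have eq: "(of_bool b :: real) = (if b then 1 else 0)" for b by simp
  show ?thesis unfolding centred_indicator_def[abs_def] eq by measurable
qed

lemma centred_indicator_bounds: "centred_indicator j y x \<in> {- marginal_cdf P j (y $ j)..1 - marginal_cdf P j (y $ j)}"
  by (simp add: centred_indicator_def)

lemma abs_centred_indicator_le: "\<bar>centred_indicator j y x\<bar> \<le> 1"
  using marginal_cdf_bounds[of j "y $ j"] by (auto simp: centred_indicator_def)

lemma integral_of_bool: "(LINT x|P. of_bool (x $ j \<le> t)) = marginal_cdf P j t"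
proof -
  have "(\<lambda>x. of_bool (x $ j \<le> t) :: real) = indicator {x. x $ j \<le> t}" by (auto simp: indicator_def)
  then show ?thesis by (simp add: marginal_cdf_eq_prob)
qed

lemma integrable_of_bool: "integrable P (\<lambda>x. of_bool (x $ j \<le> t) :: real)"
proof -
  have "(\<lambda>x. of_bool (x $ j \<le> t) :: real) = indicator {x. x $ j \<le> t}" by (auto simp: indicator_def)
  moreover have "{x. x $ j \<le> t} \<in> sets P" by measurable
  ultimately show ?thesis by (simp add: emeasure_eq_measure)
qed

lemma integral_centred_indicator: "(LINT x|P. centred_indicator j y x) = 0"
  unfolding centred_indicator_def by (simp add: integrable_of_bool integral_of_bool prob_space)

lemma integral_centred_indicator_square:
  "(LINT x|P. (centred_indicator j y x)\<^sup>2) = marginal_cdf P j (y $ j) * (1 - marginal_cdf P j (y $ j))"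
proof -
  let ?F = "marginal_cdf P j (y $ j)"
  have "(centred_indicator j y x)\<^sup>2 = (1 - 2 * ?F) * of_bool (x $ j \<le> y $ j) + ?F\<^sup>2" for x
    by (auto simp: centred_indicator_def power2_eq_square algebra_simps)
  then have "(LINT x|P. (centred_indicator j y x)\<^sup>2) = (1 - 2 * ?F) * ?F + ?F\<^sup>2"
    by (simp add: integrable_of_bool integral_of_bool prob_space)
  then show ?thesis by (simp add: power2_eq_square algebra_simps)
qed

text \<open>The observation \<open>y\<close> itself is counted by the empirical distribution function at \<open>y\<close>, whence the deterministic
  term \<open>1 - F\<close>; the other \<open>n - 1\<close> terms are independent and centred.\<close>

lemma ecdf_deviation:
  assumes "i < n"
  shows "real n * (ecdf n (z(i := y)) j (y $ j) - marginal_cdf P j (y $ j))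
      = (1 - marginal_cdf P j (y $ j)) + (\<Sum>l\<in>{..<n} - {i}. centred_indicator j y (z l))"
proof -
  have "real n * (ecdf n (z(i := y)) j (y $ j) - marginal_cdf P j (y $ j))
      = (\<Sum>l<n. of_bool ((z(i := y)) l $ j \<le> y $ j)) - (\<Sum>l<n. marginal_cdf P j (y $ j))"
    using assms by (simp add: ecdf_def right_diff_distrib)
  also have "\<dots> = (\<Sum>l<n. centred_indicator j y ((z(i := y)) l))" by (simp add: centred_indicator_def sum_subtractf)
  also have "\<dots> = centred_indicator j y y + (\<Sum>l\<in>{..<n} - {i}. centred_indicator j y ((z(i := y)) l))"
    using assms by (subst sum.remove[of _ i]) auto
  also have "(\<Sum>l\<in>{..<n} - {i}. centred_indicator j y ((z(i := y)) l)) = (\<Sum>l\<in>{..<n} - {i}. centred_indicator j y (z l))"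
    by (intro sum.cong) auto
  also have "centred_indicator j y y = 1 - marginal_cdf P j (y $ j)" by (simp add: centred_indicator_def)
  finally show ?thesis .
qed

lemma ecdf_error_measurable:
  assumes i: "i < n"
  shows "(\<lambda>x. ecdf n x j (x i $ j) - marginal_cdf P j (x i $ j)) \<in> borel_measurable (sample {..<n})"
proof -
  have "(\<lambda>x. x i) \<in> sample {..<n} \<rightarrow>\<^sub>M borel" using i by (intro sample_component) simp
  then have "(\<lambda>x. marginal_cdf P j (x i $ j)) \<in> borel_measurable (sample {..<n})"
    by (rule measurable_compose) measurable
  then show ?thesis by (intro borel_measurable_diff ecdf_measurable i)
qed

text \<open>The exact value is \<open>(n + 1) / (6 n\<^sup>2)\<close>, and \<open>n + 1 \<le> 2 n\<close>.\<close>

lemma ecdf_mean_square_error: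
  assumes i: "i < n"
  shows "(\<integral>\<^sup>+x. ennreal ((ecdf n x j (x i $ j) - marginal_cdf P j (x i $ j))\<^sup>2) \<partial>sample {..<n}) \<le> ennreal (1 / (3 * real n))"
proof -
  let ?F = "\<lambda>y. marginal_cdf P j (y $ j)"
  let ?g = "\<lambda>u. ((1 - u)\<^sup>2 + (real n - 1) * (u * (1 - u)))"
  have n: "real n \<ge> 1" using i by simp
  have "(\<integral>\<^sup>+x. ennreal ((ecdf n x j (x i $ j) - ?F (x i))\<^sup>2) \<partial>sample {..<n}) \<le> (\<integral>\<^sup>+y. ennreal (?g (?F y) / (real n)\<^sup>2) \<partial>P)"
  proof (rule sample_conditional_le[OF _ i])
    show "(\<lambda>x. ennreal ((ecdf n x j (x i $ j) - ?F (x i))\<^sup>2)) \<in> borel_measurable (sample {..<n})"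
      by (intro measurable_compose[OF _ measurable_ennreal] borel_measurable_power ecdf_error_measurable i)
    fix y
    have "(ecdf n (z(i := y)) j ((z(i := y)) i $ j) - ?F ((z(i := y)) i))\<^sup>2
        = ((1 - ?F y) / real n + (\<Sum>l\<in>{..<n} - {i}. centred_indicator j y (z l) / real n))\<^sup>2" for z
    proof -
      have "ecdf n (z(i := y)) j (y $ j) - ?F y = ((1 - ?F y) + (\<Sum>l\<in>{..<n} - {i}. centred_indicator j y (z l))) / real n"
        using ecdf_deviation[OF i, of z y j] n by (simp add: field_simps)
      then show ?thesis by (simp add: add_divide_distrib sum_divide_distrib)
    qed
    then have "(\<integral>\<^sup>+z. ennreal ((ecdf n (z(i := y)) j ((z(i := y)) i $ j) - ?F ((z(i := y)) i))\<^sup>2) \<partial>sample ({..<n} - {i}))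
        = (\<integral>\<^sup>+z. ennreal (((1 - ?F y) / real n + (\<Sum>l\<in>{..<n} - {i}. centred_indicator j y (z l) / real n))\<^sup>2) \<partial>sample ({..<n} - {i}))"
      by (simp only:)
    also have "\<dots> = ennreal (((1 - ?F y) / real n)\<^sup>2 + real (card ({..<n} - {i})) * (LINT x|P. (centred_indicator j y x / real n)\<^sup>2))"
      by (rule nn_second_moment_sum[where B = 1])
        (use n in \<open>simp_all add: integral_centred_indicator divide_le_eq order_trans[OF abs_centred_indicator_le]\<close>)
    also have "((1 - ?F y) / real n)\<^sup>2 + real (card ({..<n} - {i})) * (LINT x|P. (centred_indicator j y x / real n)\<^sup>2) = ?g (?F y) / (real n)\<^sup>2"
      using i by (simp add: power_divide integral_centred_indicator_square of_nat_diff add_divide_distrib)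
    finally show "(\<integral>\<^sup>+z. ennreal ((ecdf n (z(i := y)) j ((z(i := y)) i $ j) - ?F ((z(i := y)) i))\<^sup>2) \<partial>sample ({..<n} - {i}))
        \<le> ennreal (?g (?F y) / (real n)\<^sup>2)" by (rule eq_refl)
  qed
  also have "\<dots> = ennreal (LINT y|P. ?g (?F y) / (real n)\<^sup>2)"
  proof (rule nn_integral_eq_integral)
    have g0: "0 \<le> ?g (?F y)" "?g (?F y) \<le> real n" for y
    proof -
      show "0 \<le> ?g (?F y)" using n by (intro add_nonneg_nonneg mult_nonneg_nonneg) auto
      have "?F y * (1 - ?F y) \<le> 1" "(1 - ?F y)\<^sup>2 \<le> 1" by (auto intro!: mult_le_one power_le_one)
      then have "(real n - 1) * (?F y * (1 - ?F y)) \<le> (real n - 1) * 1" using n by (intro mult_left_mono) auto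
      from add_mono[OF \<open>(1 - ?F y)\<^sup>2 \<le> 1\<close> this] show "?g (?F y) \<le> real n" by simp
    qed
    show "AE y in P. 0 \<le> ?g (?F y) / (real n)\<^sup>2"
      by (intro AE_I2 divide_nonneg_nonneg g0(1) zero_le_power2)
    have "integrable P (\<lambda>y. ?g (?F y))"
    proof (rule integrable_const_bound)
      show "AE y in P. norm (?g (?F y)) \<le> real n"
        unfolding real_norm_def abs_of_nonneg[OF g0(1)] by (intro AE_I2 g0(2))
      show "(\<lambda>y. ?g (?F y)) \<in> borel_measurable P"
        by (rule borel_measurable_P) measurable
    qed
    then show "integrable P (\<lambda>y. ?g (?F y) / (real n)\<^sup>2)" by (rule integrable_divide)
  qed
  also have "(LINT y|P. ?g (?F y) / (real n)\<^sup>2) = (1 / 3 + (real n - 1) / 6) / (real n)\<^sup>2"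
  proof -
    have "continuous_on UNIV ?g" by (intro continuous_intros)
    from integral_marginal_uniform[OF this, of j]
    have "(LINT y|P. ?g (?F y)) = 1 / 3 + (real n - 1) / 6" unfolding integral_uniform_poly .
    then show ?thesis by (simp only: integral_divide_zero)
  qed
  also have "\<dots> \<le> 1 / (3 * real n)"
    using n by (simp add: field_simps power2_eq_square)
  finally show ?thesis by (simp add: ennreal_leI)
qed

lemma centred_indicator_mgf_le:
  "(\<integral>\<^sup>+x. ennreal (exp (\<mu> * centred_indicator j y x)) \<partial>P) \<le> ennreal (exp (\<mu>\<^sup>2 / 8))"
proof -
  let ?F = "marginal_cdf P j (y $ j)"
  interpret A: interval_bounded_random_variable P "centred_indicator j y" "- ?F" "1 - ?F"
    by unfold_locales (intro borel_measurable_P centred_indicator_measurable AE_I2 centred_indicator_bounds)+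
  interpret B: interval_bounded_random_variable P "\<lambda>x. - centred_indicator j y x" "- (1 - ?F)" "?F"
  proof unfold_locales
    show "(\<lambda>x. - centred_indicator j y x) \<in> borel_measurable P"
      by (intro borel_measurable_P borel_measurable_uminus centred_indicator_measurable)
    show "AE x in P. - centred_indicator j y x \<in> {- (1 - ?F)..?F}"
    proof (rule AE_I2)
      fix x show "- centred_indicator j y x \<in> {- (1 - ?F)..?F}" using centred_indicator_bounds[of j y x] by simp
    qed
  qed
  consider "\<mu> = 0" | "\<mu> > 0" | "\<mu> < 0" by linarith
  then show ?thesis
  proof cases
    case 1 then show ?thesis by (simp add: emeasure_eq_measure)
  next
    case 2 then show ?thesis using A.Hoeffdings_lemma_nn_integral_0[of \<mu>] by (simp add: integral_centred_indicator)
  next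
    case 3 then show ?thesis using B.Hoeffdings_lemma_nn_integral_0[of "- \<mu>"] by (simp add: integral_centred_indicator)
  qed
qed

text \<open>Hoeffding's lemma for each of the other observations; the observation itself contributes at most \<open>exp \<bar>\<mu>\<bar>\<close>.\<close>

lemma ecdf_mgf_le:
  assumes i: "i < n"
  shows "(\<integral>\<^sup>+z. ennreal (exp (\<mu> * (real n * (ecdf n (z(i := y)) j (y $ j) - marginal_cdf P j (y $ j)))))
      \<partial>sample ({..<n} - {i})) \<le> ennreal (exp (\<bar>\<mu>\<bar> + real n * \<mu>\<^sup>2 / 8))"
proof -
  let ?F = "marginal_cdf P j (y $ j)" and ?I = "{..<n} - {i}"
  have m: "(\<lambda>x. ennreal (exp (\<mu> * centred_indicator j y x))) \<in> borel_measurable borel" by measurable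
  have card: "card ?I = n - 1" using i by simp
  have "(\<integral>\<^sup>+z. (\<Prod>l\<in>?I. ennreal (exp (\<mu> * centred_indicator j y (z l)))) \<partial>sample ?I)
      = (\<Prod>l\<in>?I. \<integral>\<^sup>+x. ennreal (exp (\<mu> * centred_indicator j y x)) \<partial>P)"
    by (intro product_sigma_finite.product_nn_integral_prod[OF product_sigma_finite_P] borel_measurable_P m) simp
  also have "\<dots> \<le> (\<Prod>l\<in>?I. ennreal (exp (\<mu>\<^sup>2 / 8)))"
    by (intro prod_mono_ennreal centred_indicator_mgf_le)
  also have "\<dots> = ennreal (exp (real (n - 1) * (\<mu>\<^sup>2 / 8)))"
    by (simp only: prod_constant card ennreal_power[OF exp_ge_zero] exp_of_nat_mult)
  finally have prod_le: "(\<integral>\<^sup>+z. (\<Prod>l\<in>?I. ennreal (exp (\<mu> * centred_indicator j y (z l)))) \<partial>sample ?I)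
      \<le> ennreal (exp (real (n - 1) * (\<mu>\<^sup>2 / 8)))" .
  have split: "ennreal (exp (\<mu> * (1 - ?F + (\<Sum>l\<in>?I. centred_indicator j y (z l)))))
      = ennreal (exp (\<mu> * (1 - ?F))) * (\<Prod>l\<in>?I. ennreal (exp (\<mu> * centred_indicator j y (z l))))" for z
    by (simp add: distrib_left exp_add sum_distrib_left exp_sum ennreal_mult prod_ennreal prod_nonneg)
  have "(\<integral>\<^sup>+z. ennreal (exp (\<mu> * (real n * (ecdf n (z(i := y)) j (y $ j) - ?F)))) \<partial>sample ?I)
      = ennreal (exp (\<mu> * (1 - ?F))) * (\<integral>\<^sup>+z. (\<Prod>l\<in>?I. ennreal (exp (\<mu> * centred_indicator j y (z l)))) \<partial>sample ?I)"
    unfolding ecdf_deviation[OF i] split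
    by (intro nn_integral_cmult borel_measurable_prod_ennreal measurable_compose[OF sample_component m])
  also have "\<dots> \<le> ennreal (exp (\<mu> * (1 - ?F))) * ennreal (exp (real (n - 1) * (\<mu>\<^sup>2 / 8)))"
    by (intro mult_left_mono prod_le) simp
  also have "\<dots> = ennreal (exp (\<mu> * (1 - ?F) + real (n - 1) * (\<mu>\<^sup>2 / 8)))"
    unfolding exp_add by (rule ennreal_mult[symmetric]) simp_all
  also have "\<dots> \<le> ennreal (exp (\<bar>\<mu>\<bar> + real n * \<mu>\<^sup>2 / 8))"
  proof (intro ennreal_leI, subst exp_le_cancel_iff, rule add_mono)
    have "\<mu> * (1 - ?F) \<le> \<bar>\<mu>\<bar> * (1 - ?F)" by (intro mult_right_mono) auto
    also have "\<dots> \<le> \<bar>\<mu>\<bar>" by (intro mult_left_le) auto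
    finally show "\<mu> * (1 - ?F) \<le> \<bar>\<mu>\<bar>" .
    have "real (n - 1) * (\<mu>\<^sup>2 / 8) \<le> real n * (\<mu>\<^sup>2 / 8)" by (intro mult_right_mono) auto
    then show "real (n - 1) * (\<mu>\<^sup>2 / 8) \<le> real n * \<mu>\<^sup>2 / 8" by simp
  qed
  finally show ?thesis .
qed

end

section \<open>Bias and variance of the projection estimator\<close>

lemma square_sum_le_two: "(a + b)\<^sup>2 \<le> 2 * a\<^sup>2 + 2 * (b :: real)\<^sup>2"
proof -
  have "(a + b)\<^sup>2 + (a - b)\<^sup>2 = 2 * a\<^sup>2 + 2 * b\<^sup>2" by (simp add: power2_eq_square algebra_simps)
  then show ?thesis using zero_le_power2[of "a - b"] by linarith
qed

lemma mean_square_le: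
  fixes f :: "nat \<Rightarrow> real"
  assumes "0 < n"
  shows "((\<Sum>i<n. f i) / real n)\<^sup>2 \<le> (\<Sum>i<n. (f i)\<^sup>2 / real n)"
proof -
  have "(\<Sum>i<n. f i)\<^sup>2 \<le> real n * (\<Sum>i<n. (f i)\<^sup>2)"
    using Cauchy_Schwarz_ineq_sum[of "\<lambda>_. 1" f "{..<n}"] by simp
  then have "(\<Sum>i<n. f i)\<^sup>2 / (real n)\<^sup>2 \<le> real n * (\<Sum>i<n. (f i)\<^sup>2) / (real n)\<^sup>2"
    by (rule divide_right_mono) simp
  then show ?thesis using assms by (simp add: power_divide power2_eq_square sum_divide_distrib[symmetric])
qed

context copula_law
begin

definition Uhat :: "nat \<Rightarrow> (nat \<Rightarrow> real ^ 'd) \<Rightarrow> nat \<Rightarrow> real ^ 'd" where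
  "Uhat n x i = (\<chi> j. ecdf n x j (x i $ j))"

lemma Uhat_nth [simp]: "Uhat n x i $ j = ecdf n x j (x i $ j)"
  by (simp add: Uhat_def)

lemma tensor_Uhat_measurable:
  "i < n \<Longrightarrow> (\<lambda>x. tensor_legendre m (Uhat n x i)) \<in> borel_measurable (sample {..<n})"
  unfolding tensor_legendre_def Uhat_nth
  by (intro borel_measurable_prod measurable_compose[OF ecdf_measurable shifted_legendre_measurable])

lemma tensor_U_sample_measurable:
  "i < n \<Longrightarrow> (\<lambda>x. tensor_legendre m (U (x i))) \<in> borel_measurable (sample {..<n})"
  by (rule measurable_compose[OF sample_component tensor_U_measurable]) simp

text \<open>The coefficients that the estimator fixes in advance are exactly right, so the rank average may be used for
  all of them in upper bounds.\<close>

lemma coeff_est_error_le: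
  "(coeff_est n x m - copula_coeff c m)\<^sup>2 \<le> ((\<Sum>i<n. tensor_legendre m (Uhat n x i)) / real n - copula_coeff c m)\<^sup>2"
  by (simp add: coeff_est_def copula_coeff_0 copula_coeff_single Uhat_def)

lemma integrable_tensor_U: "integrable P (\<lambda>x. tensor_legendre m (U x))"
  by (rule integrable_const_bound[where B = "\<Prod>j\<in>UNIV. sqrt (2 * real (m $ j) + 1)"])
    (simp_all only: real_norm_def abs_tensor_U_le borel_measurable_P[OF tensor_U_measurable] AE_I2)

lemma integrable_tensor_U_square: "integrable P (\<lambda>x. (tensor_legendre m (U x))\<^sup>2)"
proof (rule integrable_const_bound)
  show "AE x in P. norm ((tensor_legendre m (U x))\<^sup>2) \<le> (\<Prod>j\<in>UNIV. sqrt (2 * real (m $ j) + 1))\<^sup>2"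
    using power_mono[OF abs_tensor_U_le abs_ge_zero, of m _ 2] by (intro AE_I2) simp
  show "(\<lambda>x. (tensor_legendre m (U x))\<^sup>2) \<in> borel_measurable P"
    by (intro borel_measurable_P borel_measurable_power tensor_U_measurable)
qed

lemma oracle_variance:
  fixes n :: nat
  assumes n: "0 < n"
  shows "(\<integral>\<^sup>+x. ennreal (((\<Sum>i<n. tensor_legendre m (U (x i))) / real n - copula_coeff c m)\<^sup>2) \<partial>sample {..<n})
    \<le> ennreal ((LINT x|P. (tensor_legendre m (U x))\<^sup>2) / real n)"
proof -
  let ?\<Phi> = "\<lambda>x. tensor_legendre m (U x)"
  define B where "B = (\<Prod>j\<in>UNIV. sqrt (2 * real (m $ j) + 1))"
  define f where "f x = (?\<Phi> x - copula_coeff c m) / real n" for x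
  have \<Phi>: "\<bar>?\<Phi> x\<bar> \<le> B" for x unfolding B_def by (rule abs_tensor_U_le)
  note int = integrable_tensor_U[of m] and int2 = integrable_tensor_U_square[of m]
  have f_meas: "f \<in> borel_measurable borel" unfolding f_def
    by (intro borel_measurable_divide borel_measurable_diff tensor_U_measurable borel_measurable_const)
  have f_bd: "\<bar>f x\<bar> \<le> (B + \<bar>copula_coeff c m\<bar>) / real n" for x
  proof -
    have "\<bar>?\<Phi> x - copula_coeff c m\<bar> \<le> B + \<bar>copula_coeff c m\<bar>"
      using abs_triangle_ineq4[of "?\<Phi> x" "copula_coeff c m"] \<Phi>[of x] by linarith
    then show ?thesis unfolding f_def abs_divide by (simp add: divide_right_mono)
  qed
  have f_mean: "(LINT x|P. f x) = 0"
    unfolding f_def using int by (simp add: copula_coeff_eq)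
  have f_var: "(LINT x|P. (f x)\<^sup>2) = ((LINT x|P. (?\<Phi> x)\<^sup>2) - (copula_coeff c m)\<^sup>2) / (real n)\<^sup>2"
  proof -
    have "(f x)\<^sup>2 = ((?\<Phi> x)\<^sup>2 - 2 * copula_coeff c m * ?\<Phi> x + (copula_coeff c m)\<^sup>2) / (real n)\<^sup>2" for x
      by (simp add: f_def power_divide power2_diff mult_ac)
    then have "(LINT x|P. (f x)\<^sup>2)
        = ((LINT x|P. (?\<Phi> x)\<^sup>2) - 2 * copula_coeff c m * (LINT x|P. ?\<Phi> x) + (copula_coeff c m)\<^sup>2) / (real n)\<^sup>2"
      using int int2 by simp
    then show ?thesis by (simp add: copula_coeff_eq[symmetric] power2_eq_square)
  qed
  have "(\<Sum>i<n. ?\<Phi> (x i)) / real n - copula_coeff c m = 0 + (\<Sum>i<n. f (x i))" for x :: "nat \<Rightarrow> real ^ 'd"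
    using n by (simp add: f_def sum_subtractf diff_divide_distrib sum_divide_distrib)
  then have "(\<integral>\<^sup>+x. ennreal (((\<Sum>i<n. ?\<Phi> (x i)) / real n - copula_coeff c m)\<^sup>2) \<partial>sample {..<n})
      = (\<integral>\<^sup>+x. ennreal ((0 + (\<Sum>i<n. f (x i)))\<^sup>2) \<partial>sample {..<n})"
    by (simp only:)
  also have "\<dots> = ennreal (0\<^sup>2 + real (card {..<n}) * (LINT x|P. (f x)\<^sup>2))"
    by (rule nn_second_moment_sum[OF f_meas f_bd f_mean]) simp
  also have "\<dots> \<le> ennreal ((LINT x|P. (?\<Phi> x)\<^sup>2) / real n)"
  proof (rule ennreal_leI)
    have "0\<^sup>2 + real (card {..<n}) * (LINT x|P. (f x)\<^sup>2) = ((LINT x|P. (?\<Phi> x)\<^sup>2) - (copula_coeff c m)\<^sup>2) / real n"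
      unfolding f_var using n by (simp add: power2_eq_square)
    also have "\<dots> \<le> (LINT x|P. (?\<Phi> x)\<^sup>2) / real n" by (intro divide_right_mono) auto
    finally show "0\<^sup>2 + real (card {..<n}) * (LINT x|P. (f x)\<^sup>2) \<le> (LINT x|P. (?\<Phi> x)\<^sup>2) / real n" .
  qed
  finally show ?thesis .
qed

text \<open>The squared distance between the feature vectors \<open>(Q\<^sub>m)\<^sub>m\<close> at the ranks \<open>v\<close> and at the true values \<open>u\<close>.\<close>

definition rank_shift :: "(nat ^ 'd) set \<Rightarrow> real ^ 'd \<Rightarrow> real ^ 'd \<Rightarrow> real" where
  "rank_shift M v u = (\<Sum>m\<in>M. (tensor_legendre m v - tensor_legendre m u)\<^sup>2)"

text \<open>Each coefficient error is the oracle error plus an average over observations of feature shifts; by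
  \<open>(a + b)\<^sup>2 \<le> 2 a\<^sup>2 + 2 b\<^sup>2\<close> and convexity of the square their mean squares add up.\<close>

lemma estimation_error_le:
  fixes n :: nat
  assumes n: "0 < n" and M: "finite M" and R0: "0 \<le> R"
    and R: "\<And>i. i < n \<Longrightarrow> (\<integral>\<^sup>+x. ennreal (rank_shift M (Uhat n x i) (U (x i))) \<partial>sample {..<n}) \<le> ennreal R"
  shows "(\<integral>\<^sup>+x. ennreal (\<Sum>m\<in>M. (coeff_est n x m - copula_coeff c m)\<^sup>2) \<partial>sample {..<n})
    \<le> ennreal (2 * (\<Sum>m\<in>M. LINT x|P. (tensor_legendre m (U x))\<^sup>2) / real n + 2 * R)"
proof -
  let ?\<rho> = "copula_coeff c"
  define V where "V m = (LINT x|P. (tensor_legendre m (U x))\<^sup>2) / real n" for m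
  have V0: "0 \<le> V m" for m by (simp add: V_def)
  define a where "a x m = ((\<Sum>i<n. tensor_legendre m (U (x i))) / real n - ?\<rho> m)\<^sup>2" for x m
  have a_meas: "(\<lambda>x. a x m) \<in> borel_measurable (sample {..<n})" for m
    unfolding a_def by (intro borel_measurable_power borel_measurable_diff borel_measurable_divide
        borel_measurable_sum borel_measurable_const tensor_U_sample_measurable) simp
  have s_meas: "(\<lambda>x. rank_shift M (Uhat n x i) (U (x i))) \<in> borel_measurable (sample {..<n})" if "i < n" for i
    unfolding rank_shift_def by (intro borel_measurable_power borel_measurable_diff borel_measurable_sum
        tensor_U_sample_measurable tensor_Uhat_measurable that)
  have s0: "0 \<le> rank_shift M v u" for v u by (simp add: rank_shift_def sum_nonneg)
  have a0: "0 \<le> a x m" for x m by (simp add: a_def)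
  have point: "(\<Sum>m\<in>M. (coeff_est n x m - ?\<rho> m)\<^sup>2)
      \<le> (\<Sum>m\<in>M. 2 * a x m) + (\<Sum>i<n. 2 / real n * rank_shift M (Uhat n x i) (U (x i)))" for x
  proof -
    have "(coeff_est n x m - ?\<rho> m)\<^sup>2
        \<le> 2 * a x m + (\<Sum>i<n. 2 / real n * (tensor_legendre m (Uhat n x i) - tensor_legendre m (U (x i)))\<^sup>2)" for m
    proof -
      let ?b = "(\<Sum>i<n. tensor_legendre m (Uhat n x i) - tensor_legendre m (U (x i))) / real n"
      have "(coeff_est n x m - ?\<rho> m)\<^sup>2 \<le> ((\<Sum>i<n. tensor_legendre m (Uhat n x i)) / real n - ?\<rho> m)\<^sup>2"
        by (rule coeff_est_error_le)
      also have "(\<Sum>i<n. tensor_legendre m (Uhat n x i)) / real n - ?\<rho> m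
          = ((\<Sum>i<n. tensor_legendre m (U (x i))) / real n - ?\<rho> m) + ?b"
        by (simp add: sum_subtractf diff_divide_distrib)
      also have "(((\<Sum>i<n. tensor_legendre m (U (x i))) / real n - ?\<rho> m) + ?b)\<^sup>2 \<le> 2 * a x m + 2 * ?b\<^sup>2"
        unfolding a_def by (rule square_sum_le_two)
      also have "\<dots> \<le> 2 * a x m + 2 * (\<Sum>i<n. (tensor_legendre m (Uhat n x i) - tensor_legendre m (U (x i)))\<^sup>2 / real n)"
        by (intro add_left_mono mult_left_mono mean_square_le n) simp
      finally show ?thesis by (simp add: sum_distrib_left)
    qed
    then have "(\<Sum>m\<in>M. (coeff_est n x m - ?\<rho> m)\<^sup>2) \<le> (\<Sum>m\<in>M. 2 * a x m
        + (\<Sum>i<n. 2 / real n * (tensor_legendre m (Uhat n x i) - tensor_legendre m (U (x i)))\<^sup>2))"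
      by (rule sum_mono)
    also have "\<dots> = (\<Sum>m\<in>M. 2 * a x m) + (\<Sum>i<n. 2 / real n * rank_shift M (Uhat n x i) (U (x i)))"
      unfolding sum.distrib rank_shift_def sum_distrib_left by (subst sum.swap) (rule refl)
    finally show ?thesis .
  qed
  have "(\<integral>\<^sup>+x. ennreal (\<Sum>m\<in>M. (coeff_est n x m - ?\<rho> m)\<^sup>2) \<partial>sample {..<n})
      \<le> (\<integral>\<^sup>+x. (\<Sum>m\<in>M. ennreal 2 * ennreal (a x m))
        + (\<Sum>i<n. ennreal (2 / real n) * ennreal (rank_shift M (Uhat n x i) (U (x i)))) \<partial>sample {..<n})"
  proof (rule nn_integral_mono)
    fix x
    have "(\<Sum>m\<in>M. ennreal 2 * ennreal (a x m)) + (\<Sum>i<n. ennreal (2 / real n) * ennreal (rank_shift M (Uhat n x i) (U (x i))))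
        = ennreal ((\<Sum>m\<in>M. 2 * a x m) + (\<Sum>i<n. 2 / real n * rank_shift M (Uhat n x i) (U (x i))))"
      by (simp only: ennreal_mult[symmetric] a0 s0 sum_ennreal mult_nonneg_nonneg divide_nonneg_nonneg of_nat_0_le_iff
          zero_le_numeral ennreal_plus sum_nonneg)
    then show "ennreal (\<Sum>m\<in>M. (coeff_est n x m - ?\<rho> m)\<^sup>2) \<le> (\<Sum>m\<in>M. ennreal 2 * ennreal (a x m))
        + (\<Sum>i<n. ennreal (2 / real n) * ennreal (rank_shift M (Uhat n x i) (U (x i))))"
      using ennreal_leI[OF point[of x]] by (simp only:)
  qed
  also have "\<dots> = (\<Sum>m\<in>M. ennreal 2 * (\<integral>\<^sup>+x. ennreal (a x m) \<partial>sample {..<n}))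
      + (\<Sum>i<n. ennreal (2 / real n) * (\<integral>\<^sup>+x. ennreal (rank_shift M (Uhat n x i) (U (x i))) \<partial>sample {..<n}))"
  proof -
    have 1: "(\<lambda>x. ennreal (a x m)) \<in> borel_measurable (sample {..<n})" for m
      by (rule measurable_compose[OF a_meas measurable_ennreal])
    have 2: "(\<lambda>x. ennreal (rank_shift M (Uhat n x i) (U (x i)))) \<in> borel_measurable (sample {..<n})" if "i \<in> {..<n}" for i
      using that by (intro measurable_compose[OF s_meas measurable_ennreal]) simp
    have 3: "(\<lambda>x. ennreal 2 * ennreal (a x m)) \<in> borel_measurable (sample {..<n})" for m
      by (intro borel_measurable_times_ennreal 1) simp
    have 4: "(\<lambda>x. ennreal (2 / real n) * ennreal (rank_shift M (Uhat n x i) (U (x i)))) \<in> borel_measurable (sample {..<n})" if "i \<in> {..<n}" for i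
      by (intro borel_measurable_times_ennreal 2 that) simp
    have "(\<integral>\<^sup>+x. (\<Sum>m\<in>M. ennreal 2 * ennreal (a x m))
        + (\<Sum>i<n. ennreal (2 / real n) * ennreal (rank_shift M (Uhat n x i) (U (x i)))) \<partial>sample {..<n})
      = (\<integral>\<^sup>+x. (\<Sum>m\<in>M. ennreal 2 * ennreal (a x m)) \<partial>sample {..<n})
        + (\<integral>\<^sup>+x. (\<Sum>i<n. ennreal (2 / real n) * ennreal (rank_shift M (Uhat n x i) (U (x i)))) \<partial>sample {..<n})"
      by (intro nn_integral_add borel_measurable_sum 3 4)
    also have "(\<integral>\<^sup>+x. (\<Sum>m\<in>M. ennreal 2 * ennreal (a x m)) \<partial>sample {..<n})
        = (\<Sum>m\<in>M. ennreal 2 * (\<integral>\<^sup>+x. ennreal (a x m) \<partial>sample {..<n}))"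
      by (subst nn_integral_sum[OF 3]) (intro sum.cong refl nn_integral_cmult 1)
    also have "(\<integral>\<^sup>+x. (\<Sum>i<n. ennreal (2 / real n) * ennreal (rank_shift M (Uhat n x i) (U (x i)))) \<partial>sample {..<n})
        = (\<Sum>i<n. ennreal (2 / real n) * (\<integral>\<^sup>+x. ennreal (rank_shift M (Uhat n x i) (U (x i))) \<partial>sample {..<n}))"
      by (subst nn_integral_sum[OF 4], assumption) (intro sum.cong refl nn_integral_cmult 2)
    finally show ?thesis .
  qed
  also have "\<dots> \<le> (\<Sum>m\<in>M. ennreal 2 * ennreal (V m)) + (\<Sum>i<n. ennreal (2 / real n) * ennreal R)"
    unfolding a_def V_def by (intro add_mono sum_mono mult_left_mono oracle_variance[OF n] R) simp_all
  also have "\<dots> = ennreal ((\<Sum>m\<in>M. 2 * V m) + (\<Sum>i<n. 2 / real n * R))"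
    by (simp only: ennreal_mult[symmetric] V0 R0 sum_ennreal mult_nonneg_nonneg divide_nonneg_nonneg of_nat_0_le_iff
          zero_le_numeral ennreal_plus sum_nonneg)
  also have "(\<Sum>m\<in>M. 2 * V m) + (\<Sum>i<n. 2 / real n * R)
      = 2 * (\<Sum>m\<in>M. LINT x|P. (tensor_legendre m (U x))\<^sup>2) / real n + 2 * R"
    using n by (simp add: V_def sum_distrib_left sum_divide_distrib)
  finally show ?thesis .
qed

text \<open>By Parseval this is the sum of \<open>\<rho>\<^sub>m\<^sup>2\<close> over the omitted indices.\<close>

definition bias :: "nat ^ 'd \<Rightarrow> real" where
  "bias N = (LINT u|unit_cube. (c u)\<^sup>2) - (\<Sum>m | m \<le> N. (copula_coeff c m)\<^sup>2)"

text \<open>The loss is, for every sample, the squared coefficient error plus the bias.\<close>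

lemma risk_le:
  assumes c2: "integrable unit_cube (\<lambda>u. (c u)\<^sup>2)"
    and V: "(\<integral>\<^sup>+x. ennreal (\<Sum>m | m \<le> N. (coeff_est n x m - copula_coeff c m)\<^sup>2) \<partial>sample {..<n}) \<le> ennreal V"
    and "0 \<le> V" "bias N \<le> B"
  shows "risk n P c N \<le> ennreal (V + B)"
proof -
  interpret S: prob_space "sample {..<n}" by (rule prob_space_sample)
  let ?E = "\<lambda>x. \<Sum>m | m \<le> N. (coeff_est n x m - copula_coeff c m)\<^sup>2"
  have bias0: "0 \<le> bias N"
  proof -
    have "0 \<le> (LINT u|unit_cube. ((\<Sum>m | m \<le> N. copula_coeff c m * tensor_legendre m u) - c u)\<^sup>2)"
      by (rule integral_nonneg_AE) simp
    then show ?thesis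
      unfolding integral_square_diff_expansion(2)[OF c_measurable c2 finite_vec_atMost] bias_def by simp
  qed
  have "l2_norm_sq (\<lambda>u. density_est n x N u - c u) = ennreal (?E x + bias N)" for x
    unfolding l2_norm_sq_def density_est_def
    by (subst nn_integral_eq_integral)
      (simp_all add: integral_square_diff_expansion[OF c_measurable c2 finite_vec_atMost] bias_def add.commute)
  then have "risk n P c N = (\<integral>\<^sup>+x. ennreal (?E x + bias N) \<partial>sample {..<n})"
    unfolding risk_def by simp
  also have "\<dots> = (\<integral>\<^sup>+x. ennreal (?E x) + ennreal (bias N) \<partial>sample {..<n})"
    by (intro nn_integral_cong ennreal_plus sum_nonneg bias0) simp
  also have "\<dots> = (\<integral>\<^sup>+x. ennreal (?E x) \<partial>sample {..<n}) + (\<integral>\<^sup>+x. ennreal (bias N) \<partial>sample {..<n})"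
  proof (rule nn_integral_add)
    have "(\<lambda>x. coeff_est n x m) \<in> borel_measurable (sample {..<n})" for m
      unfolding coeff_est_def Uhat_def[symmetric]
      by (intro measurable_If borel_measurable_divide borel_measurable_sum tensor_Uhat_measurable) simp_all
    then show "(\<lambda>x. ennreal (?E x)) \<in> borel_measurable (sample {..<n})"
      by (intro measurable_compose[OF _ measurable_ennreal] borel_measurable_sum borel_measurable_power borel_measurable_diff) simp_all
  qed simp
  also have "\<dots> \<le> ennreal V + ennreal (bias N)"
    by (intro add_mono V) (simp add: S.emeasure_space_1)
  also have "\<dots> = ennreal (V + bias N)" using \<open>0 \<le> V\<close> bias0 by (simp add: ennreal_plus)
  also have "\<dots> \<le> ennreal (V + B)" using \<open>bias N \<le> B\<close> by (intro ennreal_leI) simp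
  finally show ?thesis .
qed

end

section \<open>Error caused by the ranks\<close>

text \<open>After factoring out the normalising constants all factors are bounded by \<open>1\<close>, so the difference of the products is at most
  the sum of the differences, each controlled by \<open>\<bar>L\<^sub>m'\<bar> \<le> m (m + 1) / 2\<close>.\<close>

lemma tensor_legendre_diff_square_le:
  fixes u v :: "real ^ 'd"
  assumes "\<And>j. u $ j \<in> {0..1}" "\<And>j. v $ j \<in> {0..1}"
  shows "(tensor_legendre m v - tensor_legendre m u)\<^sup>2
    \<le> (\<Prod>j\<in>UNIV. 2 * real (m $ j) + 1)
      * (real CARD('d) * (\<Sum>j\<in>UNIV. (real (m $ j) * (real (m $ j) + 1))\<^sup>2 * (v $ j - u $ j)\<^sup>2))"
proof -
  define y where "y j = real (m $ j) * (real (m $ j) + 1)" for j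
  define s where "s = (\<Prod>j\<in>UNIV. sqrt (2 * real (m $ j) + 1))"
  let ?l = "\<lambda>w j. legendre (m $ j) (2 * w $ j - 1)"
  have le1: "\<bar>?l w j\<bar> \<le> 1" if "\<And>j. w $ j \<in> {0..1}" for w :: "real ^ 'd" and j
    using that[of j] by (intro abs_legendre_le_1) auto
  have t: "tensor_legendre m w = s * (\<Prod>j\<in>UNIV. ?l w j)" for w :: "real ^ 'd"
    by (simp add: tensor_legendre_def shifted_legendre_def prod.distrib s_def)
  have "norm ((\<Prod>j\<in>UNIV. ?l v j) - (\<Prod>j\<in>UNIV. ?l u j)) \<le> (\<Sum>j\<in>UNIV. norm (?l v j - ?l u j))"
    by (rule norm_prod_diff) (simp_all only: real_norm_def le1 assms)
  also have "\<dots> \<le> (\<Sum>j\<in>UNIV. y j * \<bar>v $ j - u $ j\<bar>)"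
    unfolding y_def real_norm_def by (intro sum_mono legendre_lipschitz assms)
  finally have "\<bar>(\<Prod>j\<in>UNIV. ?l v j) - (\<Prod>j\<in>UNIV. ?l u j)\<bar>\<^sup>2 \<le> (\<Sum>j\<in>UNIV. y j * \<bar>v $ j - u $ j\<bar>)\<^sup>2"
    by (intro power_mono) simp_all
  also have "\<dots> \<le> real CARD('d) * (\<Sum>j\<in>UNIV. (y j)\<^sup>2 * (v $ j - u $ j)\<^sup>2)"
    using Cauchy_Schwarz_ineq_sum[of "\<lambda>_. 1" "\<lambda>j. y j * \<bar>v $ j - u $ j\<bar>" "UNIV :: 'd set"]
    by (simp add: power_mult_distrib)
  finally have "s\<^sup>2 * ((\<Prod>j\<in>UNIV. ?l v j) - (\<Prod>j\<in>UNIV. ?l u j))\<^sup>2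
      \<le> s\<^sup>2 * (real CARD('d) * (\<Sum>j\<in>UNIV. (y j)\<^sup>2 * (v $ j - u $ j)\<^sup>2))"
    by (intro mult_left_mono) simp_all
  moreover have "s\<^sup>2 = (\<Prod>j\<in>UNIV. 2 * real (m $ j) + 1)" by (simp add: s_def prod_power_distrib)
  moreover have "s\<^sup>2 * ((\<Prod>j\<in>UNIV. ?l v j) - (\<Prod>j\<in>UNIV. ?l u j))\<^sup>2 = (tensor_legendre m v - tensor_legendre m u)\<^sup>2"
    unfolding t right_diff_distrib[symmetric] power_mult_distrib ..
  ultimately show ?thesis unfolding y_def by simp
qed

lemma sum_odd: "(\<Sum>i\<le>n. 2 * real i + 1) = (real n + 1)\<^sup>2"
  by (induction n) (simp_all add: power2_eq_square algebra_simps)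

text \<open>Relative to the total weight \<open>(n + 1)\<^sup>2\<close> this is the mean of \<open>(i (i + 1))\<^sup>2\<close>. The trivial bound \<open>4 n\<^sup>4\<close> for \<open>n \<ge> 1\<close> would be too
  large in dimension \<open>4\<close>; the factor \<open>3\<close> is attained at \<open>n = 1\<close>.\<close>

lemma sum_odd_weighted_le:
  "(\<Sum>i\<le>n. (2 * real i + 1) * (real i * (real i + 1))\<^sup>2) \<le> 3 * real n ^ 4 * (real n + 1)\<^sup>2"
proof (induction n)
  case (Suc n)
  define r where "r = real n"
  have r: "0 \<le> r" by (simp add: r_def)
  have "(2 * (r + 1) + 1) * ((r + 1) * (r + 2))\<^sup>2 + 3 * r ^ 4 * (r + 1)\<^sup>2 \<le> 3 * (r + 1) ^ 4 * (r + 2)\<^sup>2"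
  proof -
    have "3 * (r + 1) ^ 4 * (r + 2)\<^sup>2 - ((2 * (r + 1) + 1) * ((r + 1) * (r + 2))\<^sup>2 + 3 * r ^ 4 * (r + 1)\<^sup>2)
        = (r + 1)\<^sup>2 * (16 * r ^ 3 + 28 * r\<^sup>2 + 16 * r)"
      by (simp add: power2_eq_square power3_eq_cube power4_eq_xxxx algebra_simps)
    moreover have "0 \<le> (r + 1)\<^sup>2 * (16 * r ^ 3 + 28 * r\<^sup>2 + 16 * r)" using r by simp
    ultimately show ?thesis by linarith
  qed
  with Suc show ?case by (simp add: r_def add_ac)
qed simp

lemma sum_prod_odd: "(\<Sum>m | m \<le> N. \<Prod>j\<in>UNIV. 2 * real (m $ j) + 1) = (\<Prod>j\<in>UNIV. (real (N $ j) + 1)\<^sup>2)"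
  unfolding sum_prod_vec_atMost[of "\<lambda>j i. 2 * real i + 1"] sum_odd ..

lemma sum_prod_odd_weighted_le:
  fixes N :: "nat ^ 'd"
  shows "(\<Sum>m | m \<le> N. (\<Prod>k\<in>UNIV. 2 * real (m $ k) + 1) * (real (m $ j) * (real (m $ j) + 1))\<^sup>2)
    \<le> 3 * real (N $ j) ^ 4 * (\<Prod>k\<in>UNIV. (real (N $ k) + 1)\<^sup>2)"
proof -
  define f where "f k i = (2 * real i + 1) * (if k = j then (real i * (real i + 1))\<^sup>2 else 1)" for k i
  have pick: "(\<Prod>k\<in>UNIV. if k = j then a else 1) = (a :: real)" for a
    by (simp add: prod.delta)
  have "(\<Sum>m | m \<le> N. (\<Prod>k\<in>UNIV. 2 * real (m $ k) + 1) * (real (m $ j) * (real (m $ j) + 1))\<^sup>2)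
      = (\<Sum>m | m \<le> N. \<Prod>k\<in>UNIV. f k (m $ k))"
  proof (rule sum.cong[OF refl])
    fix m :: "nat ^ 'd"
    have "(\<Prod>k\<in>UNIV. f k (m $ k)) = (\<Prod>k\<in>UNIV. 2 * real (m $ k) + 1)
        * (\<Prod>k\<in>UNIV. if k = j then (real (m $ j) * (real (m $ j) + 1))\<^sup>2 else 1)"
      unfolding prod.distrib[symmetric] by (intro prod.cong) (auto simp: f_def)
    then show "(\<Prod>k\<in>UNIV. 2 * real (m $ k) + 1) * (real (m $ j) * (real (m $ j) + 1))\<^sup>2 = (\<Prod>k\<in>UNIV. f k (m $ k))"
      unfolding pick by (rule sym)
  qed
  also have "\<dots> = (\<Prod>k\<in>UNIV. \<Sum>i\<le>N $ k. f k i)" by (rule sum_prod_vec_atMost)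
  also have "\<dots> \<le> (\<Prod>k\<in>UNIV. (real (N $ k) + 1)\<^sup>2 * (if k = j then 3 * real (N $ j) ^ 4 else 1))"
  proof (rule prod_mono)
    fix k
    have "(\<Sum>i\<le>N $ k. f k i) \<le> (real (N $ k) + 1)\<^sup>2 * (if k = j then 3 * real (N $ j) ^ 4 else 1)"
      using sum_odd_weighted_le[of "N $ j"] sum_odd[of "N $ k"]
      by (cases "k = j") (simp_all add: f_def mult.commute[of "(real (N $ j) + 1)\<^sup>2"])
    moreover have "0 \<le> (\<Sum>i\<le>N $ k. f k i)" by (auto simp: f_def intro!: sum_nonneg)
    ultimately show "0 \<le> (\<Sum>i\<le>N $ k. f k i) \<and> (\<Sum>i\<le>N $ k. f k i)
        \<le> (real (N $ k) + 1)\<^sup>2 * (if k = j then 3 * real (N $ j) ^ 4 else 1)" by blast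
  qed
  also have "\<dots> = 3 * real (N $ j) ^ 4 * (\<Prod>k\<in>UNIV. (real (N $ k) + 1)\<^sup>2)"
    unfolding prod.distrib pick by (rule mult.commute)
  finally show ?thesis .
qed

context copula_law
begin

lemma estimation_error_polynomial_le:
  fixes n :: nat and N :: "nat ^ 'd"
  assumes n: "0 < n"
  shows "(\<integral>\<^sup>+x. ennreal (\<Sum>m | m \<le> N. (coeff_est n x m - copula_coeff c m)\<^sup>2) \<partial>sample {..<n})
    \<le> ennreal (2 / real n * (\<Prod>j\<in>UNIV. (real (N $ j) + 1)\<^sup>2)
        * (1 + real CARD('d) * (\<Sum>j\<in>UNIV. real (N $ j) ^ 4)))"
proof -
  define B where "B m = (\<Prod>j\<in>UNIV. 2 * real (m $ j) + 1)" for m :: "nat ^ 'd"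
  define Pi where "Pi = (\<Prod>j\<in>UNIV. (real (N $ j) + 1)\<^sup>2)"
  define \<kappa> where "\<kappa> j = real CARD('d) * (3 * real (N $ j) ^ 4 * Pi)" for j
  have B0: "0 \<le> B m" for m by (auto simp: B_def intro!: prod_nonneg)
  have Pi0: "0 \<le> Pi" by (auto simp: Pi_def intro!: prod_nonneg)
  have \<kappa>0: "0 \<le> \<kappa> j" for j by (simp add: \<kappa>_def Pi0)
  define R where "R = (\<Sum>j\<in>UNIV. \<kappa> j * (1 / (3 * real n)))"
  have R0: "0 \<le> R" unfolding R_def using \<kappa>0 by (intro sum_nonneg mult_nonneg_nonneg) simp_all
  define \<Delta> where "\<Delta> i j x = (ecdf n x j (x i $ j) - marginal_cdf P j (x i $ j))\<^sup>2" for i j x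
  have shift: "rank_shift {m. m \<le> N} (Uhat n x i) (U (x i)) \<le> (\<Sum>j\<in>UNIV. \<kappa> j * \<Delta> i j x)" for x i
  proof -
    have "rank_shift {m. m \<le> N} (Uhat n x i) (U (x i))
        \<le> (\<Sum>m | m \<le> N. B m * (real CARD('d) * (\<Sum>j\<in>UNIV. (real (m $ j) * (real (m $ j) + 1))\<^sup>2 * \<Delta> i j x)))"
      unfolding rank_shift_def
    proof (rule sum_mono)
      fix m :: "nat ^ 'd"
      have "(tensor_legendre m (Uhat n x i) - tensor_legendre m (U (x i)))\<^sup>2 \<le> B m * (real CARD('d)
          * (\<Sum>j\<in>UNIV. (real (m $ j) * (real (m $ j) + 1))\<^sup>2 * (Uhat n x i $ j - U (x i) $ j)\<^sup>2))"
        unfolding B_def by (rule tensor_legendre_diff_square_le) (simp_all only: U_nth Uhat_nth marginal_cdf_bounds ecdf_bounds)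
      then show "(tensor_legendre m (Uhat n x i) - tensor_legendre m (U (x i)))\<^sup>2
          \<le> B m * (real CARD('d) * (\<Sum>j\<in>UNIV. (real (m $ j) * (real (m $ j) + 1))\<^sup>2 * \<Delta> i j x))"
        by (simp only: U_nth Uhat_nth \<Delta>_def)
    qed
    also have "\<dots> = (\<Sum>j\<in>UNIV. real CARD('d) * (\<Sum>m | m \<le> N. B m * (real (m $ j) * (real (m $ j) + 1))\<^sup>2) * \<Delta> i j x)"
      unfolding sum_distrib_left sum_distrib_right
      by (subst sum.swap) (simp add: mult_ac)
    also have "\<dots> \<le> (\<Sum>j\<in>UNIV. \<kappa> j * \<Delta> i j x)"
      unfolding \<kappa>_def B_def Pi_def
      by (intro sum_mono mult_right_mono mult_left_mono sum_prod_odd_weighted_le) (simp_all add: \<Delta>_def)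
    finally show ?thesis .
  qed
  have R: "(\<integral>\<^sup>+x. ennreal (rank_shift {m. m \<le> N} (Uhat n x i) (U (x i))) \<partial>sample {..<n}) \<le> ennreal R" if i: "i < n" for i
  proof -
    have meas: "(\<lambda>x. ennreal (\<Delta> i j x)) \<in> borel_measurable (sample {..<n})" for j
      unfolding \<Delta>_def by (intro measurable_compose[OF _ measurable_ennreal] borel_measurable_power ecdf_error_measurable i)
    have \<Delta>0: "0 \<le> \<Delta> i j x" for j x by (simp add: \<Delta>_def)
    have "(\<integral>\<^sup>+x. ennreal (rank_shift {m. m \<le> N} (Uhat n x i) (U (x i))) \<partial>sample {..<n})
        \<le> (\<integral>\<^sup>+x. (\<Sum>j\<in>UNIV. ennreal (\<kappa> j) * ennreal (\<Delta> i j x)) \<partial>sample {..<n})"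
    proof (rule nn_integral_mono)
      fix x
      have "(\<Sum>j\<in>UNIV. ennreal (\<kappa> j) * ennreal (\<Delta> i j x)) = ennreal (\<Sum>j\<in>UNIV. \<kappa> j * \<Delta> i j x)"
        by (simp only: ennreal_mult[symmetric] \<kappa>0 \<Delta>0 sum_ennreal mult_nonneg_nonneg)
      then show "ennreal (rank_shift {m. m \<le> N} (Uhat n x i) (U (x i))) \<le> (\<Sum>j\<in>UNIV. ennreal (\<kappa> j) * ennreal (\<Delta> i j x))"
        using ennreal_leI[OF shift[of x i]] by (simp only:)
    qed
    also have "\<dots> = (\<Sum>j\<in>UNIV. \<integral>\<^sup>+x. ennreal (\<kappa> j) * ennreal (\<Delta> i j x) \<partial>sample {..<n})"
      by (intro nn_integral_sum borel_measurable_times_ennreal meas) simp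
    also have "\<dots> = (\<Sum>j\<in>UNIV. ennreal (\<kappa> j) * (\<integral>\<^sup>+x. ennreal (\<Delta> i j x) \<partial>sample {..<n}))"
      by (intro sum.cong refl nn_integral_cmult meas)
    also have "\<dots> \<le> (\<Sum>j\<in>UNIV. ennreal (\<kappa> j) * ennreal (1 / (3 * real n)))"
      unfolding \<Delta>_def by (intro sum_mono mult_left_mono ecdf_mean_square_error i) simp
    also have "\<dots> = ennreal R"
      unfolding R_def by (simp only: ennreal_mult[symmetric] \<kappa>0 sum_ennreal mult_nonneg_nonneg
          divide_nonneg_nonneg zero_le_one zero_le_numeral of_nat_0_le_iff)
    finally show ?thesis .
  qed
  have "(LINT x|P. (tensor_legendre m (U x))\<^sup>2) \<le> B m" for m
  proof -
    have sq: "(tensor_legendre m (U x))\<^sup>2 \<le> B m" for x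
    proof -
      have "\<bar>tensor_legendre m (U x)\<bar>\<^sup>2 \<le> (\<Prod>j\<in>UNIV. sqrt (2 * real (m $ j) + 1))\<^sup>2"
        by (intro power_mono abs_tensor_U_le) simp
      then show ?thesis by (simp add: B_def prod_power_distrib)
    qed
    have "(LINT x|P. (tensor_legendre m (U x))\<^sup>2) \<le> (LINT x|P. B m)"
    proof (rule integral_mono_AE')
      show "integrable P (\<lambda>x. B m)" by simp
    qed (simp_all add: sq B0)
    then show ?thesis by simp
  qed
  then have "(\<Sum>m | m \<le> N. LINT x|P. (tensor_legendre m (U x))\<^sup>2) \<le> (\<Sum>m | m \<le> N. B m)" by (intro sum_mono)
  also have "\<dots> = Pi" unfolding B_def Pi_def by (rule sum_prod_odd)
  finally have V: "(\<Sum>m | m \<le> N. LINT x|P. (tensor_legendre m (U x))\<^sup>2) \<le> Pi" .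
  have "(\<integral>\<^sup>+x. ennreal (\<Sum>m | m \<le> N. (coeff_est n x m - copula_coeff c m)\<^sup>2) \<partial>sample {..<n})
      \<le> ennreal (2 * (\<Sum>m | m \<le> N. LINT x|P. (tensor_legendre m (U x))\<^sup>2) / real n + 2 * R)"
    by (rule estimation_error_le[OF n finite_vec_atMost R0 R])
  also have "\<dots> \<le> ennreal (2 * Pi / real n + 2 * R)"
    by (intro ennreal_leI add_right_mono divide_right_mono mult_left_mono V) simp_all
  also have "2 * Pi / real n + 2 * R = 2 / real n * Pi * (1 + real CARD('d) * (\<Sum>j\<in>UNIV. real (N $ j) ^ 4))"
  proof -
    have "R = real CARD('d) * Pi * (\<Sum>j\<in>UNIV. real (N $ j) ^ 4) / real n"
      by (simp add: R_def \<kappa>_def sum_distrib_left sum_divide_distrib mult_ac)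
    then show ?thesis by (simp add: distrib_left mult_ac)
  qed
  finally show ?thesis unfolding Pi_def .
qed

end

lemma abs_le_of_square_le: "x\<^sup>2 \<le> y\<^sup>2 \<Longrightarrow> 0 \<le> y \<Longrightarrow> \<bar>x\<bar> \<le> (y :: real)"
  by (rule power2_le_imp_le) simp_all

text \<open>Read \<open>p\<close>, \<open>q\<close> and \<open>r\<close> as \<open>\<bar>v\<bar>\<^sup>2\<close>, \<open>\<bar>v'\<bar>\<^sup>2\<close> and \<open>\<langle>v, v'\<rangle>\<close> for vectors with \<open>\<bar>v' - v\<bar> \<le> s \<bar>v\<bar>\<close>. The products are then the same
  quantities for tensor products of the vectors, and the claim is the telescoping estimate
  \<open>\<bar>\<Otimes>v' - \<Otimes>v\<bar> \<le> (\<Prod>(1 + s) - 1) \<Prod>\<bar>v\<bar>\<close>. The second conjunct, Cauchy--Schwarz, is carried along because the induction step uses it.\<close>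

lemma product_vector_distance:
  fixes p q r s :: "'i \<Rightarrow> real"
  assumes "finite I" and p: "\<And>i. i \<in> I \<Longrightarrow> 0 \<le> p i" and q: "\<And>i. i \<in> I \<Longrightarrow> 0 \<le> q i" and s: "\<And>i. i \<in> I \<Longrightarrow> 0 \<le> s i"
    and r: "\<And>i. i \<in> I \<Longrightarrow> (r i)\<^sup>2 \<le> p i * q i"
    and dist: "\<And>i. i \<in> I \<Longrightarrow> p i + q i - 2 * r i \<le> (s i)\<^sup>2 * p i"
  shows "prod p I + prod q I - 2 * prod r I \<le> prod p I * ((\<Prod>i\<in>I. 1 + s i) - 1)\<^sup>2
    \<and> (prod r I)\<^sup>2 \<le> prod p I * prod q I"
  using assms
proof (induction I)
  case (insert i I)
  define P Q R E where "P = prod p I" and "Q = prod q I" and "R = prod r I" and "E = (\<Prod>i\<in>I. 1 + s i) - 1"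
  define p' q' r' s' where "p' = p i" and "q' = q i" and "r' = r i" and "s' = s i"
  have IH: "P + Q - 2 * R \<le> P * E\<^sup>2" "R\<^sup>2 \<le> P * Q"
    unfolding P_def Q_def R_def E_def using insert by blast+
  have nn: "0 \<le> P" "0 \<le> Q" "0 \<le> p'" "0 \<le> q'" "0 \<le> s'"
    unfolding P_def Q_def p'_def q'_def s'_def using insert.prems by (auto intro!: prod_nonneg)
  have loc: "r'\<^sup>2 \<le> p' * q'" "p' + q' - 2 * r' \<le> s'\<^sup>2 * p'"
    unfolding p'_def q'_def r'_def s'_def using insert.prems by blast+
  have E: "0 \<le> E"
  proof -
    have "1 \<le> (\<Prod>i\<in>I. 1 + s i)" using insert.prems(3) by (intro prod_ge_1) simp
    then show ?thesis by (simp add: E_def)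
  qed
  have sqrt_q: "sqrt q' \<le> sqrt p' * (1 + s')"
  proof -
    have "\<bar>r'\<bar> \<le> sqrt p' * sqrt q'"
      using real_sqrt_le_mono[OF loc(1)] by (simp add: real_sqrt_mult)
    then have "(sqrt q' - sqrt p')\<^sup>2 \<le> s'\<^sup>2 * p'"
      using loc(2) nn by (simp add: power2_diff mult_ac)
    also have "\<dots> = (s' * sqrt p')\<^sup>2" using nn by (simp add: power_mult_distrib)
    finally have "\<bar>sqrt q' - sqrt p'\<bar> \<le> \<bar>s' * sqrt p'\<bar>" by (simp only: abs_le_square_iff)
    then show ?thesis using nn by (simp add: algebra_simps)
  qed
  have q_le: "q' \<le> p' * (1 + s')\<^sup>2"
    using power_mono[OF sqrt_q, of 2] nn by (simp add: power_mult_distrib)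
  \<comment> \<open>Cauchy--Schwarz for \<open>\<langle>v', v' - v\<rangle> = q' - r'\<close>\<close>
  have "(q' - r')\<^sup>2 \<le> q' * (p' + q' - 2 * r')"
    using loc(1) by (simp add: power2_eq_square algebra_simps)
  also have "\<dots> \<le> (p' * (1 + s')\<^sup>2) * (s'\<^sup>2 * p')"
  proof -
    have "q' * (p' + q' - 2 * r') \<le> q' * (s'\<^sup>2 * p')" by (intro mult_left_mono loc(2) nn)
    also have "\<dots> \<le> (p' * (1 + s')\<^sup>2) * (s'\<^sup>2 * p')" using nn by (intro mult_right_mono q_le) simp
    finally show ?thesis .
  qed
  also have "\<dots> = (p' * (s' * (1 + s')))\<^sup>2" by (simp add: power_mult_distrib power2_eq_square mult_ac)
  finally have qr: "\<bar>q' - r'\<bar> \<le> p' * (s' * (1 + s'))"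
    by (rule abs_le_of_square_le) (use nn in simp)
  \<comment> \<open>Cauchy--Schwarz for \<open>\<langle>V' - V, V\<rangle> = R - P\<close>\<close>
  have "(R - P)\<^sup>2 \<le> P * (P + Q - 2 * R)"
    using IH(2) by (simp add: power2_eq_square algebra_simps)
  also have "\<dots> \<le> P * (P * E\<^sup>2)" by (intro mult_left_mono IH(1) nn)
  also have "\<dots> = (P * E)\<^sup>2" by (simp add: power2_eq_square mult_ac)
  finally have RP: "\<bar>R - P\<bar> \<le> P * E"
    by (rule abs_le_of_square_le) (use nn E in simp)
  \<comment> \<open>the square of \<open>v' \<otimes> (V' - V) + (v' - v) \<otimes> V\<close>\<close>
  have "p' * P + q' * Q - 2 * (r' * R) = q' * (P + Q - 2 * R) + P * (p' + q' - 2 * r') + 2 * ((q' - r') * (R - P))"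
    by (simp add: algebra_simps)
  also have "\<dots> \<le> (p' * (1 + s')\<^sup>2) * (P * E\<^sup>2) + P * (s'\<^sup>2 * p') + 2 * ((p' * (s' * (1 + s'))) * (P * E))"
  proof (intro add_mono mult_left_mono[of _ _ 2])
    have "q' * (P + Q - 2 * R) \<le> q' * (P * E\<^sup>2)" by (intro mult_left_mono IH(1) nn)
    also have "\<dots> \<le> (p' * (1 + s')\<^sup>2) * (P * E\<^sup>2)" using nn by (intro mult_right_mono q_le) simp
    finally show "q' * (P + Q - 2 * R) \<le> (p' * (1 + s')\<^sup>2) * (P * E\<^sup>2)" .
    show "P * (p' + q' - 2 * r') \<le> P * (s'\<^sup>2 * p')" by (intro mult_left_mono loc(2) nn)
    have "(q' - r') * (R - P) \<le> \<bar>q' - r'\<bar> * \<bar>R - P\<bar>" by (simp flip: abs_mult)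
    also have "\<dots> \<le> (p' * (s' * (1 + s'))) * (P * E)" using nn by (intro mult_mono qr RP) simp_all
    finally show "(q' - r') * (R - P) \<le> (p' * (s' * (1 + s'))) * (P * E)" .
  qed simp
  also have "\<dots> = p' * P * ((1 + s') * (1 + E) - 1)\<^sup>2"
    by (simp add: power2_eq_square algebra_simps)
  also have "(1 + s') * (1 + E) = (\<Prod>k\<in>insert i I. 1 + s k)"
    using insert.hyps by (simp add: s'_def E_def)
  finally have 1: "prod p (insert i I) + prod q (insert i I) - 2 * prod r (insert i I)
      \<le> prod p (insert i I) * ((\<Prod>i\<in>insert i I. 1 + s i) - 1)\<^sup>2"
    using insert.hyps by (simp add: p'_def q'_def r'_def P_def Q_def R_def mult_ac)
  have "(r' * R)\<^sup>2 \<le> (p' * q') * (P * Q)"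
    unfolding power_mult_distrib using nn by (intro mult_mono loc(1) IH(2)) simp_all
  then have 2: "(prod r (insert i I))\<^sup>2 \<le> prod p (insert i I) * prod q (insert i I)"
    using insert.hyps by (simp add: p'_def q'_def r'_def P_def Q_def R_def mult_ac)
  from 1 2 show ?case ..
qed simp

text \<open>The sum of \<open>Q\<^sub>m(u)\<^sup>2\<close> over \<open>m \<le> 1\<close>, see \<open>sum_tensor_one_square\<close>.\<close>

definition multilinear_weight :: "real ^ 'd \<Rightarrow> real" where
  "multilinear_weight u = (\<Prod>k\<in>UNIV. 1 + 3 * (2 * u $ k - 1)\<^sup>2)"

lemma sum_tensor_one:
  fixes u v :: "real ^ 'd"
  shows "(\<Sum>m | m \<le> 1. tensor_legendre m u * tensor_legendre m v) = (\<Prod>k\<in>UNIV. 1 + 3 * ((2 * u $ k - 1) * (2 * v $ k - 1)))"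
proof -
  have "(\<Sum>m | m \<le> 1. tensor_legendre m u * tensor_legendre m v)
      = (\<Prod>k\<in>UNIV. \<Sum>i\<le>(1 :: nat ^ 'd) $ k. shifted_legendre i (u $ k) * shifted_legendre i (v $ k))"
    unfolding tensor_legendre_def prod.distrib[symmetric]
    by (rule sum_prod_vec_atMost[of "\<lambda>k i. shifted_legendre i (u $ k) * shifted_legendre i (v $ k)"])
  also have "\<dots> = (\<Prod>k\<in>UNIV. 1 + 3 * ((2 * u $ k - 1) * (2 * v $ k - 1)))"
  proof (intro prod.cong refl)
    fix k
    have alg: "r * r = 3 \<Longrightarrow> (r * a) * (r * b) = 3 * (a * b)" for r a b :: real
      by (metis mult.assoc mult.left_commute)
    have "sqrt 3 * (2 * u $ k - 1) * (sqrt 3 * (2 * v $ k - 1)) = 3 * ((2 * u $ k - 1) * (2 * v $ k - 1))"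
      by (rule alg) simp
    moreover have "{..Suc 0} = {0, Suc 0}" by auto
    ultimately show "(\<Sum>i\<le>(1 :: nat ^ 'd) $ k. shifted_legendre i (u $ k) * shifted_legendre i (v $ k))
        = 1 + 3 * ((2 * u $ k - 1) * (2 * v $ k - 1))"
      by (simp only: one_index One_nat_def) (simp add: shifted_legendre_def)
  qed
  finally show ?thesis .
qed

lemma sum_tensor_one_square: "(\<Sum>m | m \<le> 1. (tensor_legendre m u)\<^sup>2) = multilinear_weight u"
  using sum_tensor_one[of u u] by (simp add: multilinear_weight_def power2_eq_square)

text \<open>The features with \<open>m \<le> 1\<close> are the entries of the tensor product of the vectors \<open>(1, sqrt 3 (2 u\<^sub>k - 1))\<close>, whose lengths are
  at least \<open>1\<close>.\<close>

lemma rank_shift_one_le: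
  fixes u v :: "real ^ 'd"
  shows "(\<Sum>m | m \<le> 1. (tensor_legendre m v - tensor_legendre m u)\<^sup>2)
    \<le> multilinear_weight u * (exp (\<Sum>k\<in>UNIV. 2 * sqrt 3 * \<bar>v $ k - u $ k\<bar>) - 1)\<^sup>2"
proof -
  define x where "x w k = 2 * w $ k - 1" for w :: "real ^ 'd" and k
  define s where "s k = 2 * sqrt 3 * \<bar>v $ k - u $ k\<bar>" for k
  have s0: "0 \<le> s k" for k by (simp add: s_def)
  have "(\<Sum>m | m \<le> 1. (tensor_legendre m v - tensor_legendre m u)\<^sup>2) = multilinear_weight u + multilinear_weight v
      - 2 * (\<Prod>k\<in>UNIV. 1 + 3 * (x u k * x v k))"
  proof -
    have "(tensor_legendre m v - tensor_legendre m u)\<^sup>2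
        = (tensor_legendre m u)\<^sup>2 + (tensor_legendre m v)\<^sup>2 - 2 * (tensor_legendre m u * tensor_legendre m v)" for m
      by (simp add: power2_diff)
    then show ?thesis
      by (simp only: sum.distrib sum_subtractf sum_distrib_left[symmetric] sum_tensor_one sum_tensor_one_square x_def)
  qed
  also have "\<dots> \<le> multilinear_weight u * ((\<Prod>k\<in>UNIV. 1 + s k) - 1)\<^sup>2"
    unfolding multilinear_weight_def x_def[symmetric]
  proof (rule product_vector_distance[THEN conjunct1])
    fix k
    show "(1 + 3 * (x u k * x v k))\<^sup>2 \<le> (1 + 3 * (x u k)\<^sup>2) * (1 + 3 * (x v k)\<^sup>2)"
    proof -
      have "(1 + 3 * (x u k)\<^sup>2) * (1 + 3 * (x v k)\<^sup>2) - (1 + 3 * (x u k * x v k))\<^sup>2 = 3 * (x u k - x v k)\<^sup>2"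
        by (simp add: power2_eq_square algebra_simps)
      then show ?thesis using zero_le_power2[of "x u k - x v k"] by linarith
    qed
    have "(1 + 3 * (x u k)\<^sup>2) + (1 + 3 * (x v k)\<^sup>2) - 2 * (1 + 3 * (x u k * x v k)) = 3 * (x v k - x u k)\<^sup>2"
      by (simp add: power2_eq_square algebra_simps)
    also have "x v k - x u k = 2 * (v $ k - u $ k)" by (simp add: x_def)
    also have "3 * (2 * (v $ k - u $ k))\<^sup>2 = (s k)\<^sup>2" by (simp only: s_def power_mult_distrib power2_abs) simp
    also have "\<dots> \<le> (s k)\<^sup>2 * (1 + 3 * (x u k)\<^sup>2)" by (simp add: mult_le_cancel_left1)
    finally show "(1 + 3 * (x u k)\<^sup>2) + (1 + 3 * (x v k)\<^sup>2) - 2 * (1 + 3 * (x u k * x v k)) \<le> (s k)\<^sup>2 * (1 + 3 * (x u k)\<^sup>2)" .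
  qed (simp_all add: s0)
  also have "\<dots> \<le> multilinear_weight u * (exp (\<Sum>k\<in>UNIV. s k) - 1)\<^sup>2"
  proof (intro mult_left_mono power_mono diff_right_mono)
    show "(\<Prod>k\<in>UNIV. 1 + s k) \<le> exp (\<Sum>k\<in>UNIV. s k)"
      unfolding exp_sum[OF finite] using s0 by (intro prod_mono) (auto intro: add_nonneg_nonneg)
    have "1 \<le> (\<Prod>k\<in>UNIV. 1 + s k)" using s0 by (intro prod_ge_1) simp
    then show "0 \<le> (\<Prod>k\<in>UNIV. 1 + s k) - 1" by simp
    show "0 \<le> multilinear_weight u" unfolding multilinear_weight_def by (intro prod_nonneg) simp
  qed
  finally show ?thesis unfolding s_def .
qed

text \<open>The left-hand side mixes the coordinates, whose rank errors are dependent. With \<open>x\<close> the exponent and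
  \<open>\<nu> = sqrt n / (sqrt 3 d)\<close>, one has \<open>exp x - 1 \<le> x exp x\<close>, and \<open>n \<ge> 48 d\<^sup>2\<close> makes \<open>\<nu> \<ge> 4\<close>, so that the factor \<open>x\<close> can be absorbed:
  \<open>(exp x - 1)\<^sup>2 \<le> 16 exp (\<nu> x - 2) / \<nu>\<^sup>2\<close>. Jensen's inequality then separates the coordinates.\<close>

lemma exp_sum_deviation_le:
  fixes \<Delta> :: "'d::finite \<Rightarrow> real" and n :: nat
  assumes n: "48 * (real CARD('d))\<^sup>2 \<le> real n"
  defines "w \<equiv> 2 / sqrt (real n)"
  shows "(exp (\<Sum>k\<in>UNIV. 2 * sqrt 3 * \<bar>\<Delta> k\<bar>) - 1)\<^sup>2
    \<le> 48 * exp (- 2) * real CARD('d) / real n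
      * (\<Sum>k\<in>UNIV. exp (w * (real n * \<Delta> k)) + exp (- w * (real n * \<Delta> k)))"
proof -
  define D where "D = real CARD('d)"
  define r where "r = sqrt (real n)"
  define x where "x = (\<Sum>k\<in>UNIV. 2 * sqrt 3 * \<bar>\<Delta> k\<bar>)"
  define \<nu> where "\<nu> = r / (sqrt 3 * D)"
  have D: "1 \<le> D" using zero_less_card_finite[where 'a = 'd] by (simp add: D_def)
  then have "48 * 1 \<le> 48 * D\<^sup>2" by (intro mult_left_mono) simp_all
  then have npos: "0 < real n" using n unfolding D_def by linarith
  then have r: "0 < r" "r\<^sup>2 = real n" by (simp_all add: r_def)
  have x0: "0 \<le> x" by (simp add: x_def sum_nonneg)
  have "(4 * (sqrt 3 * D))\<^sup>2 \<le> r\<^sup>2" using n by (simp add: r(2) power_mult_distrib D_def)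
  then have "4 * (sqrt 3 * D) \<le> r" by (rule power2_le_imp_le) (use r in simp)
  then have \<nu>: "4 \<le> \<nu>" using D by (simp add: \<nu>_def pos_le_divide_eq)
  have "1 - x \<le> exp (- x)" using exp_ge_add_one_self[of "- x"] by simp
  then have "exp x * (1 - x) \<le> exp x * exp (- x)" by (intro mult_left_mono) simp_all
  then have "exp x * (1 - x) \<le> 1" by (simp flip: exp_add)
  then have 1: "exp x - 1 \<le> x * exp x" by (simp add: algebra_simps)
  have "(\<nu> - 2) * x / 2 \<le> exp ((\<nu> - 2) * x / 2 - 1)" using exp_ge_add_one_self[of "(\<nu> - 2) * x / 2 - 1"] by simp
  moreover have "\<nu> / 4 * x \<le> (\<nu> - 2) * x / 2"
  proof -
    have "\<nu> / 4 \<le> (\<nu> - 2) / 2" using \<nu> by simp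
    from mult_right_mono[OF this x0] show ?thesis by simp
  qed
  ultimately have "\<nu> / 4 * x \<le> exp ((\<nu> - 2) * x / 2 - 1)" by linarith
  then have 2: "x \<le> 4 / \<nu> * exp ((\<nu> - 2) * x / 2 - 1)" using \<nu> by (simp add: field_simps)
  have "x * exp x \<le> 4 / \<nu> * exp ((\<nu> - 2) * x / 2 - 1) * exp x" by (intro mult_right_mono 2) simp
  also have "\<dots> = 4 / \<nu> * exp (\<nu> * x / 2 - 1)"
  proof -
    have "(\<nu> - 2) * x / 2 - 1 + x = \<nu> * x / 2 - 1" by (simp add: field_simps)
    then show ?thesis by (simp only: mult.assoc exp_add[symmetric])
  qed
  finally have "exp x - 1 \<le> 4 / \<nu> * exp (\<nu> * x / 2 - 1)" using 1 by linarith
  then have "(exp x - 1)\<^sup>2 \<le> (4 / \<nu> * exp (\<nu> * x / 2 - 1))\<^sup>2" using x0 by (intro power_mono) simp_all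
  also have "\<dots> = 48 * D\<^sup>2 / real n * (exp (- 2) * exp (\<nu> * x))"
  proof -
    have "(exp (\<nu> * x / 2 - 1))\<^sup>2 = exp (- 2) * exp (\<nu> * x)"
      by (simp add: power2_eq_square field_simps flip: exp_add)
    moreover have "(4 / \<nu>)\<^sup>2 = 48 * D\<^sup>2 / real n"
      using D r by (simp add: \<nu>_def power_divide power_mult_distrib)
    ultimately show ?thesis by (simp only: power_mult_distrib)
  qed
  also have "\<dots> \<le> 48 * D\<^sup>2 / real n * (exp (- 2) * ((\<Sum>k\<in>UNIV. exp (w * (real n * \<Delta> k)) + exp (- w * (real n * \<Delta> k))) / D))"
  proof (intro mult_left_mono)
    have "\<nu> * x = (\<Sum>k\<in>UNIV. (1 / D) *\<^sub>R (2 * r * \<bar>\<Delta> k\<bar>))"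
      by (simp add: x_def \<nu>_def sum_distrib_left mult_ac)
    also have "exp \<dots> \<le> (\<Sum>k\<in>UNIV. (1 / D) * exp (2 * r * \<bar>\<Delta> k\<bar>))"
      using D by (intro convex_on_sum[OF _ _ exp_convex]) (simp_all add: D_def)
    also have "\<dots> \<le> (\<Sum>k\<in>UNIV. (1 / D) * (exp (w * (real n * \<Delta> k)) + exp (- w * (real n * \<Delta> k))))"
    proof (intro sum_mono mult_left_mono)
      fix k
      have 1: "w * (real n * \<Delta> k) = 2 * r * \<Delta> k"
        using r by (simp add: w_def r_def[symmetric] r(2)[symmetric] power2_eq_square)
      then have 2: "- w * (real n * \<Delta> k) = - (2 * r * \<Delta> k)" by simp
      show "exp (2 * r * \<bar>\<Delta> k\<bar>) \<le> exp (w * (real n * \<Delta> k)) + exp (- w * (real n * \<Delta> k))"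
        unfolding 1 2 by (cases "0 \<le> \<Delta> k") simp_all
    qed (use D in simp)
    finally show "exp (\<nu> * x) \<le> (\<Sum>k\<in>UNIV. exp (w * (real n * \<Delta> k)) + exp (- w * (real n * \<Delta> k))) / D"
      by (simp add: sum_divide_distrib)
  qed simp_all
  also have "\<dots> = 48 * exp (- 2) * D / real n * (\<Sum>k\<in>UNIV. exp (w * (real n * \<Delta> k)) + exp (- w * (real n * \<Delta> k)))"
    using D by (simp add: power2_eq_square field_simps)
  finally show ?thesis by (simp only: x_def D_def)
qed

text \<open>Here \<open>96 = 48 * 2\<close> collects the constants of \<open>exp_sum_deviation_le\<close> and the two signs of the exponent.\<close>

lemma exp_numeral_bound:
  assumes "w \<le> 0.06" shows "96 * (exp (- 2) * exp (w + 1 / 2)) \<le> (23 :: real)"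
proof -
  have "1 + 0.18 + (0.18)\<^sup>2 / 2 \<le> exp (0.18 :: real)" by (rule exp_lower_Taylor_quadratic) simp
  then have "(1 + 0.18 + (0.18)\<^sup>2 / 2) ^ 8 \<le> exp (0.18 :: real) ^ 8" by (rule power_mono) simp
  also have "exp (0.18 :: real) ^ 8 = exp (1.44)" by (simp flip: exp_of_nat_mult)
  finally have lower: "96 / 23 \<le> exp (1.44 :: real)" by (rule order_trans[rotated]) (simp add: power2_eq_square eval_nat_numeral)
  have "exp (- 2) * exp (w + 1 / 2) = exp (w - 3 / 2)" by (simp flip: exp_add)
  also have "\<dots> \<le> exp (- 1.44)" using assms by simp
  also have "\<dots> = 1 / exp (1.44)" by (simp add: exp_minus field_simps)
  also have "\<dots> \<le> 1 / (96 / 23)" by (intro divide_left_mono lower) simp_all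
  finally show ?thesis by simp
qed

context copula_law
begin

text \<open>The expected squared length of the feature vector with \<open>m \<le> 1\<close>: an upper bound for \<open>n\<close> times the total oracle variance and for the
  sum of the squared coefficients with \<open>m \<le> 1\<close>. It is \<open>2 ^ d\<close> under independence but can approach \<open>4 ^ d\<close> up to a polynomial
  factor in \<open>d\<close> for strongly dependent coordinates.\<close>

definition multilinear_energy :: real where
  "multilinear_energy = (LINT x|P. multilinear_weight (U x))"

lemma multilinear_weight_nonneg: "0 \<le> multilinear_weight u"
  unfolding multilinear_weight_def by (intro prod_nonneg) simp

lemma multilinear_weight_U_measurable: "(\<lambda>x. multilinear_weight (U x)) \<in> borel_measurable borel"
  unfolding multilinear_weight_def U_nth by measurable

lemma multilinear_weight_factor_le: "u \<in> {0..1} \<Longrightarrow> 1 + 3 * (2 * u - 1)\<^sup>2 \<le> (4 :: real)"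
  using abs_le_square_iff[of "2 * u - 1" 1] by auto

lemma multilinear_weight_U_le: "multilinear_weight (U x) \<le> 4 ^ CARD('d)"
proof -
  have "multilinear_weight (U x) \<le> (\<Prod>k\<in>(UNIV :: 'd set). 4)"
    unfolding multilinear_weight_def by (intro prod_mono conjI multilinear_weight_factor_le) (simp_all add: add_nonneg_nonneg)
  then show ?thesis by simp
qed

lemma integrable_multilinear_weight: "integrable P (\<lambda>x. multilinear_weight (U x))"
  by (rule integrable_const_bound[where B = "4 ^ CARD('d)"])
    (simp_all add: multilinear_weight_nonneg multilinear_weight_U_le borel_measurable_P[OF multilinear_weight_U_measurable])

lemma multilinear_energy_nonneg: "0 \<le> multilinear_energy"
  unfolding multilinear_energy_def by (rule integral_nonneg_AE) (simp add: multilinear_weight_nonneg)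

lemma sum_second_moments_one: "(\<Sum>m | m \<le> 1. LINT x|P. (tensor_legendre m (U x))\<^sup>2) = multilinear_energy"
  unfolding multilinear_energy_def sum_tensor_one_square[symmetric]
  by (rule Bochner_Integration.integral_sum[symmetric]) (rule integrable_tensor_U_square)

lemma copula_coeff_square_le: "(copula_coeff c m)\<^sup>2 \<le> (LINT x|P. (tensor_legendre m (U x))\<^sup>2)"
proof -
  let ?\<rho> = "copula_coeff c m"
  have "0 \<le> (LINT x|P. (tensor_legendre m (U x) - ?\<rho>)\<^sup>2)" by (rule integral_nonneg_AE) simp
  also have "\<dots> = (LINT x|P. (tensor_legendre m (U x))\<^sup>2 - 2 * ?\<rho> * tensor_legendre m (U x) + ?\<rho>\<^sup>2)"
  proof -
    have "(t - ?\<rho>)\<^sup>2 = t\<^sup>2 - 2 * ?\<rho> * t + ?\<rho>\<^sup>2" for t by (simp add: power2_diff)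
    then show ?thesis by (simp only:)
  qed
  also have "\<dots> = (LINT x|P. (tensor_legendre m (U x))\<^sup>2) - 2 * ?\<rho> * (LINT x|P. tensor_legendre m (U x)) + ?\<rho>\<^sup>2"
    using integrable_tensor_U integrable_tensor_U_square by simp
  also have "\<dots> = (LINT x|P. (tensor_legendre m (U x))\<^sup>2) - ?\<rho>\<^sup>2"
    unfolding copula_coeff_eq[symmetric] by (simp add: power2_eq_square)
  finally show ?thesis by simp
qed

text \<open>Given the observation with index \<open>i\<close>, its weight is fixed, and the exponential moments of the rank errors are bounded
  by \<open>ecdf_mgf_le\<close> with \<open>\<mu> = \<plusminus> 2 / sqrt n\<close>. So the mean of the product is at most the energy times these bounds.\<close>

lemma rank_shift_multilinear_le:
  fixes n :: nat
  assumes i: "i < n" and n: "48 * (real CARD('d))\<^sup>2 \<le> real n" "1200 \<le> n"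
  shows "(\<integral>\<^sup>+x. ennreal (rank_shift {m. m \<le> 1} (Uhat n x i) (U (x i))) \<partial>sample {..<n})
    \<le> ennreal (23 * (real CARD('d))\<^sup>2 * multilinear_energy / real n)"
proof -
  define D where "D = real CARD('d)"
  define w where "w = 2 / sqrt (real n)"
  define C where "C = 48 * exp (- 2) * D / real n"
  have C0: "0 \<le> C" by (simp add: C_def D_def)
  have sq: "1 / 0.03 \<le> sqrt (real n)"
    using n(2) by (intro real_le_rsqrt) (simp add: power2_eq_square)
  have w: "0 \<le> w" by (simp add: w_def)
  have "2 / sqrt (real n) \<le> 2 / (1 / 0.03)"
    using n(2) by (intro divide_left_mono sq) simp_all
  then have w_le: "w \<le> 0.06" by (simp add: w_def)
  have w2: "real n * w\<^sup>2 / 8 = 1 / 2" using n(2) by (simp add: w_def power_divide)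
  define \<Delta> where "\<Delta> k x = ecdf n x k (x i $ k) - marginal_cdf P k (x i $ k)" for k x
  define e where "e s k x = exp (s * (real n * \<Delta> k x))" for s k x
  have \<Delta>_meas: "\<Delta> k \<in> borel_measurable (sample {..<n})" for k
    unfolding \<Delta>_def by (rule ecdf_error_measurable[OF i])
  have e_meas: "(\<lambda>x. ennreal (e s k x)) \<in> borel_measurable (sample {..<n})" for s k
    unfolding e_def by (intro measurable_compose[OF _ measurable_ennreal] borel_measurable_exp[THEN measurable_compose[rotated]]
        borel_measurable_times borel_measurable_const \<Delta>_meas)
  have e0: "0 \<le> e s k x" for s k x by (simp add: e_def)
  define F where "F x = ennreal (multilinear_weight (U (x i)) * C) * (\<Sum>k\<in>UNIV. ennreal (e w k x) + ennreal (e (- w) k x))" for x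
  have W_meas: "(\<lambda>x. ennreal (multilinear_weight (U (x i)) * C)) \<in> borel_measurable (sample {..<n})"
    using i by (intro measurable_compose[OF _ measurable_ennreal] borel_measurable_times borel_measurable_const
        measurable_compose[OF sample_component multilinear_weight_U_measurable]) simp
  have F_meas: "F \<in> borel_measurable (sample {..<n})"
    unfolding F_def by (intro borel_measurable_times_ennreal borel_measurable_sum borel_measurable_add e_meas W_meas)
  have "(\<integral>\<^sup>+x. ennreal (rank_shift {m. m \<le> 1} (Uhat n x i) (U (x i))) \<partial>sample {..<n}) \<le> (\<integral>\<^sup>+x. F x \<partial>sample {..<n})"
  proof (rule nn_integral_mono)
    fix x
    have "rank_shift {m. m \<le> 1} (Uhat n x i) (U (x i))
        \<le> multilinear_weight (U (x i)) * (exp (\<Sum>k\<in>UNIV. 2 * sqrt 3 * \<bar>\<Delta> k x\<bar>) - 1)\<^sup>2"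
      using rank_shift_one_le[of "Uhat n x i" "U (x i)"] by (simp only: rank_shift_def U_nth Uhat_nth \<Delta>_def)
    also have "\<dots> \<le> multilinear_weight (U (x i)) * (C * (\<Sum>k\<in>UNIV. e w k x + e (- w) k x))"
      using exp_sum_deviation_le[OF n(1), of "\<lambda>k. \<Delta> k x"]
      by (intro mult_left_mono multilinear_weight_nonneg) (simp only: C_def D_def e_def w_def)
    finally have le: "rank_shift {m. m \<le> 1} (Uhat n x i) (U (x i)) \<le> (multilinear_weight (U (x i)) * C) * (\<Sum>k\<in>UNIV. e w k x + e (- w) k x)"
      by (simp only: mult.assoc)
    have "F x = ennreal ((multilinear_weight (U (x i)) * C) * (\<Sum>k\<in>UNIV. e w k x + e (- w) k x))"
      unfolding F_def by (simp only: ennreal_plus[symmetric] sum_ennreal e0 add_nonneg_nonneg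
          ennreal_mult sum_nonneg mult_nonneg_nonneg multilinear_weight_nonneg C0)
    then show "ennreal (rank_shift {m. m \<le> 1} (Uhat n x i) (U (x i))) \<le> F x"
      using ennreal_leI[OF le] by (simp only:)
  qed
  also have "\<dots> \<le> (\<integral>\<^sup>+y. ennreal (multilinear_weight (U y) * C * (2 * D * exp (w + 1 / 2))) \<partial>P)"
  proof (rule sample_conditional_le[OF F_meas i])
    fix y
    let ?S = "sample ({..<n} - {i})"
    let ?E = "\<lambda>s k z. ennreal (exp (s * (real n * (ecdf n (z(i := y)) k (y $ k) - marginal_cdf P k (y $ k)))))"
    have upd: "(\<lambda>z. z(i := y)) \<in> ?S \<rightarrow>\<^sub>M sample {..<n}"
    proof -
      have "(\<lambda>z. z(i := y)) \<in> ?S \<rightarrow>\<^sub>M sample (insert i ({..<n} - {i}))"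
        by (intro measurable_fun_upd[where J = "{..<n} - {i}"] measurable_ident_sets measurable_const) simp_all
      moreover have "insert i ({..<n} - {i}) = {..<n}" using i by auto
      ultimately show ?thesis by simp
    qed
    have E_eq: "ennreal (e s k (z(i := y))) = ?E s k z" for s k z
      by (simp only: e_def \<Delta>_def fun_upd_same)
    have E_meas: "?E s k \<in> borel_measurable ?S" for s k
      using measurable_compose[OF upd e_meas, of s k] unfolding E_eq .
    have mgf: "(\<integral>\<^sup>+z. ?E s k z \<partial>?S) \<le> ennreal (exp (w + 1 / 2))" if "\<bar>s\<bar> = w" for s k
    proof -
      have "s\<^sup>2 = w\<^sup>2" using that by (metis power2_abs)
      then show ?thesis using ecdf_mgf_le[OF i, of s y k] w2 that by simp
    qed
    have "(\<integral>\<^sup>+z. F (z(i := y)) \<partial>?S)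
        = (\<integral>\<^sup>+z. ennreal (multilinear_weight (U y) * C) * (\<Sum>k\<in>UNIV. ?E w k z + ?E (- w) k z) \<partial>?S)"
      unfolding F_def E_eq fun_upd_same ..
    also have "\<dots> = ennreal (multilinear_weight (U y) * C) * (\<integral>\<^sup>+z. (\<Sum>k\<in>UNIV. ?E w k z + ?E (- w) k z) \<partial>?S)"
      by (intro nn_integral_cmult borel_measurable_sum borel_measurable_add E_meas)
    also have "\<dots> = ennreal (multilinear_weight (U y) * C) * (\<Sum>k\<in>UNIV. (\<integral>\<^sup>+z. ?E w k z \<partial>?S) + (\<integral>\<^sup>+z. ?E (- w) k z \<partial>?S))"
      by (subst nn_integral_sum) (simp_all only: nn_integral_add E_meas borel_measurable_add)
    also have "\<dots> \<le> ennreal (multilinear_weight (U y) * C) * (\<Sum>k\<in>(UNIV :: 'd set). ennreal (exp (w + 1 / 2)) + ennreal (exp (w + 1 / 2)))"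
      using w by (intro mult_left_mono sum_mono add_mono mgf) simp_all
    also have "\<dots> = ennreal (multilinear_weight (U y) * C) * ennreal (\<Sum>k\<in>(UNIV :: 'd set). exp (w + 1 / 2) + exp (w + 1 / 2))"
      by (simp only: ennreal_plus[symmetric] sum_ennreal exp_ge_zero add_nonneg_nonneg)
    also have "\<dots> = ennreal (multilinear_weight (U y) * C * (\<Sum>k\<in>(UNIV :: 'd set). exp (w + 1 / 2) + exp (w + 1 / 2)))"
      by (intro ennreal_mult[symmetric] mult_nonneg_nonneg multilinear_weight_nonneg C0 sum_nonneg) simp
    also have "(\<Sum>k\<in>(UNIV :: 'd set). exp (w + 1 / 2) + exp (w + 1 / 2)) = 2 * D * exp (w + 1 / 2)"
      by (simp add: D_def)
    finally show "(\<integral>\<^sup>+z. F (z(i := y)) \<partial>?S) \<le> ennreal (multilinear_weight (U y) * C * (2 * D * exp (w + 1 / 2)))" .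
  qed
  also have "\<dots> = ennreal (LINT y|P. multilinear_weight (U y) * C * (2 * D * exp (w + 1 / 2)))"
  proof (rule nn_integral_eq_integral)
    show "integrable P (\<lambda>y. multilinear_weight (U y) * C * (2 * D * exp (w + 1 / 2)))"
      by (intro integrable_mult_left integrable_multilinear_weight)
    show "AE y in P. 0 \<le> multilinear_weight (U y) * C * (2 * D * exp (w + 1 / 2))"
      by (intro AE_I2 mult_nonneg_nonneg multilinear_weight_nonneg C0) (simp_all add: D_def)
  qed
  also have "(LINT y|P. multilinear_weight (U y) * C * (2 * D * exp (w + 1 / 2))) = multilinear_energy * C * (2 * D * exp (w + 1 / 2))"
    by (simp only: integral_mult_left_zero multilinear_energy_def)
  also have "\<dots> \<le> ennreal (23 * (real CARD('d))\<^sup>2 * multilinear_energy / real n)"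
  proof (rule ennreal_leI)
    have "multilinear_energy * C * (2 * D * exp (w + 1 / 2)) = 96 * (exp (- 2) * exp (w + 1 / 2)) * (D\<^sup>2 * multilinear_energy / real n)"
      by (simp add: C_def power2_eq_square)
    also have "\<dots> \<le> 23 * (D\<^sup>2 * multilinear_energy / real n)"
      by (intro mult_right_mono exp_numeral_bound w_le) (simp add: multilinear_energy_nonneg)
    finally show "multilinear_energy * C * (2 * D * exp (w + 1 / 2)) \<le> 23 * (real CARD('d))\<^sup>2 * multilinear_energy / real n"
      by (simp add: D_def)
  qed
  finally show ?thesis .
qed

lemma estimation_error_multilinear_le:
  fixes n :: nat
  assumes n: "48 * (real CARD('d))\<^sup>2 \<le> real n" "1200 \<le> n"
  shows "(\<integral>\<^sup>+x. ennreal (\<Sum>m | m \<le> 1. (coeff_est n x m - copula_coeff c m)\<^sup>2) \<partial>sample {..<n})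
    \<le> ennreal ((2 + 46 * (real CARD('d))\<^sup>2) * multilinear_energy / real n)"
proof -
  have "(\<integral>\<^sup>+x. ennreal (\<Sum>m | m \<le> 1. (coeff_est n x m - copula_coeff c m)\<^sup>2) \<partial>sample {..<n})
      \<le> ennreal (2 * multilinear_energy / real n + 2 * (23 * (real CARD('d))\<^sup>2 * multilinear_energy / real n))"
    using estimation_error_le[OF _ finite_vec_atMost _ rank_shift_multilinear_le[OF _ n]] n(2)
    unfolding sum_second_moments_one by (simp add: multilinear_energy_nonneg)
  also have "2 * multilinear_energy / real n + 2 * (23 * (real CARD('d))\<^sup>2 * multilinear_energy / real n)
      = (2 + 46 * (real CARD('d))\<^sup>2) * multilinear_energy / real n"
    by (simp add: distrib_right add_divide_distrib)
  finally show ?thesis .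
qed

text \<open>The indices of the basis functions that occur in the expansion of \<open>multilinear_weight\<close>.\<close>

definition twos_on :: "'d set \<Rightarrow> nat ^ 'd" where
  "twos_on S = (\<chi> k. if k \<in> S then 2 else 0)"

text \<open>As \<open>1 + 3 (2 u - 1)\<^sup>2 = 2 (1 + Q\<^sub>2(u) / sqrt 5)\<close>, the energy over the coordinates outside \<open>B\<close> is a combination of the
  coefficients of \<open>c\<close> with all degrees \<open>0\<close> or \<open>2\<close>; its constant term \<open>2 ^ card (- B)\<close> is the value under independence, and the
  others are small for smooth \<open>c\<close>. On the coordinates in \<open>B\<close>, where \<open>c\<close> may be rough, the factor is bounded by \<open>4\<close>.\<close>

lemma multilinear_energy_le:
  assumes X: "(\<Sum>S\<in>Pow (- B) - {{}}. (copula_coeff c (twos_on S))\<^sup>2) \<le> X"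
  shows "multilinear_energy \<le> 4 ^ card B * 2 ^ card (- B) * (1 + sqrt (X * (6 / 5) ^ CARD('d)))"
proof -
  define \<rho> where "\<rho> S = copula_coeff c (twos_on S)" for S
  define h where "h = (\<lambda>v. (1 / sqrt 5) * shifted_legendre 2 v)"
  have h: "1 + 3 * (2 * v - 1)\<^sup>2 = 2 * (h v + 1)" for v
    by (simp add: h_def shifted_legendre_def numeral_2_eq_2 field_simps power2_eq_square)
  have prod_h: "(\<Prod>k\<in>S. h (u $ k)) = (1 / sqrt 5) ^ card S * tensor_legendre (twos_on S) u" for S u
  proof -
    have "tensor_legendre (twos_on S) u = (\<Prod>k\<in>S. shifted_legendre 2 (u $ k))"
      unfolding tensor_legendre_def twos_on_def
      by (rule prod.mono_neutral_cong_right) (auto simp: shifted_legendre_def[of 0])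
    then show ?thesis by (simp add: h_def prod_dividef power_one_over)
  qed
  have point: "multilinear_weight u \<le> 4 ^ card B * 2 ^ card (- B) * (\<Sum>S\<in>Pow (- B). (1 / sqrt 5) ^ card S * tensor_legendre (twos_on S) u)"
    if u: "\<And>k. u $ k \<in> {0..1}" for u
  proof -
    have "multilinear_weight u = (\<Prod>k\<in>B. 1 + 3 * (2 * u $ k - 1)\<^sup>2) * (\<Prod>k\<in>- B. 1 + 3 * (2 * u $ k - 1)\<^sup>2)"
      unfolding multilinear_weight_def by (subst prod.union_disjoint[symmetric]) auto
    also have "\<dots> \<le> (\<Prod>k\<in>B. 4) * (\<Prod>k\<in>- B. 1 + 3 * (2 * u $ k - 1)\<^sup>2)"
      by (intro mult_right_mono prod_mono prod_nonneg conjI multilinear_weight_factor_le u) (simp_all add: add_nonneg_nonneg)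
    also have "(\<Prod>k\<in>- B. 1 + 3 * (2 * u $ k - 1)\<^sup>2) = 2 ^ card (- B) * (\<Prod>k\<in>- B. h (u $ k) + 1)"
      by (simp only: h prod.distrib prod_constant)
    also have "(\<Prod>k\<in>- B. h (u $ k) + 1) = (\<Sum>S\<in>Pow (- B). (1 / sqrt 5) ^ card S * tensor_legendre (twos_on S) u)"
      by (subst prod_add) (simp_all add: prod_h)
    finally show ?thesis by (simp add: mult.assoc)
  qed
  have "multilinear_energy \<le> (LINT x|P. 4 ^ card B * 2 ^ card (- B)
      * (\<Sum>S\<in>Pow (- B). (1 / sqrt 5) ^ card S * tensor_legendre (twos_on S) (U x)))"
    unfolding multilinear_energy_def
    by (intro integral_mono integrable_multilinear_weight integrable_mult_right Bochner_Integration.integrable_sum integrable_tensor_U point)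
      (simp add: marginal_cdf_bounds)
  also have "\<dots> = 4 ^ card B * 2 ^ card (- B) * (\<Sum>S\<in>Pow (- B). (1 / sqrt 5) ^ card S * \<rho> S)"
    by (simp add: integrable_tensor_U Bochner_Integration.integral_sum copula_coeff_eq[symmetric] \<rho>_def)
  also have "\<dots> \<le> 4 ^ card B * 2 ^ card (- B) * (1 + sqrt (X * (6 / 5) ^ CARD('d)))"
  proof (intro mult_left_mono)
    have "twos_on {} = 0" by (simp add: twos_on_def vec_eq_iff)
    then have "(\<Sum>S\<in>Pow (- B). (1 / sqrt 5) ^ card S * \<rho> S) = 1 + (\<Sum>S\<in>Pow (- B) - {{}}. (1 / sqrt 5) ^ card S * \<rho> S)"
      by (subst sum.remove[of _ "{}"]) (simp_all add: \<rho>_def copula_coeff_0)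
    moreover have "(\<Sum>S\<in>Pow (- B) - {{}}. (1 / sqrt 5) ^ card S * \<rho> S) \<le> sqrt (X * (6 / 5) ^ CARD('d))"
    proof (rule real_le_rsqrt)
      have "(\<Sum>S\<in>Pow (- B) - {{}}. (1 / sqrt 5) ^ card S * \<rho> S)\<^sup>2
          \<le> (\<Sum>S\<in>Pow (- B) - {{}}. ((1 / sqrt 5) ^ card S)\<^sup>2) * (\<Sum>S\<in>Pow (- B) - {{}}. (\<rho> S)\<^sup>2)"
        by (rule Cauchy_Schwarz_ineq_sum)
      also have "\<dots> \<le> (6 / 5) ^ CARD('d) * X"
      proof (intro mult_mono)
        have sq: "((1 / sqrt 5) ^ card S)\<^sup>2 = (\<Prod>k\<in>S. 1 / 5 :: real)" for S :: "'d set"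
          by (simp add: power_divide flip: power_mult) (simp add: power_mult mult.commute[of _ 2])
        have "(\<Sum>S\<in>Pow (- B) - {{}}. ((1 / sqrt 5) ^ card S)\<^sup>2) \<le> (\<Sum>S\<in>Pow (UNIV :: 'd set). ((1 / sqrt 5) ^ card S)\<^sup>2)"
          by (intro sum_mono2) auto
        also have "\<dots> = (\<Prod>k\<in>(UNIV :: 'd set). 1 / 5 + 1)"
          by (subst prod_add) (simp_all only: finite sq prod.neutral_const mult_1_right)
        finally show "(\<Sum>S\<in>Pow (- B) - {{}}. ((1 / sqrt 5) ^ card S)\<^sup>2) \<le> (6 / 5 :: real) ^ CARD('d)" by simp
        show "(\<Sum>S\<in>Pow (- B) - {{}}. (\<rho> S)\<^sup>2) \<le> X" using X by (simp add: \<rho>_def)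
      qed (simp_all add: sum_nonneg)
      finally show "(\<Sum>S\<in>Pow (- B) - {{}}. (1 / sqrt 5) ^ card S * \<rho> S)\<^sup>2 \<le> X * (6 / 5) ^ CARD('d)"
        by (simp only: mult.commute)
    qed
    ultimately show "(\<Sum>S\<in>Pow (- B). (1 / sqrt 5) ^ card S * \<rho> S) \<le> 1 + sqrt (X * (6 / 5) ^ CARD('d))" by simp
  qed simp
  finally show ?thesis .
qed

end

section \<open>Numerical inequalities\<close>

text \<open>Since \<open>(4/3) ^ 16 < 100\<close>, it suffices to compare \<open>(13/50) ^ 16 * 100 ^ D\<close> with \<open>(3 D) ^ (D - 1)\<close>. As long as \<open>3 D\<close> is below \<open>100\<close>, the
  comparison on a range \<open>a \<le> D \<le> e\<close> follows from the one with \<open>3 a\<close> and exponent \<open>e\<close>; four ranges cover \<open>D \<le> 33\<close>.\<close>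

lemma power_comparison:
  assumes D: "5 \<le> D"
  shows "(13 / 50 * (4 / 3) ^ D) ^ 16 \<le> (3 * real D) ^ (D - 1)"
proof -
  have "(4 / 3 :: real) ^ 16 \<le> 100" by (simp add: power_divide)
  then have "((4 / 3 :: real) ^ 16) ^ D \<le> 100 ^ D" by (rule power_mono) simp
  then have le: "(13 / 50 * (4 / 3) ^ D) ^ 16 \<le> (13 / 50 :: real) ^ 16 * 100 ^ D"
    by (simp only: power_mult_distrib power_mult[symmetric] mult.commute[of D]) simp
  have range: ?thesis if a: "a \<le> real D" "D \<le> e" "0 < a" "3 * a \<le> 100"
    and check: "(13 / 50) ^ 16 * 100 ^ e \<le> (3 * a) ^ (e - 1)" for a :: real and e
  proof -
    have "((13 / 50) ^ 16 * 100 ^ D) * (3 * a) ^ (e - D) \<le> ((13 / 50) ^ 16 * 100 ^ D) * 100 ^ (e - D)"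
      using a by (intro mult_left_mono power_mono) simp_all
    also have "\<dots> = (13 / 50) ^ 16 * 100 ^ e" using a(2) by (simp add: mult.assoc flip: power_add)
    also have "\<dots> \<le> (3 * a) ^ (D - 1) * (3 * a) ^ (e - D)"
    proof -
      have "e - 1 = (D - 1) + (e - D)" using a(2) D by simp
      then show ?thesis using check by (simp only: power_add)
    qed
    finally have "(13 / 50) ^ 16 * 100 ^ D \<le> (3 * a) ^ (D - 1)"
      by (rule mult_right_le_imp_le) (use a(3) in simp)
    also have "\<dots> \<le> (3 * real D) ^ (D - 1)" using a by (intro power_mono) simp_all
    finally show ?thesis using le by (rule order_trans[rotated])
  qed
  consider "D \<le> 9" | "10 \<le> D" "D \<le> 15" | "16 \<le> D" "D \<le> 24" | "25 \<le> D" "D \<le> 33" | "34 \<le> D" by linarith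
  then show ?thesis
  proof cases
    case 1 then show ?thesis using D by (intro range[of 5 9]) (simp_all add: power_divide)
  next
    case 2 then show ?thesis by (intro range[of 10 15]) (simp_all add: power_divide)
  next
    case 3 then show ?thesis by (intro range[of 16 24]) (simp_all add: power_divide)
  next
    case 4 then show ?thesis by (intro range[of 25 33]) (simp_all add: power_divide)
  next
    case 5
    obtain k where k: "D = Suc k" using D by (cases D) auto
    have "(13 / 50 :: real) ^ 16 * 100 ^ D = ((13 / 50) ^ 16 * 100) * 100 ^ k" by (simp only: k power_Suc mult.assoc)
    also have "\<dots> \<le> 1 * (3 * real D) ^ k"
      using 5 by (intro mult_mono power_mono) (simp_all add: power_divide)
    finally show ?thesis using le k by simp
  qed
qed

text \<open>If the generic choice of degrees fails, the power of \<open>T\<close> has not made up for \<open>(4/3) ^ D\<close>, so \<open>T\<close> is close to \<open>1\<close>. Since \<open>T powr b\<close>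
  exceeds \<open>3 D\<close> all the same, \<open>b\<close> must be large.\<close>

lemma small_spread_consequences:
  fixes T b :: real and D :: nat
  assumes D: "2 \<le> D" and T: "1 \<le> T" and t: "3 * real D < T powr b"
    and small: "T ^ (2 * D - 2) * (3 ^ D * (8 * (real D)\<^sup>2 + 2)) < 2 * 4 ^ D * (1 + (real D)\<^sup>2)"
  shows "5 \<le> D" "32 \<le> b" "T\<^sup>2 < 4 / 3" "T ^ (2 * D - 2) \<le> 13 / 50 * (4 / 3) ^ D"
proof -
  have T1: "1 \<le> T ^ k" for k using T by (rule one_le_power)
  show D5: "5 \<le> D"
  proof (rule ccontr)
    assume "\<not> 5 \<le> D"
    then have "D = 2 \<or> D = 3 \<or> D = 4" using D by presburger
    moreover have "3 ^ D * (8 * (real D)\<^sup>2 + 2) < 2 * 4 ^ D * (1 + (real D)\<^sup>2)"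
    proof -
      have "1 * (3 ^ D * (8 * (real D)\<^sup>2 + 2)) \<le> T ^ (2 * D - 2) * (3 ^ D * (8 * (real D)\<^sup>2 + 2))"
        by (rule mult_right_mono[OF T1]) simp
      then show ?thesis using small by linarith
    qed
    ultimately show False by (elim disjE) simp_all
  qed
  have "(5::real)\<^sup>2 \<le> (real D)\<^sup>2" using D5 by (intro power_mono) simp_all
  then have ratio: "2 * (1 + (real D)\<^sup>2) \<le> 13 / 50 * (8 * (real D)\<^sup>2 + 2)" by simp
  have "T ^ (2 * D - 2) * 3 ^ D * (8 * (real D)\<^sup>2 + 2) < 4 ^ D * (2 * (1 + (real D)\<^sup>2))"
    using small by (simp only: mult_ac)
  also have "\<dots> \<le> 4 ^ D * (13 / 50 * (8 * (real D)\<^sup>2 + 2))" by (intro mult_left_mono ratio) simp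
  also have "\<dots> = (4 ^ D * (13 / 50)) * (8 * (real D)\<^sup>2 + 2)" by (simp only: mult.assoc)
  finally have "T ^ (2 * D - 2) * 3 ^ D < 4 ^ D * (13 / 50)"
    by (rule mult_right_less_imp_less) simp
  then have lt: "T ^ (2 * D - 2) < 13 / 50 * (4 / 3) ^ D"
    by (simp add: power_divide pos_less_divide_eq mult_ac)
  then show le: "T ^ (2 * D - 2) \<le> 13 / 50 * (4 / 3) ^ D" by simp
  obtain k where k: "D = Suc k" using D by (cases D) auto
  have pow: "T ^ (2 * D - 2) = (T\<^sup>2) ^ k" by (simp add: k power_mult)
  have "(T\<^sup>2) ^ k < (4 / 3) ^ k"
  proof -
    have "13 / 50 * (4 / 3 :: real) ^ D = (13 / 50 * (4 / 3)) * (4 / 3) ^ k" by (simp only: k power_Suc mult.assoc)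
    also have "\<dots> \<le> 1 * (4 / 3 :: real) ^ k" by (intro mult_right_mono) simp_all
    finally show ?thesis using lt pow by simp
  qed
  then show "T\<^sup>2 < 4 / 3" by (rule power_less_imp_less_base) simp
  show "32 \<le> b"
  proof (rule ccontr)
    assume "\<not> 32 \<le> b"
    then have "T powr b \<le> T powr 32" using T by (intro powr_mono) simp_all
    then have "3 * real D < T ^ 32" using t T powr_realpow[of T 32] by simp
    then have "(3 * real D) ^ k < (T ^ 32) ^ k" using k D5 by (intro power_strict_mono) simp_all
    also have "(T ^ 32) ^ k = (T ^ (2 * D - 2)) ^ 16"
      by (simp add: pow flip: power_mult)
    also have "\<dots> \<le> (13 / 50 * (4 / 3) ^ D) ^ 16" using T le by (intro power_mono) simp_all
    also have "\<dots> \<le> (3 * real D) ^ (D - 1)" by (rule power_comparison[OF D5])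
    finally show False using k by simp
  qed
qed

lemma square_times_power_le:
  assumes "8 \<le> (D::nat)"
  shows "(real D)\<^sup>2 * (3 / 10) ^ D \<le> 64 * (3 / 10) ^ 8"
  using assms
proof (induction D rule: dec_induct)
  case (step k)
  have k: "8 \<le> real k" using step by simp
  then have "8 * real k \<le> real k * real k" by (intro mult_right_mono) simp_all
  moreover have "(x + 1)\<^sup>2 * (3 / 10) = 3 / 10 * (x * x) + 6 / 10 * x + 3 / 10" for x :: real
    by (simp add: power2_eq_square field_simps)
  ultimately have "(real k + 1)\<^sup>2 * (3 / 10) \<le> (real k)\<^sup>2"
    using k by (simp only: power2_eq_square[of "real k"])
  then have "(real k + 1)\<^sup>2 * (3 / 10) * (3 / 10) ^ k \<le> (real k)\<^sup>2 * (3 / 10) ^ k" by (rule mult_right_mono) simp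
  also have "\<dots> \<le> 64 * (3 / 10) ^ 8" by (rule step.IH)
  finally show ?case by (simp only: of_nat_Suc power_Suc mult.assoc add.commute)
qed simp

text \<open>The left-hand side is the bound for the coefficient tail after inserting \<open>T\<^sup>2 < 4/3\<close> and \<open>b \<ge> 32\<close>.\<close>

lemma tail_constant_le:
  assumes D: "5 \<le> (D::nat)"
  shows "(2 * real D + 4) * (8 * (real D)\<^sup>2 + 2) / (32 * real D) * (832 / 1350 * (24 / 5) ^ D * (4 / 3) ^ 16)
      / 2 ^ (32 * (D div 8 + 1)) \<le> 1 / 20"
proof (cases "D \<le> 7")
  case True
  then have "D = 5 \<or> D = 6 \<or> D = 7" using D by presburger
  then show ?thesis by (elim disjE) (simp_all add: power_divide)
next
  case False
  then have D8: "8 \<le> D" by simp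
  have "4 * (D + 1) \<le> 32 * (D div 8 + 1)" by presburger
  then have "(2::real) ^ (4 * (D + 1)) \<le> 2 ^ (32 * (D div 8 + 1))" by (intro power_increasing) simp_all
  moreover have "(2::real) ^ (4 * (D + 1)) = 16 * 16 ^ D"
    using power_mult[of "2::real" 4 "D + 1"] by simp
  ultimately have den: "16 * 16 ^ D \<le> (2::real) ^ (32 * (D div 8 + 1))" by (simp only:)
  have rat: "(2 * real D + 4) * (8 * (real D)\<^sup>2 + 2) / (32 * real D) \<le> (real D)\<^sup>2"
  proof -
    have r: "8 \<le> real D" using D8 by simp
    then have r2: "8 * 8 \<le> (real D)\<^sup>2" unfolding power2_eq_square by (intro mult_mono) simp_all
    have "(2 * real D + 4) * (8 * (real D)\<^sup>2 + 2) \<le> (5 / 2 * real D) * (9 * (real D)\<^sup>2)"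
      using r r2 by (intro mult_mono) simp_all
    also have "\<dots> \<le> (real D)\<^sup>2 * (32 * real D)" by (simp add: mult_ac)
    finally show ?thesis using r by (simp add: pos_divide_le_eq)
  qed
  have "(2 * real D + 4) * (8 * (real D)\<^sup>2 + 2) / (32 * real D) * (832 / 1350 * (24 / 5) ^ D * (4 / 3) ^ 16)
      / 2 ^ (32 * (D div 8 + 1)) \<le> (real D)\<^sup>2 * (832 / 1350 * (24 / 5) ^ D * (4 / 3) ^ 16) / (16 * 16 ^ D)"
    by (intro frac_le mult_right_mono rat den mult_nonneg_nonneg) simp_all
  also have "\<dots> = (832 / 1350 * (4 / 3) ^ 16 / 16) * ((real D)\<^sup>2 * ((24 / 5) ^ D / 16 ^ D))" by simp
  also have "(24 / 5) ^ D / 16 ^ D = (3 / 10 :: real) ^ D" by (simp flip: power_divide)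
  also have "(832 / 1350 * (4 / 3) ^ 16 / 16) * ((real D)\<^sup>2 * (3 / 10) ^ D)
      \<le> (832 / 1350 * (4 / 3) ^ 16 / 16) * (64 * (3 / 10) ^ 8)"
    by (intro mult_left_mono square_times_power_le D8) simp
  also have "\<dots> \<le> 1 / 20" by (simp add: power_divide)
  finally show ?thesis .
qed

text \<open>The case \<open>D = 5\<close> is the tight one: \<open>6 * 49/40 = 7.35\<close> against \<open>(3/2) ^ 5 = 7.59\<close>.\<close>

lemma three_power_ge:
  assumes "5 \<le> (D::nat)"
  shows "6 * (2 ^ (D div 8) * 2 ^ D * (49 / 40)) \<le> (3::real) ^ D"
proof -
  define q where "q = D div 8"
  have "147 / 20 * 2 ^ q \<le> (3 / 2 :: real) ^ D"
  proof (cases "q = 0")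
    case True
    have "(3 / 2 :: real) ^ 5 \<le> (3 / 2) ^ D" using assms by (intro power_increasing) simp_all
    then show ?thesis using True by (simp add: power_divide)
  next
    case False
    have "8 * q \<le> D" by (simp add: q_def)
    have "147 / 20 \<le> (12 :: real) ^ q"
      using power_increasing[of 1 q "12::real"] False by simp
    then have "147 / 20 * 2 ^ q \<le> (12 :: real) ^ q * 2 ^ q" by (intro mult_right_mono) simp_all
    also have "\<dots> = 24 ^ q" by (simp flip: power_mult_distrib)
    also have "\<dots> \<le> ((3 / 2) ^ 8) ^ q" by (intro power_mono) (simp_all add: power_divide)
    also have "\<dots> \<le> (3 / 2) ^ D" unfolding power_mult[symmetric] using \<open>8 * q \<le> D\<close> by (intro power_increasing) simp_all
    finally show ?thesis .
  qed
  then have "147 / 20 * 2 ^ q * 2 ^ D \<le> (3 / 2 :: real) ^ D * 2 ^ D" by (intro mult_right_mono) simp_all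
  then show ?thesis by (simp add: q_def power_divide mult_ac)
qed

text \<open>The assumption on \<open>L\<close> is the equation defining \<open>T\<close>, with \<open>n\<close> replaced by \<open>1\<close>. Although \<open>L\<close> may be of order \<open>3 ^ D\<close>, the weight
  \<open>2 powr (k b)\<close> with \<open>k = D div 8 + 1\<close> and \<open>b \<ge> 32\<close> dominates it.\<close>

lemma coefficient_tail_le:
  fixes T b L :: real and D :: nat
  assumes D: "5 \<le> D" and b: "32 \<le> b" and T: "1 \<le> T" "T\<^sup>2 < 4 / 3"
    and small: "T ^ (2 * D - 2) \<le> 13 / 50 * (4 / 3) ^ D"
    and L: "L \<le> (2 * real D + 4) * (3 ^ D * (8 * (real D)\<^sup>2 + 2)) * (T ^ (2 * D + 4) * T powr b) / (real D * b)"
  shows "L * (6 / 5) ^ D / 2 powr (real (D div 8 + 1) * b) \<le> 1 / 20"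
proof -
  define \<kappa> where "\<kappa> = D div 8 + 1"
  have "T ^ (2 * D + 4) = T ^ (2 * D - 2) * (T\<^sup>2) ^ 3"
  proof -
    have "2 * D + 4 = (2 * D - 2) + 2 * 3" using D by simp
    then show ?thesis by (simp only: power_add power_mult)
  qed
  also have "\<dots> \<le> (13 / 50 * (4 / 3) ^ D) * (4 / 3) ^ 3"
    using T by (intro mult_mono small power_mono) simp_all
  finally have T1: "T ^ (2 * D + 4) \<le> 832 / 1350 * (4 / 3) ^ D" by (simp add: power_divide)
  have T32: "T ^ 32 \<le> (4 / 3) ^ 16"
  proof -
    have "(T\<^sup>2) ^ 16 \<le> (4 / 3) ^ 16" using T by (intro power_mono) simp_all
    then show ?thesis by (simp flip: power_mult)
  qed
  have T2: "T powr b / 2 powr (real \<kappa> * b) \<le> (4 / 3) ^ 16 / 2 ^ (32 * \<kappa>)"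
  proof -
    have "T \<le> 2"
    proof (rule power2_le_imp_le)
      show "T\<^sup>2 \<le> 2\<^sup>2" using T(2) by simp
    qed simp
    also have "(2::real) \<le> 2 ^ \<kappa>" using power_increasing[of 1 \<kappa> "2::real"] by (simp add: \<kappa>_def)
    finally have "T \<le> 2 ^ \<kappa>" .
    have "T powr b / 2 powr (real \<kappa> * b) = (T / 2 ^ \<kappa>) powr b"
      using T by (simp add: powr_divide powr_powr[symmetric] powr_realpow)
    also have "\<dots> \<le> (T / 2 ^ \<kappa>) powr 32"
      using T b \<open>T \<le> 2 ^ \<kappa>\<close> by (intro powr_mono') simp_all
    also have "\<dots> = T ^ 32 / 2 ^ (32 * \<kappa>)"
      using T powr_realpow[of "T / 2 ^ \<kappa>" 32] by (simp add: power_divide power_mult mult.commute[of 32])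
    also have "\<dots> \<le> (4 / 3) ^ 16 / 2 ^ (32 * \<kappa>)" by (intro divide_right_mono T32) simp
    finally show ?thesis .
  qed
  define A where "A = (2 * real D + 4) * (8 * (real D)\<^sup>2 + 2)"
  have A0: "0 \<le> A" by (simp add: A_def)
  have "L * (6 / 5) ^ D / 2 powr (real \<kappa> * b)
      \<le> ((2 * real D + 4) * (3 ^ D * (8 * (real D)\<^sup>2 + 2)) * (T ^ (2 * D + 4) * T powr b) / (real D * b)) * (6 / 5) ^ D / 2 powr (real \<kappa> * b)"
    by (intro divide_right_mono mult_right_mono L) simp_all
  also have "\<dots> = A / (real D * b) * (3 ^ D * (6 / 5) ^ D * (T ^ (2 * D + 4) * (T powr b / 2 powr (real \<kappa> * b))))"
    by (simp add: A_def)
  also have "\<dots> \<le> A / (real D * 32) * (3 ^ D * (6 / 5) ^ D * ((832 / 1350 * (4 / 3) ^ D) * ((4 / 3) ^ 16 / 2 ^ (32 * \<kappa>))))"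
    using b D A0 T by (intro mult_mono divide_left_mono T1 T2) simp_all
  also have "\<dots> = A / (32 * real D) * (832 / 1350 * (3 ^ D * (6 / 5) ^ D * (4 / 3) ^ D) * (4 / 3) ^ 16) / 2 ^ (32 * \<kappa>)"
    by simp
  also have "(3::real) ^ D * (6 / 5) ^ D * (4 / 3) ^ D = (24 / 5) ^ D"
    by (simp flip: power_mult_distrib)
  also have "A / (32 * real D) * (832 / 1350 * (24 / 5) ^ D * (4 / 3) ^ 16) / 2 ^ (32 * \<kappa>) \<le> 1 / 20"
    unfolding A_def \<kappa>_def by (rule tail_constant_le[OF D])
  finally show ?thesis unfolding \<kappa>_def .
qed

section \<open>Smoothness classes and the minimax bound\<close>

definition sobolev_weight :: "real ^ 'd \<Rightarrow> nat ^ 'd \<Rightarrow> real" where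
  "sobolev_weight \<beta> m = 1 + (\<Sum>i\<in>UNIV. real (m $ i) powr (\<beta> $ i))"

lemma sobolev_weight_ge_coord: "1 + real (m $ i) powr (\<beta> $ i) \<le> sobolev_weight \<beta> m"
proof -
  have "real (m $ i) powr (\<beta> $ i) \<le> (\<Sum>i\<in>UNIV. real (m $ i) powr (\<beta> $ i))"
    by (rule member_le_sum) simp_all
  then show ?thesis by (simp add: sobolev_weight_def)
qed

text \<open>A nonzero natural number is at least \<open>1\<close>, and so are its positive powers.\<close>

lemma sobolev_weight_ge_support:
  assumes "\<And>i. 0 < \<beta> $ i"
  shows "1 + real (card {i. m $ i \<noteq> 0}) \<le> sobolev_weight \<beta> m"
proof -
  have "real (card {i. m $ i \<noteq> 0}) = (\<Sum>i | m $ i \<noteq> 0. 1)" by simp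
  also have "\<dots> \<le> (\<Sum>i | m $ i \<noteq> 0. real (m $ i) powr (\<beta> $ i))"
  proof (rule sum_mono)
    fix i assume "i \<in> {i. m $ i \<noteq> 0}"
    then show "1 \<le> real (m $ i) powr (\<beta> $ i)"
      using assms[of i] by (intro ge_one_powr_ge_zero) simp_all
  qed
  also have "\<dots> \<le> (\<Sum>i\<in>UNIV. real (m $ i) powr (\<beta> $ i))" by (rule sum_mono2) simp_all
  finally show ?thesis by (simp add: sobolev_weight_def)
qed

lemma copula_class_sum_le:
  assumes "c \<in> copula_class \<beta> L" "finite A"
  shows "(\<Sum>m\<in>A. (copula_coeff c m)\<^sup>2 * sobolev_weight \<beta> m) \<le> L"
proof -
  let ?f = "\<lambda>m. (copula_coeff c m)\<^sup>2 * sobolev_weight \<beta> m"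
  have w0: "0 \<le> sobolev_weight \<beta> m" for m by (simp add: sobolev_weight_def sum_nonneg add_nonneg_nonneg)
  have "?f summable_on UNIV" "infsum ?f UNIV < L"
    using assms(1) by (simp_all add: copula_class_def sobolev_weight_def)
  moreover from this(1) have "sum ?f A \<le> infsum ?f UNIV"
    using assms(2) w0 by (intro finite_sum_le_infsum) simp_all
  ultimately show ?thesis by linarith
qed

text \<open>Few coordinates can have smoothness much below average, because the reciprocals add up to \<open>1 / b\<close>.\<close>

lemma card_small_smoothness:
  fixes \<beta> :: "real ^ 'd"
  assumes \<beta>: "\<And>i. 0 < \<beta> $ i" and b: "inverse b = (\<Sum>i\<in>UNIV. 1 / \<beta> $ i)" "0 < b"
  shows "card {i. \<beta> $ i < (real k + 1) * b} \<le> k"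
proof (rule ccontr)
  let ?B = "{i. \<beta> $ i < (real k + 1) * b}"
  assume "\<not> card ?B \<le> k"
  then have k: "real k + 1 \<le> real (card ?B)" by simp
  have ne: "?B \<noteq> {}"
  proof
    assume "?B = {}"
    then have "card ?B = 0" by (simp only: card.empty)
    then show False using k by simp
  qed
  have "(real k + 1) * (1 / ((real k + 1) * b)) \<le> real (card ?B) * (1 / ((real k + 1) * b))"
    using k b(2) by (intro mult_right_mono) simp_all
  also have "\<dots> = (\<Sum>i\<in>?B. 1 / ((real k + 1) * b))" by simp
  also have "\<dots> < (\<Sum>i\<in>?B. 1 / \<beta> $ i)"
    using ne \<beta> b(2) by (intro sum_strict_mono divide_strict_left_mono mult_pos_pos) auto
  also have "\<dots> \<le> (\<Sum>i\<in>UNIV. 1 / \<beta> $ i)"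
    using \<beta> by (intro sum_mono2) (auto intro: less_imp_le)
  finally show False using b by (simp add: inverse_eq_divide)
qed

locale copula_class_law = copula_law P c for P :: "(real ^ 'd) measure" and c +
  fixes \<beta> :: "real ^ 'd" and L :: real
  assumes in_class: "c \<in> copula_class \<beta> L" and \<beta>_pos: "\<And>i. 0 < \<beta> $ i"
begin

lemma integrable_square: "integrable unit_cube (\<lambda>u. (c u)\<^sup>2)"
  using in_class by (simp add: copula_class_def)

lemma bias_le:
  assumes W: "0 < W" and w: "\<And>m. \<not> m \<le> N \<Longrightarrow> copula_coeff c m \<noteq> 0 \<Longrightarrow> W \<le> sobolev_weight \<beta> m"
  shows "bias N \<le> L / W"
  unfolding bias_def
proof (rule projection_bias_le[OF c_measurable integrable_square _ copula_class_sum_le[OF in_class] finite_vec_atMost W])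
  show "0 \<le> sobolev_weight \<beta> m" for m by (simp add: sobolev_weight_def sum_nonneg add_nonneg_nonneg)
  show "W \<le> sobolev_weight \<beta> m" if "m \<notin> {m. m \<le> N}" "copula_coeff c m \<noteq> 0" for m
    using w[of m] that by simp
qed

lemma bias_le_coord:
  assumes t: "0 < t" and N: "\<And>m. \<not> m \<le> N \<Longrightarrow> \<exists>i. t \<le> real (m $ i) powr (\<beta> $ i)"
  shows "bias N \<le> L / t"
proof (rule bias_le[OF t])
  fix m :: "nat ^ 'd" assume "\<not> m \<le> N"
  then obtain i where "t \<le> real (m $ i) powr (\<beta> $ i)" using N by blast
  then show "t \<le> sobolev_weight \<beta> m" using sobolev_weight_ge_coord[of m i \<beta>] by linarith
qed

text \<open>An omitted index with nonzero coefficient has at least two nonzero entries, hence weight at least \<open>3\<close>.\<close>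

lemma bias_axis_le: "bias (axis k 1) \<le> L / 3"
proof (rule bias_le)
  fix m :: "nat ^ 'd" assume m: "\<not> m \<le> axis k 1" "copula_coeff c m \<noteq> 0"
  have "card {i. m $ i \<noteq> 0} \<noteq> 0"
  proof
    assume "card {i. m $ i \<noteq> 0} = 0"
    then have "m = 0" by (auto simp: vec_eq_iff)
    then show False using m(1) by (simp add: less_eq_vec_def)
  qed
  moreover have "card {i. m $ i \<noteq> 0} \<noteq> 1"
  proof
    assume "card {i. m $ i \<noteq> 0} = 1"
    moreover have "{i. m $ i = 0} = UNIV - {i. m $ i \<noteq> 0}" by auto
    ultimately have "card {i. m $ i = 0} = CARD('d) - 1" by (simp add: card_Diff_subset)
    then show False using copula_coeff_single m(2) by blast
  qed
  ultimately have "2 \<le> real (card {i. m $ i \<noteq> 0})" by linarith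
  then show "3 \<le> sobolev_weight \<beta> m" using sobolev_weight_ge_support[OF \<beta>_pos, of m] by linarith
qed simp

text \<open>Below a coordinate vector lie only indices whose coefficients the estimator fixes at their true values.\<close>

lemma estimation_error_axis:
  "(\<integral>\<^sup>+x. ennreal (\<Sum>m | m \<le> axis k 1. (coeff_est n x m - copula_coeff c m)\<^sup>2) \<partial>sample {..<n}) \<le> ennreal 0"
proof -
  have "(coeff_est n x m - copula_coeff c m)\<^sup>2 = 0" if m: "m \<le> axis k 1" for x m
  proof (cases "m = 0")
    case True then show ?thesis by (simp add: coeff_est_def copula_coeff_0)
  next
    case False
    have le: "m $ i \<le> (if i = k then 1 else 0)" for i
    proof -
      have "m $ i \<le> axis k 1 $ i" using m by (simp only: less_eq_vec_def)
      then show ?thesis by (simp add: axis_def split: if_splits)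
    qed
    then have zero: "m $ i = 0" if "i \<noteq> k" for i using that le[of i] by simp
    then have "m $ k \<noteq> 0" using False by (metis vec_eq_iff zero_index)
    with zero have "{j. m $ j = 0} = UNIV - {k}" by auto
    then have "card {j. m $ j = 0} = CARD('d) - 1" by (simp add: card_Diff_subset)
    then show ?thesis using False by (simp add: coeff_est_def copula_coeff_single)
  qed
  then show ?thesis by simp
qed

lemma risk_axis_le: "risk n P c (axis k 1) \<le> ennreal (L / 3)"
  using risk_le[OF integrable_square estimation_error_axis _ bias_axis_le, of n k] by simp

text \<open>The constant estimator again, but now the coefficients with \<open>m \<le> 1\<close> are bounded by the energy instead of the
  class.\<close>

lemma risk_axis_le_energy:
  assumes "bias 1 \<le> B"
  shows "risk n P c (axis k 1) \<le> ennreal (multilinear_energy + B)"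
proof -
  have sub: "{m. m \<le> axis k (1::nat)} \<subseteq> {m :: nat ^ 'd. m \<le> 1}"
  proof
    fix m :: "nat ^ 'd" assume "m \<in> {m. m \<le> axis k 1}"
    then have "m $ i \<le> axis k 1 $ i" for i by (simp add: less_eq_vec_def)
    also have "axis k (1::nat) $ i \<le> 1" for i by (simp add: axis_def)
    finally show "m \<in> {m. m \<le> 1}" by (simp add: less_eq_vec_def)
  qed
  have "(\<Sum>m | m \<le> 1. (copula_coeff c m)\<^sup>2) \<le> (\<Sum>m | m \<le> 1. LINT x|P. (tensor_legendre m (U x))\<^sup>2)"
    by (intro sum_mono copula_coeff_square_le)
  then have "(\<Sum>m | m \<le> 1. (copula_coeff c m)\<^sup>2) \<le> multilinear_energy" by (simp only: sum_second_moments_one)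
  moreover have "0 \<le> (\<Sum>m | m \<le> axis k 1. (copula_coeff c m)\<^sup>2)" by (simp add: sum_nonneg)
  ultimately have "bias (axis k 1) \<le> multilinear_energy + B" using assms unfolding bias_def by linarith
  from risk_le[OF integrable_square estimation_error_axis _ this, of n] show ?thesis by simp
qed

text \<open>Take for \<open>B\<close> the coordinates with smoothness below \<open>(k + 1) b\<close>, where \<open>k = d div 8\<close>. There are at most \<open>k\<close> of them, which costs a
  factor \<open>2 ^ k\<close>; an index with a degree \<open>2\<close> outside \<open>B\<close> has weight at least \<open>2 powr ((k + 1) b)\<close>, which makes the other terms small.\<close>

lemma multilinear_energy_class_le:
  assumes b: "inverse b = (\<Sum>i\<in>UNIV. 1 / \<beta> $ i)" "0 < b"
    and D: "5 \<le> CARD('d)"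
    and tail: "L * (6 / 5) ^ CARD('d) / 2 powr (real (CARD('d) div 8 + 1) * b) \<le> 1 / 20"
  shows "6 * multilinear_energy \<le> 3 ^ CARD('d)"
proof -
  define q where "q = CARD('d) div 8"
  define W where "W = 2 powr (real (q + 1) * b)"
  define B where "B = {i. \<beta> $ i < (real q + 1) * b}"
  have W: "0 < W" by (simp add: W_def)
  have cardB: "card B \<le> q" unfolding B_def by (rule card_small_smoothness[OF \<beta>_pos b])
  have inj: "inj_on twos_on (Pow (- B) - {{}})"
  proof (rule inj_onI, rule set_eqI)
    fix S T :: "'d set" and k assume "twos_on S = twos_on T"
    then have "twos_on S $ k = twos_on T $ k" by (simp only:)
    then show "k \<in> S \<longleftrightarrow> k \<in> T" unfolding twos_on_def vec_lambda_beta by (simp split: if_splits)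
  qed
  have "(\<Sum>S\<in>Pow (- B) - {{}}. (copula_coeff c (twos_on S))\<^sup>2) * W
      = (\<Sum>m\<in>twos_on ` (Pow (- B) - {{}}). (copula_coeff c m)\<^sup>2 * W)"
    by (simp add: sum_distrib_right sum.reindex[OF inj])
  also have "\<dots> \<le> (\<Sum>m\<in>twos_on ` (Pow (- B) - {{}}). (copula_coeff c m)\<^sup>2 * sobolev_weight \<beta> m)"
  proof (intro sum_mono mult_left_mono)
    fix m assume "m \<in> twos_on ` (Pow (- B) - {{}})"
    then obtain S i where "m = twos_on S" "i \<in> S" "i \<notin> B" by blast
    then have mi: "m $ i = 2" and \<beta>i: "(real q + 1) * b \<le> \<beta> $ i" by (simp_all add: twos_on_def B_def)
    have "W \<le> 2 powr (\<beta> $ i)" unfolding W_def using \<beta>i by (intro powr_mono) (simp_all add: add.commute)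
    also have "\<dots> \<le> sobolev_weight \<beta> m" using sobolev_weight_ge_coord[of m i \<beta>] mi by simp
    finally show "W \<le> sobolev_weight \<beta> m" .
  qed simp
  also have "\<dots> \<le> L" by (rule copula_class_sum_le[OF in_class]) simp
  finally have "(\<Sum>S\<in>Pow (- B) - {{}}. (copula_coeff c (twos_on S))\<^sup>2) \<le> L / W"
    using W by (simp add: pos_le_divide_eq)
  from multilinear_energy_le[OF this]
  have "multilinear_energy \<le> 4 ^ card B * 2 ^ card (- B) * (1 + sqrt (L / W * (6 / 5) ^ CARD('d)))" .
  also have "(4::real) ^ card B * 2 ^ card (- B) = 2 ^ card B * 2 ^ CARD('d)"
  proof -
    have "CARD('d) = card B + card (- B)" by (simp add: card_Un_disjoint[symmetric])
    then have "(2::real) ^ CARD('d) = 2 ^ card B * 2 ^ card (- B)" by (simp only: power_add)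
    moreover have "(4::real) ^ card B = 2 ^ card B * 2 ^ card B" by (simp flip: power_mult_distrib)
    ultimately show ?thesis by simp
  qed
  also have "2 ^ card B * 2 ^ CARD('d) * (1 + sqrt (L / W * (6 / 5) ^ CARD('d))) \<le> 2 ^ q * 2 ^ CARD('d) * (49 / 40)"
  proof (intro mult_mono mult_right_mono)
    show "(2::real) ^ card B \<le> 2 ^ q" using cardB by (intro power_increasing) simp_all
    have "L / W * (6 / 5) ^ CARD('d) \<le> 1 / 20" using tail by (simp only: W_def q_def times_divide_eq_left)
    also have "\<dots> \<le> (9 / 40 :: real)\<^sup>2" by (simp add: power2_eq_square)
    finally have "sqrt (L / W * (6 / 5) ^ CARD('d)) \<le> 9 / 40" by (intro real_le_lsqrt) simp_all
    then show "1 + sqrt (L / W * (6 / 5) ^ CARD('d)) \<le> 49 / 40" by simp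
    have "0 \<le> L" using copula_class_sum_le[OF in_class, of "{}"] by simp
    then show "0 \<le> 1 + sqrt (L / W * (6 / 5) ^ CARD('d))" using W by simp
  qed simp_all
  finally have "6 * multilinear_energy \<le> 6 * (2 ^ q * 2 ^ CARD('d) * (49 / 40))" by simp
  also have "\<dots> \<le> 3 ^ CARD('d)" unfolding q_def by (rule three_power_ge[OF D])
  finally show ?thesis .
qed

end

theorem proposition9:
  fixes \<beta> :: "real ^ 'd" and n :: nat and L b d \<eta> K v :: real
  assumes "CARD('d) \<ge> 2" and "d = real CARD('d)"
    and "\<And>i. 0 < \<beta> $ i" and "0 < L" and "1 \<le> n"
    and "inverse b = (\<Sum>i\<in>UNIV. 1 / \<beta> $ i)"
    and "\<eta> = 8 * d\<^sup>2 * 3 ^ CARD('d) + 2 * 3 ^ CARD('d)"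
    and "K = L * d * (2 * d + b + 4) / (2 * d + 4)
               * (L * b * d / (\<eta> * (2 * d + 4))) powr (- b / (2 * d + b + 4))"
    and "v = real n powr (- b / (2 * d + b + 4))"
  shows "projection_minimax_risk n (copula_class \<beta> L) \<le> ennreal (K * v)"
proof -
  define D where "D = CARD('d)"
  have D: "2 \<le> D" and d: "d = real D" using assms(1,2) by (simp_all add: D_def)
  have d2: "2 \<le> d" using D d by simp
  note \<beta> = assms(3) and L = assms(4) and n = assms(5) and b_eq = assms(6)
  have "0 < inverse b" unfolding b_eq using \<beta> by (intro sum_pos) simp_all
  then have b: "0 < b" by simp
  have b_le: "b \<le> \<beta> $ i" for i
  proof -
    have "1 / \<beta> $ i \<le> (\<Sum>i\<in>UNIV. 1 / \<beta> $ i)" using \<beta> by (intro member_le_sum) (simp_all add: less_imp_le)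
    then have "1 / \<beta> $ i \<le> 1 / b" using b_eq by (simp add: inverse_eq_divide)
    then show ?thesis using \<beta>[of i] b by (simp add: field_simps)
  qed
  have \<eta>: "\<eta> = 3 ^ D * (8 * d\<^sup>2 + 2)" using assms(7) by (simp add: D_def algebra_simps)
  have \<eta>_pos: "0 < \<eta>" unfolding \<eta> by (intro mult_pos_pos add_nonneg_pos) simp_all
  define s where "s = 2 * d + b + 4"
  have s: "0 < s" using d2 b by (simp add: s_def)
  define A where "A = L * b * d / (\<eta> * (2 * d + 4))"
  have A: "0 < A" using L b d2 \<eta>_pos by (simp add: A_def)
  \<comment> \<open>the minimiser of \<open>L d / t + \<eta> T ^ (2 d + 4) / n\<close>, with \<open>t = T powr b\<close>\<close>
  define T where "T = (A * real n) powr (1 / s)"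
  define t where "t = T powr b"
  have An: "0 < A * real n" using A n by simp
  have T_pos: "0 < T" using A n by (simp add: T_def)
  have t_pos: "0 < t" using T_pos by (simp add: t_def)
  have Tt: "T ^ (2 * D + 4) * t = A * real n"
  proof -
    have "T ^ (2 * D + 4) = T powr (2 * d + 4)" using T_pos by (simp add: d flip: powr_realpow)
    then have "T ^ (2 * D + 4) * t = T powr s" by (simp add: t_def s_def add_ac flip: powr_add)
    then show ?thesis using s An by (simp add: T_def powr_powr)
  qed
  have Kv: "K * v = L * d / t + \<eta> * T ^ (2 * D + 4) / real n"
  proof -
    have "t = (A * real n) powr (b / s)" by (simp add: t_def T_def powr_powr)
    then have "1 / t = A powr (- b / s) * real n powr (- b / s)"
      using A n by (simp add: powr_minus_divide powr_mult)
    then have "K * v = L * d * s / (2 * d + 4) * (1 / t)"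
      by (simp add: assms(8,9) A_def s_def)
    also have "\<dots> = L * d / t + L * b * d / (2 * d + 4) / t"
    proof -
      have "L * d * (k + b) / k = L * d + L * b * d / k" if "k \<noteq> 0" for k
        using that by (simp add: field_simps)
      from this[of "2 * d + 4"] have "L * d * s / (2 * d + 4) = L * d + L * b * d / (2 * d + 4)"
        using d2 by (simp add: s_def add_ac)
      then show ?thesis by (simp add: add_divide_distrib)
    qed
    also have "L * b * d / (2 * d + 4) / t = \<eta> * A / t" using \<eta>_pos d2 by (simp add: A_def)
    also have "\<dots> = \<eta> * T ^ (2 * D + 4) / real n"
    proof -
      have "T ^ (2 * D + 4) = A * real n / t" using Tt t_pos by (simp add: eq_divide_eq)
      then show ?thesis using n by simp
    qed
    finally show ?thesis .
  qed
  have T_ge_1: "1 \<le> T" if "1 < t"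
  proof (rule ccontr)
    assume "\<not> 1 \<le> T"
    then have "T powr b \<le> 1 powr b" using T_pos b by (intro powr_mono2) simp_all
    then show False using that by (simp add: t_def)
  qed
  have main: "\<exists>N. N \<noteq> 0 \<and> (\<forall>c\<in>copula_class \<beta> L. \<forall>P. has_copula_density P c \<longrightarrow> risk n P c N \<le> ennreal (K * v))"
  proof -
    have law: "copula_class_law P c \<beta> L" if "c \<in> copula_class \<beta> L" "has_copula_density P c" for P c
    proof -
      have "prob_space P" using that(2) by (simp add: has_copula_density_def)
      then show ?thesis
        using that \<beta> by (simp add: copula_class_law_def copula_law_def copula_law_axioms_def copula_class_law_axioms_def)
    qed
    have axis_ne: "axis k (1::nat) \<noteq> (0 :: nat ^ 'd)" for k by (simp add: axis_eq_0_iff)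
    have var_pos: "0 \<le> \<eta> * T ^ (2 * D + 4) / real n" using \<eta>_pos T_pos by simp
    \<comment> \<open>the second inequality in \<open>generic\<close> is what the generic degrees need; see \<open>V\<close> there\<close>
    consider (flat) "t \<le> 3 * d"
      | (generic) "3 * d < t" "2 * 4 ^ D * (1 + d\<^sup>2) \<le> T ^ (2 * D - 2) * (3 ^ D * (8 * d\<^sup>2 + 2))"
      | (thin) "3 * d < t" "T ^ (2 * D - 2) * (3 ^ D * (8 * d\<^sup>2 + 2)) < 2 * 4 ^ D * (1 + d\<^sup>2)"
      by linarith
    then show ?thesis
    proof cases
      \<comment> \<open>any coordinate vector will do, hence \<open>axis undefined 1\<close>\<close>
      case flat
      have "risk n P c (axis undefined 1) \<le> ennreal (K * v)"
        if "c \<in> copula_class \<beta> L" "has_copula_density P c" for P c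
      proof -
        interpret copula_class_law P c \<beta> L using law that by blast
        have "L / 3 \<le> L * d / t" using flat L t_pos by (simp add: field_simps)
        then have "L / 3 \<le> K * v" using var_pos Kv by linarith
        then show ?thesis using risk_axis_le order_trans ennreal_leI by blast
      qed
      then show ?thesis using axis_ne by blast
    next
      case generic
      have t1: "1 < t" using generic(1) d2 by linarith
      note T1 = T_ge_1[OF t1]
      \<comment> \<open>every omitted index has an entry with \<open>m\<^sub>i powr \<beta>\<^sub>i \<ge> t\<close>\<close>
      define N :: "nat ^ 'd" where "N = (\<chi> i. nat \<lfloor>t powr (1 / \<beta> $ i)\<rfloor>)"
      have tb: "1 \<le> t powr (1 / \<beta> $ i)" for i using t1 \<beta>[of i] by (intro ge_one_powr_ge_zero) simp_all
      have N1: "1 \<le> real (N $ i)" for i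
      proof -
        have "1 \<le> \<lfloor>t powr (1 / \<beta> $ i)\<rfloor>" using tb[of i] by (simp add: le_floor_iff)
        then show ?thesis by (simp add: N_def)
      qed
      have N_le: "real (N $ i) \<le> t powr (1 / \<beta> $ i)" for i
        using tb[of i] by (simp add: N_def)
      have prodN: "(\<Prod>i\<in>UNIV. real (N $ i)) \<le> T"
      proof -
        have "(\<Prod>i\<in>UNIV. real (N $ i)) \<le> (\<Prod>i\<in>UNIV. t powr (1 / \<beta> $ i))"
          by (intro prod_mono) (simp add: N_le)
        also have "\<dots> = t powr (\<Sum>i\<in>UNIV. 1 / \<beta> $ i)" using t_pos by (simp add: powr_sum)
        also have "\<dots> = T" using b T_pos by (simp add: b_eq[symmetric] t_def powr_powr)
        finally show ?thesis .
      qed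
      have N_le_T: "real (N $ j) \<le> T" for j
      proof -
        have "real (N $ j) * 1 \<le> real (N $ j) * (\<Prod>i\<in>UNIV - {j}. real (N $ i))"
          by (intro mult_left_mono prod_ge_1 N1) simp
        also have "\<dots> = (\<Prod>i\<in>UNIV. real (N $ i))" by (simp add: prod.remove[of _ j])
        finally show ?thesis using prodN by simp
      qed
      define V where "V = 2 / real n * (\<Prod>j\<in>UNIV. (real (N $ j) + 1)\<^sup>2) * (1 + real CARD('d) * (\<Sum>j\<in>UNIV. real (N $ j) ^ 4))"
      have V: "V \<le> \<eta> * T ^ (2 * D + 4) / real n"
      proof -
        have "(\<Prod>j\<in>UNIV. (real (N $ j) + 1)\<^sup>2) \<le> (\<Prod>j\<in>UNIV. 4 * (real (N $ j))\<^sup>2)"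
        proof (intro prod_mono conjI)
          fix j
          have "(real (N $ j) + 1)\<^sup>2 \<le> (2 * real (N $ j))\<^sup>2" using N1[of j] by (intro power_mono) simp_all
          then show "(real (N $ j) + 1)\<^sup>2 \<le> 4 * (real (N $ j))\<^sup>2" by (simp add: power_mult_distrib)
        qed simp
        also have "\<dots> = 4 ^ D * (\<Prod>j\<in>UNIV. real (N $ j))\<^sup>2" by (simp add: prod.distrib D_def prod_power_distrib)
        also have "\<dots> \<le> 4 ^ D * T\<^sup>2" by (intro mult_left_mono power_mono prodN prod_nonneg) simp_all
        finally have 1: "(\<Prod>j\<in>UNIV. (real (N $ j) + 1)\<^sup>2) \<le> 4 ^ D * T\<^sup>2" .
        have T4: "1 \<le> T ^ 4" using T1 by (rule one_le_power)
        have "real CARD('d) * (\<Sum>j\<in>UNIV. real (N $ j) ^ 4) \<le> real CARD('d) * (\<Sum>j\<in>(UNIV :: 'd set). T ^ 4)"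
          by (intro mult_left_mono sum_mono power_mono N_le_T) simp_all
        also have "\<dots> = d\<^sup>2 * T ^ 4" by (simp add: d D_def power2_eq_square)
        finally have "1 + real CARD('d) * (\<Sum>j\<in>UNIV. real (N $ j) ^ 4) \<le> (1 + d\<^sup>2) * T ^ 4"
          using T4 by (simp add: distrib_right)
        then have "V \<le> 2 / real n * (4 ^ D * T\<^sup>2) * ((1 + d\<^sup>2) * T ^ 4)"
          unfolding V_def by (intro mult_mono 1 mult_left_mono) (simp_all add: sum_nonneg prod_nonneg)
        also have "\<dots> = (2 * 4 ^ D * (1 + d\<^sup>2)) * T ^ 6 / real n" by (simp add: power_add[symmetric] mult_ac)
        also have "\<dots> \<le> (T ^ (2 * D - 2) * (3 ^ D * (8 * d\<^sup>2 + 2))) * T ^ 6 / real n"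
          using T_pos by (intro divide_right_mono mult_right_mono generic(2)) simp_all
        also have "\<dots> = \<eta> * T ^ (2 * D + 4) / real n"
        proof -
          have "2 * D + 4 = (2 * D - 2) + 6" using D by simp
          then have "T ^ (2 * D + 4) = T ^ (2 * D - 2) * T ^ 6" by (simp only: power_add)
          then show ?thesis by (simp add: \<eta> mult_ac)
        qed
        finally show ?thesis .
      qed
      have V0: "0 \<le> V" unfolding V_def by (intro mult_nonneg_nonneg add_nonneg_nonneg sum_nonneg prod_nonneg) simp_all
      have "risk n P c N \<le> ennreal (K * v)" if "c \<in> copula_class \<beta> L" "has_copula_density P c" for P c
      proof -
        interpret copula_class_law P c \<beta> L using law that by blast
        have "bias N \<le> L / t"
        proof (rule bias_le_coord[OF t_pos])
          fix m :: "nat ^ 'd" assume "\<not> m \<le> N"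
          then obtain i where "N $ i < m $ i" by (auto simp: less_eq_vec_def not_le)
          then have "t powr (1 / \<beta> $ i) \<le> real (m $ i)" unfolding N_def by simp linarith
          then have "(t powr (1 / \<beta> $ i)) powr (\<beta> $ i) \<le> real (m $ i) powr (\<beta> $ i)"
            using \<beta>[of i] by (intro powr_mono2) simp_all
          then have "t \<le> real (m $ i) powr (\<beta> $ i)" using \<beta>[of i] t_pos by (simp add: powr_powr)
          then show "\<exists>i. t \<le> real (m $ i) powr (\<beta> $ i)" ..
        qed
        also have "L / t \<le> L * d / t" using L d2 t_pos by (intro divide_right_mono) simp_all
        finally have "V + bias N \<le> K * v" using V Kv by linarith
        moreover have "risk n P c N \<le> ennreal (V + bias N)"
          unfolding V_def using n V0[unfolded V_def]
          by (intro risk_le[OF integrable_square estimation_error_polynomial_le]) simp_all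
        ultimately show ?thesis using order_trans ennreal_leI by blast
      qed
      moreover have "N \<noteq> 0"
      proof
        assume "N = 0"
        then show False using N1[of undefined] by simp
      qed
      ultimately show ?thesis by blast
    next
      case thin
      have t1: "1 < t" using thin(1) d2 by linarith
      note T1 = T_ge_1[OF t1]
      note sm = small_spread_consequences[OF D T1, of b, folded t_def d, OF thin]
      have T_le_2: "T \<le> 2"
      proof (rule power2_le_imp_le)
        show "T\<^sup>2 \<le> 2\<^sup>2" using sm(3) by simp
      qed simp
      have L_eq: "L = (2 * real D + 4) * (3 ^ D * (8 * (real D)\<^sup>2 + 2)) * (T ^ (2 * D + 4) * T powr b) / (real D * b) / real n"
      proof -
        have "k * e * (L * b * d / (e * k) * real n) / (d * b) / real n = L" if "0 < k" "0 < e" for k e :: real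
          using that n b d2 by simp
        from this[of "2 * d + 4" \<eta>] have "(2 * d + 4) * \<eta> * (A * real n) / (d * b) / real n = L"
          unfolding A_def using d2 \<eta>_pos by simp
        then show ?thesis unfolding Tt[symmetric] unfolding t_def \<eta> d by (rule sym)
      qed
      have "L \<le> (2 * real D + 4) * (3 ^ D * (8 * (real D)\<^sup>2 + 2)) * (T ^ (2 * D + 4) * T powr b) / (real D * b)" (is "L \<le> ?X")
      proof -
        have "0 \<le> ?X" using T_pos b by (intro divide_nonneg_nonneg mult_nonneg_nonneg add_nonneg_nonneg) simp_all
        then have "?X / real n \<le> ?X / 1" using n by (intro divide_left_mono) simp_all
        then show ?thesis using L_eq by simp
      qed
      from coefficient_tail_le[OF sm(1,2) T1 sm(3,4) this]
      have tail: "L * (6 / 5) ^ D / 2 powr (real (D div 8 + 1) * b) \<le> 1 / 20" .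
      have bias1: "copula_law.bias c 1 \<le> L * d / t" and energy: "6 * copula_law.multilinear_energy P \<le> 3 ^ D"
        if "c \<in> copula_class \<beta> L" "has_copula_density P c" for P c
      proof -
        interpret copula_class_law P c \<beta> L using law that by blast
        have "bias 1 \<le> L / t"
        proof (rule bias_le_coord[OF t_pos])
          fix m :: "nat ^ 'd" assume "\<not> m \<le> 1"
          then obtain i where "1 < m $ i" by (auto simp: less_eq_vec_def not_le)
          then have m2: "2 \<le> real (m $ i)" by simp
          have "t \<le> 2 powr b" unfolding t_def using T_le_2 T_pos b by (intro powr_mono2) simp_all
          also have "\<dots> \<le> 2 powr (\<beta> $ i)" using b_le[of i] by (intro powr_mono) simp_all
          also have "\<dots> \<le> real (m $ i) powr (\<beta> $ i)" using m2 \<beta>[of i] by (intro powr_mono2) simp_all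
          finally show "\<exists>i. t \<le> real (m $ i) powr (\<beta> $ i)" ..
        qed
        also have "L / t \<le> L * d / t" using L d2 t_pos by (intro divide_right_mono) simp_all
        finally show "bias 1 \<le> L * d / t" .
        show "6 * multilinear_energy \<le> 3 ^ D"
          unfolding D_def using multilinear_energy_class_le[OF b_eq b] sm(1) tail by (simp add: D_def)
      qed
      have T_pow: "1 \<le> T ^ (2 * D + 4)" using T1 by (rule one_le_power)
      show ?thesis
      \<comment> \<open>Here \<open>\<eta> = 3 ^ D (8 d\<^sup>2 + 2)\<close> and the energy is at most \<open>3 ^ D / 6\<close>: below this threshold the energy itself is at most
      \<open>\<eta> / n\<close>, above it the rank bound with its requirement \<open>n \<ge> 48 d\<^sup>2\<close> applies.\<close>
      proof (cases "real n \<le> 6 * (8 * d\<^sup>2 + 2)")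
        case True
        have "risk n P c (axis undefined 1) \<le> ennreal (K * v)"
          if "c \<in> copula_class \<beta> L" "has_copula_density P c" for P c
        proof -
          interpret copula_class_law P c \<beta> L using law that by blast
          have "multilinear_energy * real n \<le> (3 ^ D / 6) * (6 * (8 * d\<^sup>2 + 2))"
            using energy[OF that] True by (intro mult_mono) (simp_all add: multilinear_energy_nonneg)
          also have "\<dots> = \<eta> * 1" by (simp add: \<eta>)
          also have "\<dots> \<le> \<eta> * T ^ (2 * D + 4)" using \<eta>_pos by (intro mult_left_mono T_pow) simp
          finally have "multilinear_energy \<le> \<eta> * T ^ (2 * D + 4) / real n" using n by (simp add: pos_le_divide_eq)
          then have "multilinear_energy + L * d / t \<le> K * v" using Kv by linarith
          then show ?thesis
            using risk_axis_le_energy[OF bias1[OF that]] order_trans ennreal_leI by blast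
        qed
        then show ?thesis using axis_ne by blast
      next
        case False
        have n48: "48 * (real CARD('d))\<^sup>2 \<le> real n" using False by (simp add: d D_def)
        have "(5::real)\<^sup>2 \<le> (real CARD('d))\<^sup>2" using sm(1) by (intro power_mono) (simp_all add: D_def)
        then have "1200 \<le> real n" using n48 by simp
        then have n1200: "1200 \<le> n" by simp
        have "risk n P c 1 \<le> ennreal (K * v)" if "c \<in> copula_class \<beta> L" "has_copula_density P c" for P c
        proof -
          interpret copula_class_law P c \<beta> L using law that by blast
          define V where "V = (2 + 46 * (real CARD('d))\<^sup>2) * multilinear_energy / real n"
          have "(2 + 46 * d\<^sup>2) * multilinear_energy \<le> (6 * (8 * d\<^sup>2 + 2)) * (3 ^ D / 6)"
            using energy[OF that] by (intro mult_mono) (simp_all add: multilinear_energy_nonneg)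
          also have "\<dots> = \<eta> * 1" by (simp add: \<eta>)
          also have "\<dots> \<le> \<eta> * T ^ (2 * D + 4)" using \<eta>_pos by (intro mult_left_mono T_pow) simp
          finally have "V \<le> \<eta> * T ^ (2 * D + 4) / real n"
            unfolding V_def by (intro divide_right_mono) (simp_all add: d D_def)
          then have le: "V + L * d / t \<le> K * v" using Kv by linarith
          have "0 \<le> V" by (simp add: V_def multilinear_energy_nonneg)
          then have "risk n P c 1 \<le> ennreal (V + L * d / t)"
            unfolding V_def
            by (intro risk_le[OF integrable_square estimation_error_multilinear_le[OF n48 n1200] _ bias1[OF that]])
          then show ?thesis using le order_trans ennreal_leI by blast
        qed
        moreover have "(1 :: nat ^ 'd) \<noteq> 0" by (simp add: vec_eq_iff)
        ultimately show ?thesis by blast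
      qed
    qed
  qed
  then obtain N :: "nat ^ 'd" where N: "N \<noteq> 0"
    and risk: "\<And>c P. c \<in> copula_class \<beta> L \<Longrightarrow> has_copula_density P c \<Longrightarrow> risk n P c N \<le> ennreal (K * v)"
    by blast
  show ?thesis
    unfolding projection_minimax_risk_def
  proof (rule INF_lower2)
    show "N \<in> {N. N \<noteq> 0}" using N by simp
    show "(SUP c\<in>copula_class \<beta> L. SUP P\<in>{P. has_copula_density P c}. risk n P c N) \<le> ennreal (K * v)"
      by (intro SUP_least) (simp add: risk)
  qed
qed

end
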